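(* For every $\theta\in\mathbb{R}\setminus\mathbb{Q}$ and every $1<p<\infty$ with $p\ne2$, there exists $\phi:\mathbb{Z}^2\to\mathbb{C}$ such that $M_\phi$ is bounded on $L_p(\mathbb{T}^2)$, i.e. $\|M_\phi:L_p(\mathbb{T}^2)\to L_p(\mathbb{T}^2)\|<\infty$, but $M_\phi$ is not bounded on $L_p(\mathbb{T}^2_\theta)$, i.e. $\|M_\phi:L_p(\mathbb{T}^2_\theta)\to L_p(\mathbb{T}^2_\theta)\|=\infty$.
   Context: For $\theta\in\mathbb{R}$, $\mathcal{A}^2_\theta$ is the universal $C^*$-algebra generated by unitaries $U_\theta,V_\theta$ with $U_\theta V_\theta=e^{2\pi i\theta}V_\theta U_\theta$, with trace $\tau(U_\theta^kV_\theta^l)=\delta_{k,0}\delta_{l,0}$; $L_\infty(\mathbb{T}^2_\theta)$ is the GNS von Neumann algebra and $L_p(\mathbb{T}^2_\theta)$ its noncommutative $L_p$-spaces; $\theta=0$ gives the classical $L_p(\mathbb{T}^2)$. For $\phi:\mathbb{Z}^2\to\mathbb{C}$, $M_\phi(U_\theta^kV_\theta^l)=\phi(k,l)U_\theta^kV_\theta^l$ on polynomials, and $\|M_\phi\|$ on $L_p$ is the norm of its extension, $+\infty$ if it does not extend boundedly. *)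

theory Defs
  imports "HOL-Analysis.Analysis"
begin

(* Polynomials in the rotation algebra A_theta: x = sum a(k,l) U^k V^l,
   represented by their finitely supported coefficient function. *)

definition nc_poly :: "(int \<times> int \<Rightarrow> complex) \<Rightarrow> bool" where
  "nc_poly a \<longleftrightarrow> finite {m. a m \<noteq> 0}"

(* (U^k V^l)(U^k' V^l') = e^{-2 pi i theta l k'} U^(k+k') V^(l+l'),
   from U V = e^{2 pi i theta} V U. *)
definition nc_mult :: "real \<Rightarrow> (int \<times> int \<Rightarrow> complex) \<Rightarrow> (int \<times> int \<Rightarrow> complex) \<Rightarrow> (int \<times> int \<Rightarrow> complex)" where
  "nc_mult \<theta> a b = (\<lambda>(k, l). \<Sum>j\<in>{j. a j \<noteq> 0}.
      a j * b (k - fst j, l - snd j) * cis (- 2 * pi * \<theta> * of_int (snd j) * of_int (k - fst j)))"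

(* (U^k V^l)^* = V^{-l} U^{-k} = e^{-2 pi i theta k l} U^{-k} V^{-l} *)
definition nc_adj :: "real \<Rightarrow> (int \<times> int \<Rightarrow> complex) \<Rightarrow> (int \<times> int \<Rightarrow> complex)" where
  "nc_adj \<theta> a = (\<lambda>(k, l). cnj (a (- k, - l)) * cis (- 2 * pi * \<theta> * of_int k * of_int l))"

definition nc_one :: "int \<times> int \<Rightarrow> complex" where
  "nc_one = (\<lambda>m. if m = (0, 0) then 1 else 0)"

fun nc_pow :: "real \<Rightarrow> (int \<times> int \<Rightarrow> complex) \<Rightarrow> nat \<Rightarrow> (int \<times> int \<Rightarrow> complex)" where
  "nc_pow \<theta> a 0 = nc_one"
| "nc_pow \<theta> a (Suc n) = nc_mult \<theta> a (nc_pow \<theta> a n)"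

definition nc_trace :: "(int \<times> int \<Rightarrow> complex) \<Rightarrow> complex" where
  "nc_trace a = a (0, 0)"

(* Distribution of x^* x with respect to tau: the compactly supported Borel
   measure on [0, oo) whose moments are tau((x^* x)^n). *)
definition spec_meas :: "real \<Rightarrow> (int \<times> int \<Rightarrow> complex) \<Rightarrow> real measure \<Rightarrow> bool" where
  "spec_meas \<theta> a \<mu> \<longleftrightarrow> sets \<mu> = sets borel \<and> finite_measure \<mu> \<and>
     (\<exists>R. AE t in \<mu>. 0 \<le> t \<and> t \<le> R) \<and>
     (\<forall>n. integrable \<mu> (\<lambda>t. t ^ n) \<and>
          (\<integral>t. t ^ n \<partial>\<mu>) = Re (nc_trace (nc_pow \<theta> (nc_mult \<theta> (nc_adj \<theta> a) a) n)))"

(* ||x||_p = tau(|x|^p)^{1/p} = (int t^{p/2} d mu_{x^* x})^{1/p} *)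
definition nc_Lp_norm :: "real \<Rightarrow> real \<Rightarrow> (int \<times> int \<Rightarrow> complex) \<Rightarrow> real" where
  "nc_Lp_norm \<theta> p a = (\<integral>t. t powr (p / 2) \<partial>(THE \<mu>. spec_meas \<theta> a \<mu>)) powr (1 / p)"

definition fourier_mult :: "(int \<times> int \<Rightarrow> complex) \<Rightarrow> (int \<times> int \<Rightarrow> complex) \<Rightarrow> (int \<times> int \<Rightarrow> complex)" where
  "fourier_mult \<phi> a = (\<lambda>m. \<phi> m * a m)"

(* M_phi extends to a bounded operator on L_p(T^2_theta) (polynomials are dense, p < oo) *)
definition bounded_mult_Lp :: "real \<Rightarrow> real \<Rightarrow> (int \<times> int \<Rightarrow> complex) \<Rightarrow> bool" where
  "bounded_mult_Lp \<theta> p \<phi> \<longleftrightarrow>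
     (\<exists>C. \<forall>a. nc_poly a \<longrightarrow> nc_Lp_norm \<theta> p (fourier_mult \<phi> a) \<le> C * nc_Lp_norm \<theta> p a)"

end

theory Submission
  imports Defs "HOL-Probability.Probability"
begin

text \<open>
  The symbol is \<open>\<phi>(k, l) = \<psi>(k)\<close> where \<open>\<psi>\<close> lives on the frequencies \<open>B^(2i) + B^(2j+1)\<close> and
  takes there the sign of the \<open>(i, j)\<close> entry of Sylvester's infinite Hadamard matrix. Base-\<open>B\<close> digits
  show that these frequencies form a \<open>\<Lambda>(2K)\<close> set, so on \<open>L\<^sub>p(T)\<close> the projection onto them factors
  through \<open>L\<^sub>2\<close> and every bounded symbol on them is an \<open>L\<^sub>p\<close> multiplier; Fubini in the second variable
  gives the bound on \<open>L\<^sub>p(T\<^sup>2)\<close>.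

  For irrational \<open>\<theta>\<close>, let \<open>g\<close> be a bump on the circle whose translates by the finitely many relevant
  multiples of \<open>\<theta>\<close> are disjoint. Then the elements \<open>U\<^bsup>n i\<^esup> g(V) U\<^bsup>m j\<^esup>\<close> multiply like matrix
  units, and \<open>M\<^sub>\<phi>\<close> acts on their span as the Schur multiplier with the Hadamard matrix. On \<open>N \<times> N\<close>
  matrices that multiplier exchanges the all-ones matrix, of Schatten norm \<open>N\<close>, and the Hadamard
  matrix, of Schatten norm \<open>N powr (1/2 + 1/p)\<close>, so its norm is unbounded in \<open>N\<close> unless \<open>p = 2\<close>.
  Replacing \<open>g\<close> by trigonometric polynomials makes the elements polynomials; the norms converge
  because the moments of the spectral measures do. The spectral measure of a polynomial exists by
  the Hausdorff moment problem.
\<close>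

section \<open>Moment problems and convergence of moments\<close>

text \<open>At \<open>\<theta> = 0\<close> the factor \<open>g(V)\<close> commutes past the powers
  of \<open>U\<close>, and what remains is the scalar sum of the \<open>A i j U^(n i + m j)\<close>:
  on a Lambda set its L_p norm is comparable to the l_2 norm of the coefficients and blind to signs.
  For irrational \<theta> the powers on the two sides of \<open>g(V)\<close> keep \<open>i\<close>
  and \<open>j\<close> apart, although only their sum \<open>n i + m j\<close> is visible to the
  symbol. The frequencies form a sum set, hence (n i + m j) + (n i' + m j') = (n i + m j') + (n i' +
  m j): representations are not unique up to order, merely bounded in number for fixed
  \<open>K\<close>. The base \<open>B\<close> must exceed \<open>K\<close> and so depends on
  \<open>p\<close>. The limit has one obstacle. The moments of order k >= 1 converge to a constant
  times those of a probability law, while order 0 stays 1; the difference is mass at 0. Convergence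
  of moments is therefore used only for orders >= 1 and for test functions vanishing at 0, such as
  t^(p/2). No operator algebra is built: elements are coefficient functions, and they act on
  sequences along the orbits of the rotation, with the trace recovered by averaging over the
  starting point.\<close>

lemma continuous_approx_by_power_sum:
  fixes f :: "real \<Rightarrow> real"
  assumes "continuous_on {0..R} f" "f 0 = 0" "R \<ge> 0" "e > 0"
  obtains c d where "\<And>x. x \<in> {0..R} \<Longrightarrow> \<bar>f x - (\<Sum>i=1..d. c i * x ^ i)\<bar> < e"
proof -
  obtain q where q: "real_polynomial_function q" "\<And>x. x \<in> {0..R} \<Longrightarrow> \<bar>f x - q x\<bar> < e/2"
    using Stone_Weierstrass_real_polynomial_function[of "{0..R}" f "e/2"] assms by auto
  obtain a n where an: "q = (\<lambda>x. \<Sum>i\<le>n. a i * x ^ i)"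
    using q(1) real_polynomial_function_iff_sum by blast
  have split: "(\<Sum>i\<le>n. a i * x ^ i) = a 0 + (\<Sum>i=1..n. a i * x ^ i)" for x :: real
    using sum.atLeast_Suc_atMost[of 0 n "\<lambda>i. a i * x ^ i"] by (simp add: atMost_atLeast0)
  have a0: "\<bar>a 0\<bar> < e/2"
    using q(2)[of 0] assms unfolding an by (simp add: power_0_left if_distrib cong: if_cong)
  have "\<bar>f x - (\<Sum>i=1..n. a i * x ^ i)\<bar> < e" if "x \<in> {0..R}" for x
    using q(2)[OF that] a0 unfolding an split by linarith
  then show ?thesis by (rule that)
qed

lemma (in prob_space) abs_integral_diff_le:
  fixes f g :: "'a \<Rightarrow> real"
  assumes "integrable M f" "integrable M g" "AE x in M. \<bar>f x - g x\<bar> \<le> e"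
  shows "\<bar>(\<integral>x. f x \<partial>M) - (\<integral>x. g x \<partial>M)\<bar> \<le> e"
proof -
  have "\<bar>(\<integral>x. f x \<partial>M) - (\<integral>x. g x \<partial>M)\<bar> = \<bar>\<integral>x. f x - g x \<partial>M\<bar>"
    using assms by simp
  also have "\<dots> \<le> (\<integral>x. \<bar>f x - g x\<bar> \<partial>M)" by (rule integral_abs_bound)
  also have "\<dots> \<le> (\<integral>x. e \<partial>M)"
    using assms by (intro integral_mono_AE) auto
  finally show ?thesis by (simp add: prob_space)
qed

lemma (in prob_space) integrable_comp_continuous:
  fixes f h :: "_ \<Rightarrow> real"
  assumes "continuous_on {0..R} f" "f \<in> borel_measurable borel" "h \<in> borel_measurable M"
    "AE x in M. 0 \<le> h x \<and> h x \<le> R"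
  shows "integrable M (\<lambda>x. f (h x))"
proof -
  have "bounded (f ` {0..R})"
    using assms(1) compact_continuous_image compact_imp_bounded by blast
  then obtain B where B: "\<And>x. x \<in> {0..R} \<Longrightarrow> \<bar>f x\<bar> \<le> B"
    unfolding bounded_iff by (metis image_eqI real_norm_def)
  show ?thesis
    by (rule integrable_const_bound[where B = B])
       (use assms B in \<open>auto intro: measurable_compose\<close>)
qed

text \<open>Uniform approximation of \<open>f\<close> on \<open>[0, R]\<close> by polynomials
  without constant term reduces the claim to moments of order >= 1. Order 0 has to be left out:
  every \<open>\<mu> s\<close> has mass 1, the limit functional has mass \<open>c\<close>. The
  common \<open>R\<close> makes the approximation uniform in \<open>s\<close>.\<close>

lemma moments_convergence:
  fixes \<mu> :: "nat \<Rightarrow> real measure" and h :: "'a \<Rightarrow> real"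
  assumes \<mu>: "\<And>s. prob_space (\<mu> s)" "\<And>s. sets (\<mu> s) = sets borel"
    and supp: "\<And>s. AE t in \<mu> s. 0 \<le> t \<and> t \<le> R"
    and M: "prob_space M" "h \<in> borel_measurable M" "AE x in M. 0 \<le> h x \<and> h x \<le> R"
    and mom: "\<And>n. n \<ge> 1 \<Longrightarrow> (\<lambda>s. \<integral>t. t ^ n \<partial>\<mu> s) \<longlonglongrightarrow> c * (\<integral>x. h x ^ n \<partial>M)"
    and f: "continuous_on {0..R} f" "f 0 = 0" "f \<in> borel_measurable borel" and "R \<ge> 0"
  shows "(\<lambda>s. \<integral>t. f t \<partial>\<mu> s) \<longlonglongrightarrow> c * (\<integral>x. f (h x) \<partial>M)"
proof (rule LIMSEQ_I)
  fix e :: real assume "e > 0"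
  interpret M: prob_space M by fact
  \<comment> \<open>The approximation costs \<open>d\<close> under \<open>\<mu> s\<close> and at
    most |c| d under \<open>M\<close>, together e/2; the moments of the polynomial cost a further
    e/4.\<close>
  define d where "d = e / (2 * (1 + \<bar>c\<bar>))"
  have d: "d > 0" using \<open>e > 0\<close> by (simp add: d_def add_pos_nonneg)
  obtain a n where q: "\<And>x. x \<in> {0..R} \<Longrightarrow> \<bar>f x - (\<Sum>i=1..n. a i * x ^ i)\<bar> < d"
    using continuous_approx_by_power_sum[OF f(1,2) \<open>R \<ge> 0\<close> d] by metis
  let ?q = "\<lambda>x::real. \<Sum>i=1..n. a i * x ^ i"
  have pint: "integrable M (\<lambda>x. h x ^ i)" for i
    by (rule M.integrable_comp_continuous[OF _ _ M(2,3)]) (auto intro!: continuous_intros)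
  have \<mu>int: "integrable (\<mu> s) (\<lambda>x. g x)" if "continuous_on {0..R} g" "g \<in> borel_measurable borel" for g :: "real \<Rightarrow> real" and s
  proof -
    interpret prob_space "\<mu> s" by fact
    have "(\<lambda>x. x) \<in> borel_measurable (\<mu> s)" using \<mu>(2)[of s] by (simp add: measurable_ident_sets)
    from integrable_comp_continuous[of R g "\<lambda>x. x", OF that this] supp[of s] show ?thesis by simp
  qed
  have "(\<lambda>s. \<Sum>i=1..n. a i * (\<integral>t. t ^ i \<partial>\<mu> s)) \<longlonglongrightarrow> (\<Sum>i=1..n. a i * (c * (\<integral>x. h x ^ i \<partial>M)))"
    by (intro tendsto_intros mom) auto
  also have "(\<lambda>s. \<Sum>i=1..n. a i * (\<integral>t. t ^ i \<partial>\<mu> s)) = (\<lambda>s. \<integral>t. ?q t \<partial>\<mu> s)"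
  proof
    fix s
    have "integrable (\<mu> s) (\<lambda>x. x ^ i)" for i by (rule \<mu>int) (auto intro!: continuous_intros)
    then show "(\<Sum>i=1..n. a i * (\<integral>t. t ^ i \<partial>\<mu> s)) = (\<integral>t. ?q t \<partial>\<mu> s)"
      by (subst Bochner_Integration.integral_sum) auto
  qed
  also have "(\<Sum>i=1..n. a i * (c * (\<integral>x. h x ^ i \<partial>M))) = c * (\<integral>x. ?q (h x) \<partial>M)"
    using pint by (subst Bochner_Integration.integral_sum) (auto simp: sum_distrib_left mult_ac)
  finally obtain s0 where s0: "\<And>s. s \<ge> s0 \<Longrightarrow> \<bar>(\<integral>t. ?q t \<partial>\<mu> s) - c * (\<integral>x. ?q (h x) \<partial>M)\<bar> < e / 4"
    using LIMSEQ_D[of _ _ "e/4"] \<open>e > 0\<close> by fastforce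
  have 1: "\<bar>(\<integral>t. f t \<partial>\<mu> s) - (\<integral>t. ?q t \<partial>\<mu> s)\<bar> \<le> d" for s
  proof -
    interpret prob_space "\<mu> s" by fact
    show ?thesis
      using supp[of s] q
      by (intro abs_integral_diff_le \<mu>int f) (auto intro!: continuous_intros less_imp_le)
  qed
  have qint: "integrable M (\<lambda>x. ?q (h x))" using pint by auto
  have 2: "\<bar>(\<integral>x. f (h x) \<partial>M) - (\<integral>x. ?q (h x) \<partial>M)\<bar> \<le> d"
    using M q
    by (intro M.abs_integral_diff_le M.integrable_comp_continuous[OF _ _ M(2,3)] f qint)
       (auto intro!: continuous_intros less_imp_le)
  have 3: "\<bar>c * (\<integral>x. f (h x) \<partial>M) - c * (\<integral>x. ?q (h x) \<partial>M)\<bar> \<le> \<bar>c\<bar> * d"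
    using mult_left_mono[OF 2, of "\<bar>c\<bar>"] by (simp add: abs_mult[symmetric] right_diff_distrib)
  have 4: "d + \<bar>c\<bar> * d = e / 2"
  proof -
    have "k * (e / (2 * k)) = e / 2" if "k \<noteq> 0" for k using that by simp
    from this[of "1 + \<bar>c\<bar>"] have "(1 + \<bar>c\<bar>) * d = e / 2" unfolding d_def by linarith
    then show ?thesis by (simp add: algebra_simps)
  qed
  show "\<exists>s0. \<forall>s\<ge>s0. norm ((\<integral>t. f t \<partial>\<mu> s) - c * (\<integral>x. f (h x) \<partial>M)) < e"
  proof (intro exI allI impI)
    fix s assume "s \<ge> s0"
    from s0[OF this] 1[of s] 3 4 \<open>e > 0\<close>
    show "norm ((\<integral>t. f t \<partial>\<mu> s) - c * (\<integral>x. f (h x) \<partial>M)) < e" unfolding real_norm_def by linarith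
  qed
qed

text \<open>Convergence of moments for a constant sequence with \<open>c = 1\<close> gives equal
  integrals of all continuous functions vanishing at 0. The functions cos(u t) - 1 and sin(u t) are
  of this kind, so the characteristic functions agree.\<close>

lemma moments_determine_measure:
  fixes \<mu> \<nu> :: "real measure"
  assumes \<mu>: "prob_space \<mu>" "sets \<mu> = sets borel" "AE t in \<mu>. 0 \<le> t \<and> t \<le> R"
    and \<nu>: "prob_space \<nu>" "sets \<nu> = sets borel" "AE t in \<nu>. 0 \<le> t \<and> t \<le> R'"
    and mom: "\<And>n. (\<integral>t. t ^ n \<partial>\<mu>) = (\<integral>t. t ^ n \<partial>\<nu>)"
  shows "\<mu> = \<nu>"
proof -
  interpret m: real_distribution \<mu> using \<mu> by (simp add: real_distribution_def real_distribution_axioms_def)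
  interpret n: real_distribution \<nu> using \<nu> by (simp add: real_distribution_def real_distribution_axioms_def)
  define S where "S = max 0 (max R R')"
  have S: "AE t in \<mu>. 0 \<le> t \<and> t \<le> S" "AE t in \<nu>. 0 \<le> t \<and> t \<le> S" "S \<ge> 0"
    using \<mu>(3) \<nu>(3) by (auto simp: S_def)
  have eq0: "(\<integral>t. f t \<partial>\<mu>) = (\<integral>t. f t \<partial>\<nu>)"
    if "continuous_on UNIV f" "f 0 = 0" for f :: "real \<Rightarrow> real"
  proof -
    have "(\<lambda>s::nat. \<integral>t. f t \<partial>\<mu>) \<longlonglongrightarrow> 1 * (\<integral>x. f x \<partial>\<nu>)"
      by (rule moments_convergence[where R = S])
         (use S \<mu> \<nu> mom that in \<open>auto intro: borel_measurable_continuous_onI continuous_on_subset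
            simp: measurable_ident_sets\<close>)
    then show ?thesis by (simp add: LIMSEQ_const_iff)
  qed
  have icos: "integrable \<mu> (\<lambda>t. cos (u * t))" "integrable \<nu> (\<lambda>t. cos (u * t))"
   and isin: "integrable \<mu> (\<lambda>t. sin (u * t))" "integrable \<nu> (\<lambda>t. sin (u * t))" for u :: real
    by (auto intro!: m.integrable_const_bound[where B=1] n.integrable_const_bound[where B=1]
        simp: abs_cos_le_one abs_sin_le_one)
  have "(\<integral>t. cos (u * t) \<partial>\<mu>) = (\<integral>t. cos (u * t) \<partial>\<nu>)" for u
    using eq0[of "\<lambda>t. cos (u * t) - 1"] icos[of u]
      m.prob_space n.prob_space by (simp add: continuous_intros)
  moreover have "(\<integral>t. sin (u * t) \<partial>\<mu>) = (\<integral>t. sin (u * t) \<partial>\<nu>)" for u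
    using eq0[of "\<lambda>t. sin (u * t)"] by (simp add: continuous_intros)
  moreover have "char M u = Complex (\<integral>t. cos (u * t) \<partial>M) (\<integral>t. sin (u * t) \<partial>M)"
    if "real_distribution M" for M u
  proof -
    interpret real_distribution M by fact
    have "integrable M (\<lambda>t. cis (u * t))"
      by (rule integrable_const_bound[where B=1])
        (auto simp: cis_conv_exp)
    moreover have "char M u = (\<integral>t. cis (u * t) \<partial>M)" by (simp add: char_def cis_conv_exp)
    ultimately show ?thesis
      by (intro complex_eqI) (simp_all flip: integral_Re integral_Im)
  qed
  ultimately have "char \<mu> = char \<nu>"
    using m.real_distribution_axioms n.real_distribution_axioms by auto
  then show ?thesis
    by (intro Levy_uniqueness m.real_distribution_axioms n.real_distribution_axioms)
qed

text \<open>\<open>D k l\<close> stands for the integral of t^k (1 - t)^l against a measure still to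
  be found. The hypothesis is then 1 = t + (1 - t), and the conclusion is the binomial expansion of
  its N-th power.\<close>

lemma Bernstein_weights_sum:
  fixes D :: "nat \<Rightarrow> nat \<Rightarrow> real"
  assumes "\<And>k l. D k l = D (Suc k) l + D k (Suc l)"
  shows "(\<Sum>i\<le>N. real (N choose i) * D (j + i) (l + (N - i))) = D j l"
proof (induction N arbitrary: j l)
  case 0
  then show ?case by simp
next
  case (Suc N)
  have "(\<Sum>i\<le>Suc N. real (Suc N choose i) * D (j + i) (l + (Suc N - i)))
    = D j (l + Suc N) + (\<Sum>i\<le>N. real (Suc N choose Suc i) * D (j + Suc i) (l + (N - i)))"
    by (subst sum.atMost_Suc_shift) simp
  also have "(\<Sum>i\<le>N. real (Suc N choose Suc i) * D (j + Suc i) (l + (N - i)))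
    = (\<Sum>i\<le>N. real (N choose i) * D (Suc j + i) (l + (N - i))) +
      (\<Sum>i\<le>N. real (N choose Suc i) * D (j + Suc i) (l + (N - i)))"
    by (simp add: sum.distrib algebra_simps)
  also have "(\<Sum>i\<le>N. real (N choose i) * D (Suc j + i) (l + (N - i))) = D (Suc j) l"
    by (rule Suc.IH)
  also have "D j (l + Suc N) + (D (Suc j) l + (\<Sum>i\<le>N. real (N choose Suc i) * D (j + Suc i) (l + (N - i))))
    = D (Suc j) l + (\<Sum>i\<le>Suc N. real (N choose i) * D (j + i) (l + (Suc N - i)))"
    by (subst sum.atMost_Suc_shift) simp
  also have "(\<Sum>i\<le>Suc N. real (N choose i) * D (j + i) (l + (Suc N - i)))
     = (\<Sum>i\<le>N. real (N choose i) * D (j + i) (Suc l + (N - i)))"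
    by (simp add: Suc_diff_le)
  also have "\<dots> = D j (Suc l)" by (rule Suc.IH)
  finally show ?case using assms[of j l] by simp
qed

text \<open>The two products have all factors in [0, 1] and differ in the i-th factor by at most i/n
  <= j/n, so the errors add up over the j factors. Truncated subtraction gives the value 0 for i >=
  k, in accordance with the vanishing of the falling factorial.\<close>

lemma falling_quotient_approx:
  assumes "k \<le> n" "n > 0"
  shows "\<bar>(\<Prod>i<j. real (k - i) / real (n - i)) - (real k / real n) ^ j\<bar> \<le> real (j * j) / real n"
proof -
  have *: "real (k - i) / real (n - i) \<le> 1 \<and> \<bar>real (k - i) / real (n - i) - real k / real n\<bar> \<le> real i / real n" for i
  proof (cases "i \<le> k \<and> i < n")
    case True
    have le: "(real k - real i) * real n \<le> (real n - real i) * real k"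
      using assms True by (simp add: algebra_simps mult_left_mono)
    have "(real k - real i) / (real n - real i) + real i / real n - real k / real n
        = real i * (real k - real i) / (real n * (real n - real i))"
      using assms True by (simp add: of_nat_diff field_simps)
    also have "\<dots> \<ge> 0" using True assms by (intro divide_nonneg_nonneg mult_nonneg_nonneg) auto
    finally have "real k / real n - (real k - real i) / (real n - real i) \<le> real i / real n" by linarith
    then have "real k / real n - real (k - i) / real (n - i) \<le> real i / real n"
      using assms True by (simp add: of_nat_diff)
    moreover have "real (k - i) / real (n - i) \<le> real k / real n"
      using le assms True by (simp add: of_nat_diff field_simps)
    moreover have "real k / real n \<le> 1" using assms by simp
    ultimately show ?thesis by auto
  next
    case False
    then have "k \<le> i" using assms by auto
    then show ?thesis using assms by (simp add: divide_right_mono)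
  qed
  have "norm ((\<Prod>i\<in>{..<j}. real (k - i) / real (n - i)) - (\<Prod>i\<in>{..<j}. real k / real n))
     \<le> (\<Sum>i\<in>{..<j}. norm (real (k - i) / real (n - i) - real k / real n))"
    using * assms by (intro norm_prod_diff) (auto simp del: of_nat_diff)
  also have "\<dots> \<le> (\<Sum>i\<in>{..<j}. real j / real n)"
  proof (rule sum_mono)
    fix i assume "i \<in> {..<j}"
    then have "real i / real n \<le> real j / real n" by (simp add: divide_right_mono)
    with * [of i] show "norm (real (k - i) / real (n - i) - real k / real n) \<le> real j / real n"
      unfolding real_norm_def by (meson order_trans)
  qed
  finally show ?thesis by simp
qed

lemma binomial_falling_quotient:
  assumes "j \<le> n" "j \<le> k" "k \<le> n"
  shows "real (n choose k) * (\<Prod>i<j. real (k - i) / real (n - i)) = real ((n - j) choose (k - j))"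
  using assms
proof (induction j)
  case 0
  then show ?case by simp
next
  case (Suc j)
  then have *: "Suc (n - Suc j) = n - j" "Suc (k - Suc j) = k - j" by auto
  have "real (k - j) * real ((n - j) choose (k - j)) = real (n - j) * real ((n - Suc j) choose (k - Suc j))"
    using Suc_times_binomial_eq[of "n - Suc j" "k - Suc j"] unfolding *
    by (metis mult.commute of_nat_mult)
  moreover have "real (n choose k) * (\<Prod>i<Suc j. real (k - i) / real (n - i))
     = real ((n - j) choose (k - j)) * (real (k - j) / real (n - j))"
    using Suc by (simp add: mult.assoc[symmetric])
  ultimately show ?case using Suc.prems by (simp add: field_simps del: of_nat_diff)
qed

text \<open>The falling quotient turns \<open>n choose k\<close> into
  \<open>(n - j) choose (k - j)\<close>, so the weight sum for n - j applies. Falling moments of the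
  Bernstein weights are thus exact, and ordinary moments are off by O(1/n) only.\<close>

lemma Bernstein_weights_falling_moment:
  fixes D :: "nat \<Rightarrow> nat \<Rightarrow> real"
  assumes rec: "\<And>k l. D k l = D (Suc k) l + D k (Suc l)" and "j \<le> n"
  shows "(\<Sum>k\<le>n. real (n choose k) * D k (n - k) * (\<Prod>i<j. real (k - i) / real (n - i))) = D j 0"
proof -
  have "(\<Sum>k\<le>n. real (n choose k) * D k (n - k) * (\<Prod>i<j. real (k - i) / real (n - i)))
     = (\<Sum>k\<in>{j..n}. real ((n - j) choose (k - j)) * D k (n - k))"
  proof (rule sum.mono_neutral_cong_right)
    show "\<forall>k\<in>{..n} - {j..n}. real (n choose k) * D k (n - k) * (\<Prod>i<j. real (k - i) / real (n - i)) = 0"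
    proof
      fix k assume "k \<in> {..n} - {j..n}"
      then have "k < j" by auto
      then have "(\<Prod>i<j. real (k - i) / real (n - i)) = 0" by (intro prod_zero) auto
      then show "real (n choose k) * D k (n - k) * (\<Prod>i<j. real (k - i) / real (n - i)) = 0" by simp
    qed
  next
    fix k assume "k \<in> {j..n}"
    then have "real (n choose k) * (\<Prod>i<j. real (k - i) / real (n - i)) = real ((n - j) choose (k - j))"
      using assms by (intro binomial_falling_quotient) auto
    then show "real (n choose k) * D k (n - k) * (\<Prod>i<j. real (k - i) / real (n - i)) =
        real ((n - j) choose (k - j)) * D k (n - k)"
      by (metis mult.assoc mult.commute)
  qed auto
  also have "\<dots> = (\<Sum>i\<le>n - j. real ((n - j) choose i) * D (j + i) (0 + ((n - j) - i)))"
    using \<open>j \<le> n\<close> by (intro sum.reindex_bij_witness[of _ "\<lambda>i. j + i" "\<lambda>k. k - j"]) auto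
  also have "\<dots> = D j 0" by (rule Bernstein_weights_sum) (rule rec)
  finally show ?thesis .
qed

text \<open>The discrete measures with mass \<open>(n choose k) * D k (n - k)\<close> at k/n live on
  [0, 1] and are tight; any weak limit of a subsequence has the prescribed moments.\<close>

lemma Hausdorff_moment_problem:
  fixes D :: "nat \<Rightarrow> nat \<Rightarrow> real"
  assumes rec: "\<And>k l. D k l = D (Suc k) l + D k (Suc l)" and nonneg: "\<And>k l. D k l \<ge> 0"
    and "D 0 0 = 1"
  shows "\<exists>M. real_distribution M \<and> (AE t in M. 0 \<le> t \<and> t \<le> 1) \<and> (\<forall>j. (\<integral>t. t ^ j \<partial>M) = D j 0)"
proof -
  define w where "w n k = (if k \<le> n then real (n choose k) * D k (n - k) else 0)" for n k
  have w0: "w n k \<ge> 0" for n k using nonneg by (simp add: w_def)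
  have wsum: "(\<Sum>k\<le>n. w n k) = 1" for n
    using Bernstein_weights_falling_moment[of D 0 n, OF rec] \<open>D 0 0 = 1\<close> by (simp add: w_def)
  define P where "P n = embed_pmf (w n)" for n
  have pmf_P: "pmf (P n) k = w n k" for n k
    unfolding P_def
  proof (rule pmf_embed_pmf)
    have "(\<integral>\<^sup>+k. ennreal (w n k) \<partial>count_space UNIV) = (\<Sum>k\<le>n. ennreal (w n k))"
      by (rule nn_integral_count_space'[of "{..n}"]) (auto simp: w_def)
    also have "\<dots> = ennreal (\<Sum>k\<le>n. w n k)" using w0 by (simp add: sum_ennreal)
    finally show "(\<integral>\<^sup>+k. ennreal (w n k) \<partial>count_space UNIV) = 1" using wsum by simp
  qed (rule w0)
  define \<mu> where "\<mu> n = distr (measure_pmf (P n)) borel (\<lambda>k. real k / real n)" for n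
  have rd: "real_distribution (\<mu> n)" for n
    unfolding \<mu>_def by (intro prob_space.real_distribution_distr measure_pmf.prob_space_axioms) simp
  have int\<mu>: "(\<integral>t. f t \<partial>\<mu> n) = (\<Sum>k\<le>n. w n k * f (real k / real n))"
    if [measurable]: "f \<in> borel_measurable borel" for f :: "real \<Rightarrow> real" and n
  proof -
    have "(\<integral>t. f t \<partial>\<mu> n) = (\<integral>k. f (real k / real n) \<partial>measure_pmf (P n))"
      unfolding \<mu>_def by (subst integral_distr) auto
    also have "\<dots> = (\<Sum>k\<in>{..n}. f (real k / real n) * pmf (P n) k)"
      by (rule integral_measure_pmf_real) (auto simp: set_pmf_iff pmf_P w_def split: if_splits)
    finally show ?thesis by (simp add: pmf_P mult.commute)
  qed
  have "tight \<mu>"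
    unfolding tight_def
  proof (intro conjI allI impI rd)
    fix e :: real assume "e > 0"
    have "measure (\<mu> n) {-1<..1} = 1" for n
    proof -
      interpret real_distribution "\<mu> n" by (rule rd)
      have "measure (\<mu> n) {-1<..1} = (\<integral>t. indicator {-1<..1} t \<partial>\<mu> n)" by simp
      also have "\<dots> = (\<Sum>k\<le>n. w n k * indicator {-1<..1} (real k / real n))"
        by (rule int\<mu>) simp
      also have "\<dots> = (\<Sum>k\<le>n. w n k)"
      proof (rule sum.cong)
        fix k assume k: "k \<in> {..n}"
        have "(- 1::real) < 0" by simp
        also have "0 \<le> real k / real n" by simp
        finally have "-1 < real k / real n" .
        moreover have "real k / real n \<le> 1" using k by (auto simp: divide_le_eq_1)
        ultimately show "w n k * indicator {- 1<..1} (real k / real n) = w n k" by simp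
      qed simp
      finally show ?thesis using wsum by simp
    qed
    then show "\<exists>a b. a < b \<and> (\<forall>n. measure (\<mu> n) {a<..b} > 1 - e)"
      using \<open>e > 0\<close> by (intro exI[of _ "-1"] exI[of _ 1]) auto
  qed
  from tight_imp_convergent_subsubsequence[OF this strict_mono_id]
  obtain r M where r: "strict_mono (r :: nat \<Rightarrow> nat)" and M: "real_distribution M"
    and wc: "weak_conv_m (\<mu> \<circ> r) M" by auto
  interpret M: real_distribution M by (rule M)
  have lim: "(\<lambda>n. \<integral>t. f t \<partial>\<mu> (r n)) \<longlonglongrightarrow> (\<integral>t. f t \<partial>M)"
    if "continuous_on UNIV f" "\<And>x. \<bar>f x\<bar> \<le> B" for f :: "real \<Rightarrow> real" and B
    using weak_conv_imp_integral_bdd_continuous_conv[of "\<mu> \<circ> r" M f B] rd M wc that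
    by (auto simp: continuous_on_eq_continuous_at)
  \<comment> \<open>Weak convergence tests bounded continuous functions only, so t^j is replaced by
    \<open>cl t ^ j\<close>, which agrees with it on [0, 1], where all approximants live.\<close>
  define cl where "cl t = max 0 (min 1 t)" for t :: real
  have cl_cont: "continuous_on UNIV cl" unfolding cl_def by (intro continuous_intros)
  have cl_id: "cl t = t" if "0 \<le> t" "t \<le> 1" for t using that by (simp add: cl_def)
  have cl_bd: "0 \<le> cl t" "cl t \<le> 1" for t by (auto simp: cl_def)
  have cl_m [measurable]: "cl \<in> borel_measurable borel"
    using cl_cont by (rule borel_measurable_continuous_onI)
  have supp: "AE t in M. cl t = t"
  proof -
    \<comment> \<open>A bounded continuous function whose zero set is exactly [0, 1]. Its integrals
      under the approximants are 0, hence also under \<open>M\<close>, which locates the support of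
      \<open>M\<close>.\<close>
    define g where "g t = min 1 \<bar>t - cl t\<bar>" for t
    have g_cont: "continuous_on UNIV g" unfolding g_def by (intro continuous_intros cl_cont)
    have gm: "g \<in> borel_measurable borel" using g_cont by (rule borel_measurable_continuous_onI)
    have "(\<lambda>n. \<integral>t. g t \<partial>\<mu> (r n)) \<longlonglongrightarrow> (\<integral>t. g t \<partial>M)"
      by (rule lim[OF g_cont, of 1]) (auto simp: g_def)
    moreover have "(\<integral>t. g t \<partial>\<mu> n) = 0" for n
      unfolding int\<mu>[OF gm]
    proof (rule sum.neutral, rule ballI)
      fix k assume "k \<in> {..n}"
      then have "real k / real n \<le> 1" by (auto simp: divide_le_eq_1)
      then show "w n k * g (real k / real n) = 0" by (simp add: g_def cl_id)
    qed
    ultimately have "(\<integral>t. g t \<partial>M) = 0" by (simp add: LIMSEQ_const_iff)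
    moreover have "integrable M g"
      by (rule M.integrable_const_bound[where B=1]) (use gm in \<open>auto simp: g_def\<close>)
    ultimately have "AE t in M. g t = 0"
      by (subst (asm) integral_nonneg_eq_0_iff_AE) (auto simp: g_def)
    then show ?thesis by eventually_elim (auto simp: g_def min_def split: if_splits)
  qed
  have "(\<integral>t. t ^ j \<partial>M) = D j 0" for j
  proof -
    have c: "continuous_on UNIV (\<lambda>t. cl t ^ j)" by (intro continuous_intros cl_cont)
    have "(\<lambda>n. \<integral>t. cl t ^ j \<partial>\<mu> (r n)) \<longlonglongrightarrow> (\<integral>t. cl t ^ j \<partial>M)"
      by (rule lim[OF c, of 1]) (use cl_bd in \<open>auto simp: power_le_one\<close>)
    moreover have "(\<lambda>n. \<integral>t. cl t ^ j \<partial>\<mu> n) \<longlonglongrightarrow> D j 0"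
    proof (rule LIMSEQ_I)
      fix e :: real assume "e > 0"
      define n0 where "n0 = Suc (max j (nat \<lceil>real (j * j) / e\<rceil>))"
      show "\<exists>n0. \<forall>n\<ge>n0. norm ((\<integral>t. cl t ^ j \<partial>\<mu> n) - D j 0) < e"
      proof (intro exI allI impI)
        fix n assume n: "n \<ge> n0"
        then have nj: "j \<le> n" "n > 0" and "real n > real (j * j) / e" unfolding n0_def by linarith+
        then have small: "real (j * j) / real n < e" using \<open>e > 0\<close> by (simp add: field_simps)
        have "(\<integral>t. cl t ^ j \<partial>\<mu> n) = (\<Sum>k\<le>n. w n k * cl (real k / real n) ^ j)"
          by (rule int\<mu>) simp
        also have "\<dots> = (\<Sum>k\<le>n. w n k * (real k / real n) ^ j)"
        proof (rule sum.cong)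
          fix k assume "k \<in> {..n}"
          then have "real k / real n \<le> 1" by (auto simp: divide_le_eq_1)
          then show "w n k * cl (real k / real n) ^ j = w n k * (real k / real n) ^ j" by (simp add: cl_id)
        qed simp
        also have "\<dots> - D j 0 = (\<Sum>k\<le>n. w n k * ((real k / real n) ^ j - (\<Prod>i<j. real (k - i) / real (n - i))))"
          using Bernstein_weights_falling_moment[of D j n, OF rec nj(1)]
          by (simp add: w_def right_diff_distrib sum_subtractf)
        finally have "\<bar>(\<integral>t. cl t ^ j \<partial>\<mu> n) - D j 0\<bar> \<le>
          (\<Sum>k\<le>n. \<bar>w n k * ((real k / real n) ^ j - (\<Prod>i<j. real (k - i) / real (n - i)))\<bar>)"
          by (simp only: sum_abs)
        also have "\<dots> \<le> (\<Sum>k\<le>n. w n k * (real (j * j) / real n))"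
        proof (rule sum_mono)
          fix k assume "k \<in> {..n}"
          then show "\<bar>w n k * ((real k / real n) ^ j - (\<Prod>i<j. real (k - i) / real (n - i)))\<bar>
              \<le> w n k * (real (j * j) / real n)"
            using falling_quotient_approx[of k n j] w0[of n k] nj
            by (simp only: abs_mult abs_minus_commute abs_of_nonneg mult_left_mono atMost_iff)
        qed
        also have "\<dots> = real (j * j) / real n" using wsum[of n] by (simp only: sum_distrib_right[symmetric] mult_1)
        finally show "norm ((\<integral>t. cl t ^ j \<partial>\<mu> n) - D j 0) < e" using small by simp
      qed
    qed
    from LIMSEQ_subseq_LIMSEQ[OF this r] have "(\<lambda>n. \<integral>t. cl t ^ j \<partial>\<mu> (r n)) \<longlonglongrightarrow> D j 0"
      by (simp add: comp_def)
    ultimately have "(\<integral>t. cl t ^ j \<partial>M) = D j 0" using LIMSEQ_unique by blast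
    moreover have "(\<integral>t. cl t ^ j \<partial>M) = (\<integral>t. t ^ j \<partial>M)"
      by (rule integral_cong_AE) (use supp in auto)
    ultimately show ?thesis by simp
  qed
  moreover have "AE t in M. 0 \<le> t \<and> t \<le> 1"
    using supp by eventually_elim (metis cl_bd)
  ultimately show ?thesis using M by blast
qed

section \<open>The twisted convolution algebra and existence of spectral measures\<close>

text \<open>The 2-cocycle of the twisted convolution: the scalar produced when V^(snd i) is moved
  past U^(fst j).\<close>

definition nc_phase :: "real \<Rightarrow> int \<times> int \<Rightarrow> int \<times> int \<Rightarrow> complex" where
  "nc_phase \<theta> i j = cis (- 2 * pi * \<theta> * of_int (snd i) * of_int (fst j))"

lemma norm_nc_phase [simp]: "norm (nc_phase \<theta> i j) = 1"
  by (simp add: nc_phase_def)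

lemma nc_mult_eq: "nc_mult \<theta> a b m = (\<Sum>j | a j \<noteq> 0. a j * b (m - j) * nc_phase \<theta> j (m - j))"
  by (cases m) (simp add: nc_mult_def nc_phase_def minus_prod_def)

lemma nc_mult_eq_on:
  assumes "finite S" "\<And>j. a j \<noteq> 0 \<Longrightarrow> j \<in> S"
  shows "nc_mult \<theta> a b m = (\<Sum>j\<in>S. a j * b (m - j) * nc_phase \<theta> j (m - j))"
  unfolding nc_mult_eq using assms by (intro sum.mono_neutral_left) auto

lemma nc_adj_eq: "nc_adj \<theta> a m = cnj (a (- m)) * nc_phase \<theta> m m"
  by (cases m) (simp add: nc_adj_def nc_phase_def mult_ac)

lemma nc_phase_cocycle:
  "nc_phase \<theta> i j * nc_phase \<theta> (i + j) k = nc_phase \<theta> i (j + k) * nc_phase \<theta> j k"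
  by (simp add: nc_phase_def cis_mult algebra_simps)

lemma nc_polyI: "finite S \<Longrightarrow> (\<And>m. a m \<noteq> 0 \<Longrightarrow> m \<in> S) \<Longrightarrow> nc_poly a"
  unfolding nc_poly_def by (rule finite_subset) auto

lemma nc_mult_support:
  assumes "nc_mult \<theta> a b m \<noteq> 0"
  shows "\<exists>i j. a i \<noteq> 0 \<and> b j \<noteq> 0 \<and> m = i + j"
proof -
  obtain j where "a j * b (m - j) * nc_phase \<theta> j (m - j) \<noteq> 0"
    using assms unfolding nc_mult_eq by (meson sum.not_neutral_contains_not_neutral)
  then show ?thesis by (intro exI[of _ j] exI[of _ "m - j"]) auto
qed

lemma nc_poly_mult: assumes "nc_poly a" "nc_poly b" shows "nc_poly (nc_mult \<theta> a b)"
  by (rule nc_polyI[of "(\<lambda>(i, j). i + j) ` ({m. a m \<noteq> 0} \<times> {m. b m \<noteq> 0})"])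
     (use assms nc_mult_support in \<open>force simp: nc_poly_def\<close>)+

lemma nc_poly_adj: assumes "nc_poly a" shows "nc_poly (nc_adj \<theta> a)"
  by (rule nc_polyI[of "uminus ` {m. a m \<noteq> 0}"])
     (use assms in \<open>force simp: nc_poly_def nc_adj_eq\<close>)+

lemma nc_poly_one: "nc_poly nc_one"
  by (rule nc_polyI[of "{0}"]) (auto simp: nc_one_def zero_prod_def split: if_splits)

lemma nc_poly_pow: "nc_poly a \<Longrightarrow> nc_poly (nc_pow \<theta> a n)"
  by (induction n) (auto intro: nc_poly_mult nc_poly_one)

lemma nc_poly_fourier_mult: "nc_poly a \<Longrightarrow> nc_poly (fourier_mult \<phi> a)"
  by (rule nc_polyI[of "{m. a m \<noteq> 0}"]) (auto simp: nc_poly_def fourier_mult_def)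

text \<open>Pairing a product with an arbitrary function \<open>G\<close> of the degree becomes a
  double sum over the factors. Associativity, the adjoint relation, evaluation at points of the
  torus and the orbit representation all follow by choosing \<open>G\<close>.\<close>

lemma sum_nc_mult:
  assumes "nc_poly a" "nc_poly b"
  shows "(\<Sum>m | nc_mult \<theta> a b m \<noteq> 0. nc_mult \<theta> a b m * G m)
    = (\<Sum>i | a i \<noteq> 0. \<Sum>j | b j \<noteq> 0. a i * b j * nc_phase \<theta> i j * G (i + j))"
proof -
  let ?A = "{m. a m \<noteq> 0}" and ?B = "{m. b m \<noteq> 0}"
  define S where "S = (\<lambda>(i, j). i + j) ` (?A \<times> ?B)"
  have fin: "finite ?A" "finite ?B" "finite S" using assms by (auto simp: nc_poly_def S_def)
  have "(\<Sum>m | nc_mult \<theta> a b m \<noteq> 0. nc_mult \<theta> a b m * G m) = (\<Sum>m\<in>S. nc_mult \<theta> a b m * G m)"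
    using fin nc_mult_support by (intro sum.mono_neutral_left) (force simp: S_def)+
  also have "\<dots> = (\<Sum>i\<in>?A. \<Sum>m\<in>S. a i * b (m - i) * nc_phase \<theta> i (m - i) * G m)"
    unfolding nc_mult_eq by (simp add: sum_distrib_right) (rule sum.swap)
  also have "\<dots> = (\<Sum>i\<in>?A. \<Sum>j\<in>?B. a i * b j * nc_phase \<theta> i j * G (i + j))"
  proof (rule sum.cong)
    fix i assume "i \<in> ?A"
    then have sub: "(\<lambda>j. i + j) ` ?B \<subseteq> S" by (auto simp: S_def)
    have "(\<Sum>m\<in>S. a i * b (m - i) * nc_phase \<theta> i (m - i) * G m)
      = (\<Sum>m\<in>(\<lambda>j. i + j) ` ?B. a i * b (m - i) * nc_phase \<theta> i (m - i) * G m)"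
    proof (rule sum.mono_neutral_right[OF fin(3) sub], rule ballI)
      fix m assume "m \<in> S - (\<lambda>j. i + j) ` ?B"
      then have "b (m - i) = 0" by (metis (mono_tags) DiffD2 add.commute diff_add_cancel imageI mem_Collect_eq)
      then show "a i * b (m - i) * nc_phase \<theta> i (m - i) * G m = 0" by simp
    qed
    also have "\<dots> = (\<Sum>j\<in>?B. a i * b j * nc_phase \<theta> i j * G (i + j))"
      by (subst sum.reindex) (auto simp: inj_on_def)
    finally show "(\<Sum>m\<in>S. a i * b (m - i) * nc_phase \<theta> i (m - i) * G m) =
       (\<Sum>j\<in>?B. a i * b j * nc_phase \<theta> i j * G (i + j))" .
  qed simp
  finally show ?thesis .
qed

lemma nc_mult_assoc:
  assumes "nc_poly a" "nc_poly b"
  shows "nc_mult \<theta> (nc_mult \<theta> a b) c = nc_mult \<theta> a (nc_mult \<theta> b c)"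
proof
  fix m
  have "nc_mult \<theta> (nc_mult \<theta> a b) c m = (\<Sum>q | nc_mult \<theta> a b q \<noteq> 0. nc_mult \<theta> a b q * (c (m - q) * nc_phase \<theta> q (m - q)))"
    by (subst nc_mult_eq) (simp add: mult_ac)
  also have "\<dots> = (\<Sum>i | a i \<noteq> 0. \<Sum>j | b j \<noteq> 0.
      a i * b j * nc_phase \<theta> i j * (c (m - (i + j)) * nc_phase \<theta> (i + j) (m - (i + j))))"
    by (rule sum_nc_mult[OF assms])
  also have "\<dots> = (\<Sum>i | a i \<noteq> 0. \<Sum>j | b j \<noteq> 0.
      a i * (b j * c (m - i - j) * nc_phase \<theta> j (m - i - j)) * nc_phase \<theta> i (m - i))"
  proof (intro sum.cong refl)
    fix i j
    have "nc_phase \<theta> i j * nc_phase \<theta> (i + j) (m - (i + j)) = nc_phase \<theta> i (m - i) * nc_phase \<theta> j (m - i - j)"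
      using nc_phase_cocycle[of \<theta> i j "m - (i + j)"] by (simp add: algebra_simps)
    then show "a i * b j * nc_phase \<theta> i j * (c (m - (i + j)) * nc_phase \<theta> (i + j) (m - (i + j)))
      = a i * (b j * c (m - i - j) * nc_phase \<theta> j (m - i - j)) * nc_phase \<theta> i (m - i)"
      by (simp add: diff_diff_eq mult_ac)
  qed
  also have "\<dots> = nc_mult \<theta> a (nc_mult \<theta> b c) m"
    unfolding nc_mult_eq by (simp add: sum_distrib_left sum_distrib_right)
  finally show "nc_mult \<theta> (nc_mult \<theta> a b) c m = nc_mult \<theta> a (nc_mult \<theta> b c) m" .
qed

section \<open>The inner product tau(a^* b) and the spectral measure of x^* x\<close>

definition nc_inner :: "(int \<times> int \<Rightarrow> complex) \<Rightarrow> (int \<times> int \<Rightarrow> complex) \<Rightarrow> complex" where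
  "nc_inner a b = (\<Sum>m | a m \<noteq> 0. cnj (a m) * b m)"

lemma nc_inner_eq_on:
  assumes "finite S" "\<And>m. a m \<noteq> 0 \<Longrightarrow> m \<in> S"
  shows "nc_inner a b = (\<Sum>m\<in>S. cnj (a m) * b m)"
  unfolding nc_inner_def using assms by (intro sum.mono_neutral_left) auto

lemma nc_inner_commute:
  assumes "nc_poly a" "nc_poly b" shows "nc_inner b a = cnj (nc_inner a b)"
proof -
  let ?S = "{m. a m \<noteq> 0} \<union> {m. b m \<noteq> 0}"
  have "finite ?S" using assms by (simp add: nc_poly_def)
  then have "nc_inner b a = (\<Sum>m\<in>?S. cnj (b m) * a m)" "nc_inner a b = (\<Sum>m\<in>?S. cnj (a m) * b m)"
    by (auto intro!: nc_inner_eq_on)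
  then show ?thesis by (simp add: mult.commute)
qed

lemma nc_inner_self: "nc_inner a a = of_real (\<Sum>m | a m \<noteq> 0. (cmod (a m))\<^sup>2)"
  by (simp add: nc_inner_def complex_norm_square[symmetric] mult.commute of_real_power[symmetric] del: of_real_power)

lemma nc_inner_mult_left:
  assumes "nc_poly a" "nc_poly b"
  shows "nc_inner (nc_mult \<theta> a b) c = nc_inner b (nc_mult \<theta> (nc_adj \<theta> a) c)"
proof -
  let ?A = "{m. a m \<noteq> 0}" and ?B = "{m. b m \<noteq> 0}"
  have fin: "finite ?A" "finite ?B" using assms by (auto simp: nc_poly_def)
  have "nc_inner (nc_mult \<theta> a b) c = cnj (\<Sum>m | nc_mult \<theta> a b m \<noteq> 0. nc_mult \<theta> a b m * cnj (c m))"
    by (simp add: nc_inner_def)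
  also have "\<dots> = (\<Sum>i\<in>?A. \<Sum>j\<in>?B. cnj (a i) * cnj (b j) * cnj (nc_phase \<theta> i j) * c (i + j))"
    by (subst sum_nc_mult[OF assms]) simp
  also have "\<dots> = (\<Sum>j\<in>?B. \<Sum>i\<in>?A. cnj (a i) * cnj (b j) * cnj (nc_phase \<theta> i j) * c (i + j))"
    by (rule sum.swap)
  also have "\<dots> = (\<Sum>j\<in>?B. cnj (b j) * nc_mult \<theta> (nc_adj \<theta> a) c j)"
  proof (rule sum.cong)
    fix j
    have "nc_mult \<theta> (nc_adj \<theta> a) c j
      = (\<Sum>i\<in>uminus ` ?A. nc_adj \<theta> a i * c (j - i) * nc_phase \<theta> i (j - i))"
      using fin by (intro nc_mult_eq_on) (force simp: nc_adj_eq)+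
    also have "\<dots> = (\<Sum>i\<in>?A. nc_adj \<theta> a (-i) * c (j + i) * nc_phase \<theta> (-i) (j + i))"
      by (subst sum.reindex) (auto simp: inj_on_def)
    also have "\<dots> = (\<Sum>i\<in>?A. cnj (a i) * cnj (nc_phase \<theta> i j) * c (i + j))"
    proof (intro sum.cong refl)
      fix i
      have "nc_phase \<theta> (-i) (-i) * nc_phase \<theta> (-i) (j + i) = cnj (nc_phase \<theta> i j)"
        by (simp add: nc_phase_def cis_mult cis_cnj algebra_simps)
      then show "nc_adj \<theta> a (-i) * c (j + i) * nc_phase \<theta> (-i) (j + i) = cnj (a i) * cnj (nc_phase \<theta> i j) * c (i + j)"
        by (simp add: nc_adj_eq add.commute mult_ac)
    qed
    finally show "(\<Sum>i\<in>?A. cnj (a i) * cnj (b j) * cnj (nc_phase \<theta> i j) * c (i + j)) =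
      cnj (b j) * nc_mult \<theta> (nc_adj \<theta> a) c j"
      by (simp add: sum_distrib_left mult_ac)
  qed simp
  finally show ?thesis by (simp add: nc_inner_def)
qed

lemma Re_nc_inner_self: "Re (nc_inner a a) = (\<Sum>m | a m \<noteq> 0. (cmod (a m))\<^sup>2)"
  unfolding nc_inner_self by simp

lemma nc_inner_self_nonneg: "Re (nc_inner a a) \<ge> 0"
  unfolding Re_nc_inner_self by (intro sum_nonneg) simp

text \<open>Left multiplication is bounded on l_2 by the l_1 norm of the coefficients:
  Cauchy-Schwarz with |a| split into two square roots, then summation over the translates of
  \<open>b\<close>. This crude bound is enough to scale x^* x to a contraction.\<close>

lemma nc_mult_bounded:
  assumes "nc_poly a" "nc_poly b"
  shows "Re (nc_inner (nc_mult \<theta> a b) (nc_mult \<theta> a b)) \<le> (\<Sum>m | a m \<noteq> 0. cmod (a m))\<^sup>2 * Re (nc_inner b b)"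
proof -
  let ?A = "{m. a m \<noteq> 0}" and ?B = "{m. b m \<noteq> 0}"
  define S where "S = (\<lambda>(i, j). i + j) ` (?A \<times> ?B)"
  have fin: "finite ?A" "finite ?B" "finite S" using assms by (auto simp: nc_poly_def S_def)
  define N where "N = (\<Sum>m\<in>?A. cmod (a m))"
  have N0: "N \<ge> 0" by (simp add: N_def sum_nonneg)
  have "Re (nc_inner (nc_mult \<theta> a b) (nc_mult \<theta> a b)) = (\<Sum>m\<in>S. (cmod (nc_mult \<theta> a b m))\<^sup>2)"
    unfolding Re_nc_inner_self using fin nc_mult_support by (intro sum.mono_neutral_left) (force simp: S_def)+
  also have "\<dots> \<le> (\<Sum>m\<in>S. N * (\<Sum>i\<in>?A. cmod (a i) * (cmod (b (m - i)))\<^sup>2))"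
  proof (rule sum_mono)
    fix m
    have "cmod (nc_mult \<theta> a b m) \<le> (\<Sum>i\<in>?A. cmod (a i * b (m - i) * nc_phase \<theta> i (m - i)))"
      unfolding nc_mult_eq by (rule norm_sum)
    also have "\<dots> = (\<Sum>i\<in>?A. sqrt (cmod (a i)) * (sqrt (cmod (a i)) * cmod (b (m - i))))"
      by (intro sum.cong refl) (simp add: norm_mult)
    finally have "(cmod (nc_mult \<theta> a b m))\<^sup>2 \<le> (\<Sum>i\<in>?A. sqrt (cmod (a i)) * (sqrt (cmod (a i)) * cmod (b (m - i))))\<^sup>2"
      by (rule power_mono) simp
    also have "\<dots> \<le> (\<Sum>i\<in>?A. (sqrt (cmod (a i)))\<^sup>2) * (\<Sum>i\<in>?A. (sqrt (cmod (a i)) * cmod (b (m - i)))\<^sup>2)"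
      by (rule Cauchy_Schwarz_ineq_sum)
    finally show "(cmod (nc_mult \<theta> a b m))\<^sup>2 \<le> N * (\<Sum>i\<in>?A. cmod (a i) * (cmod (b (m - i)))\<^sup>2)"
      by (simp add: N_def power_mult_distrib)
  qed
  also have "\<dots> = N * (\<Sum>i\<in>?A. cmod (a i) * (\<Sum>m\<in>S. (cmod (b (m - i)))\<^sup>2))"
    by (simp add: sum_distrib_left[symmetric]) (simp add: sum_distrib_left sum.swap[of _ S])
  also have "\<dots> \<le> N * (\<Sum>i\<in>?A. cmod (a i) * (\<Sum>j\<in>?B. (cmod (b j))\<^sup>2))"
  proof (intro mult_left_mono sum_mono N0 norm_ge_zero)
    fix i
    have "(\<Sum>m\<in>S. (cmod (b (m - i)))\<^sup>2) = (\<Sum>j\<in>(\<lambda>m. m - i) ` S. (cmod (b j))\<^sup>2)"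
      by (subst sum.reindex) (auto simp: inj_on_def)
    also have "\<dots> = (\<Sum>j\<in>(\<lambda>m. m - i) ` S \<inter> ?B. (cmod (b j))\<^sup>2)"
      using fin by (intro sum.mono_neutral_right) auto
    also have "\<dots> \<le> (\<Sum>j\<in>?B. (cmod (b j))\<^sup>2)"
      using fin by (intro sum_mono2) auto
    finally show "(\<Sum>m\<in>S. (cmod (b (m - i)))\<^sup>2) \<le> (\<Sum>j\<in>?B. (cmod (b j))\<^sup>2)" .
  qed
  also have "\<dots> = N\<^sup>2 * Re (nc_inner b b)"
    by (simp add: Re_nc_inner_self N_def power2_eq_square sum_distrib_right[symmetric] mult.assoc)
  finally show ?thesis by (simp add: N_def)
qed

text \<open>For commuting self-adjoint positive T and S with T + S = 1, the products T^k S^l are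
  positive. Square roots are avoided: half of the even part of each exponent is moved to the left
  argument, and the remaining case of one T and one S follows from ST = TST + STS.\<close>

lemma commuting_contraction_positivity:
  fixes T S :: "'v \<Rightarrow> 'v" and ip :: "'v \<Rightarrow> 'v \<Rightarrow> real"
  assumes P: "\<And>u. P u \<Longrightarrow> P (T u)" "\<And>u. P u \<Longrightarrow> P (S u)" "P e"
    and sa: "\<And>u v. P u \<Longrightarrow> P v \<Longrightarrow> ip (T u) v = ip u (T v)" "\<And>u v. P u \<Longrightarrow> P v \<Longrightarrow> ip (S u) v = ip u (S v)"
    and comm: "\<And>u. P u \<Longrightarrow> S (T u) = T (S u)"
    and pos: "\<And>u. P u \<Longrightarrow> ip u u \<ge> 0" "\<And>u. P u \<Longrightarrow> ip u (T u) \<ge> 0" "\<And>u. P u \<Longrightarrow> ip u (S u) \<ge> 0"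
    and split: "\<And>u v. P u \<Longrightarrow> P v \<Longrightarrow> ip u v = ip u (T v) + ip u (S v)"
  defines "D \<equiv> \<lambda>k l. ip e ((S ^^ l) ((T ^^ k) e))"
  shows "D k l = D (Suc k) l + D k (Suc l)" "D k l \<ge> 0"
proof -
  have PT: "P ((T ^^ n) u)" and PS: "P ((S ^^ n) u)" if "P u" for n u
    using that P by (induction n) auto
  have saT: "ip ((T ^^ n) u) v = ip u ((T ^^ n) v)" if "P u" "P v" for n u v
    using that by (induction n arbitrary: v) (simp_all add: sa P PT funpow_swap1[symmetric])
  have saS: "ip ((S ^^ n) u) v = ip u ((S ^^ n) v)" if "P u" "P v" for n u v
    using that by (induction n arbitrary: v) (simp_all add: sa P PS funpow_swap1[symmetric])
  have comm1: "S ((T ^^ n) u) = (T ^^ n) (S u)" if "P u" for n u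
    using that by (induction n) (simp_all add: comm PT)
  have comm2: "(S ^^ l) ((T ^^ k) u) = (T ^^ k) ((S ^^ l) u)" if "P u" for k l u
    using that by (induction l) (simp_all add: comm1 PS)
  note PP = P PT PS
  have "D k l = ip ((S ^^ l) e) ((T ^^ k) e)" by (simp add: D_def saS PP)
  also have "\<dots> = ip ((S ^^ l) e) (T ((T ^^ k) e)) + ip ((S ^^ l) e) (S ((T ^^ k) e))"
    by (rule split) (simp_all add: PP)
  also have "\<dots> = D (Suc k) l + D k (Suc l)"
    by (simp add: D_def saS PP funpow_swap1)
  finally show "D k l = D (Suc k) l + D k (Suc l)" .
  have pos2: "ip u (S (T u)) \<ge> 0" if "P u" for u
  proof -
    have "ip u (S (T u)) = ip u (T (S (T u))) + ip u (S (S (T u)))"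
      by (rule split) (simp_all add: PP that)
    also have "ip u (T (S (T u))) = ip (T u) (S (T u))" by (simp add: sa PP that)
    also have "ip u (S (S (T u))) = ip (S u) (T (S u))" by (simp add: sa PP that comm)
    finally show ?thesis using pos(2)[of "S u"] pos(3)[of "T u"] that by (simp add: PP)
  qed
  define a r b s where "a = k div 2" "r = k mod 2" "b = l div 2" "s = l mod 2"
  have kl: "k = r + (a + a)" "l = s + (b + b)" "r \<in> {0, 1}" "s \<in> {0, 1}"
    unfolding a_r_b_s_def insert_iff empty_iff by presburger+
  define w where "w = (S ^^ b) ((T ^^ a) e)"
  have Pw: "P w" by (simp add: w_def PP)
  have "(S ^^ l) ((T ^^ k) e) = (S ^^ b) ((T ^^ a) ((S ^^ s) ((T ^^ r) w)))"
    unfolding kl funpow_add w_def comp_apply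
    by (simp add: comm2[symmetric] PP) (simp add: funpow_add[symmetric, THEN fun_cong, unfolded comp_apply] add_ac)
  then have "D k l = ip w ((S ^^ s) ((T ^^ r) w))"
    unfolding D_def by (simp add: saS[symmetric] saT[symmetric] PP Pw) (simp add: w_def comm2 PP)
  also have "\<dots> \<ge> 0"
    using kl(3,4) pos pos2 Pw by auto
  finally show "D k l \<ge> 0" .
qed

lemma nc_mult_diff_right: "nc_mult \<theta> a (\<lambda>m. u m - v m) = (\<lambda>m. nc_mult \<theta> a u m - nc_mult \<theta> a v m)"
  by (rule ext) (simp add: nc_mult_eq algebra_simps sum_subtractf)

lemma nc_mult_scale_right: "nc_mult \<theta> a (\<lambda>m. c * u m) = (\<lambda>m. c * nc_mult \<theta> a u m)"
  by (rule ext) (simp add: nc_mult_eq sum_distrib_left mult_ac)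

lemma nc_poly_diff: assumes "nc_poly a" "nc_poly b" shows "nc_poly (\<lambda>m. a m - b m)"
  by (rule nc_polyI[of "{m. a m \<noteq> 0} \<union> {m. b m \<noteq> 0}"]) (use assms in \<open>auto simp: nc_poly_def\<close>)

lemma nc_poly_scale: assumes "nc_poly a" shows "nc_poly (\<lambda>m. c * a m)"
  by (rule nc_polyI[of "{m. a m \<noteq> 0}"]) (use assms in \<open>auto simp: nc_poly_def\<close>)

lemma nc_inner_diff_right: "nc_inner a (\<lambda>m. u m - v m) = nc_inner a u - nc_inner a v"
  by (simp add: nc_inner_def algebra_simps sum_subtractf)

lemma nc_inner_scale_right: "nc_inner a (\<lambda>m. c * u m) = c * nc_inner a u"
  by (simp add: nc_inner_def sum_distrib_left mult_ac)

lemma nc_inner_diff_left: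
  assumes "nc_poly a" "nc_poly b" "nc_poly c"
  shows "nc_inner (\<lambda>m. a m - b m) c = nc_inner a c - nc_inner b c"
  using assms by (simp add: nc_inner_commute[of c] nc_poly_diff nc_inner_diff_right)

lemma nc_inner_one: "nc_inner nc_one a = a (0, 0)"
  by (subst nc_inner_eq_on[of "{(0, 0)}"]) (auto simp: nc_one_def split: if_splits)

lemma nc_inner_mult_right:
  assumes "nc_poly a" "nc_poly b" "nc_poly c"
  shows "nc_inner b (nc_mult \<theta> (nc_mult \<theta> (nc_adj \<theta> a) a) c) = nc_inner (nc_mult \<theta> a b) (nc_mult \<theta> a c)"
  using assms by (simp add: nc_mult_assoc nc_poly_adj nc_inner_mult_left)

text \<open>Left multiplication by x^* x divided by \<open>R\<close> is a positive contraction
  \<open>T\<close> for the trace inner product, and \<open>S = 1 - T\<close> is positive as well.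
  The numbers tau(T^k S^l) satisfy the hypotheses of the Hausdorff problem on [0, 1]; its solution
  is stretched by \<open>R\<close>.\<close>

lemma spec_meas_exists:
  assumes x: "nc_poly x"
  shows "\<exists>\<mu>. spec_meas \<theta> x \<mu>"
proof -
  define y where "y = nc_mult \<theta> (nc_adj \<theta> x) x"
  \<comment> \<open>The squared l_1 norm bounds x^* x; the summand 1 keeps \<open>R\<close> positive
    when \<open>x = 0\<close>.\<close>
  define R where "R = 1 + (\<Sum>m | x m \<noteq> 0. cmod (x m))\<^sup>2"
  have R: "R > 0" unfolding R_def by (simp add: add_pos_nonneg)
  define T where "T z = (\<lambda>m. of_real (1 / R) * nc_mult \<theta> y z m)" for z
  define S where "S z = (\<lambda>m. z m - T z m)" for z
  define ip where "ip u v = Re (nc_inner u v)" for u v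
  have y: "nc_poly y" unfolding y_def using x by (simp add: nc_poly_mult nc_poly_adj)
  have T: "nc_poly (T u)" if "nc_poly u" for u
    unfolding T_def using y that by (intro nc_poly_scale nc_poly_mult)
  have S: "nc_poly (S u)" if "nc_poly u" for u
    unfolding S_def using T that by (intro nc_poly_diff)
  have ipT: "nc_inner u (T v) = nc_inner (nc_mult \<theta> x u) (nc_mult \<theta> x v) / of_real R"
    if "nc_poly u" "nc_poly v" for u v
    unfolding T_def nc_inner_scale_right y_def using x that by (simp add: nc_inner_mult_right)
  have saT: "nc_inner (T u) v = nc_inner u (T v)" if "nc_poly u" "nc_poly v" for u v
    using that x by (simp add: nc_inner_commute[of v "T u"] T ipT)
       (simp add: nc_inner_commute[of "nc_mult \<theta> x v"] nc_poly_mult)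
  have saS: "nc_inner (S u) v = nc_inner u (S v)" if "nc_poly u" "nc_poly v" for u v
    unfolding S_def using that T by (simp add: nc_inner_diff_left nc_inner_diff_right saT)
  have posT: "ip u (T u) \<ge> 0" if "nc_poly u" for u
    unfolding ip_def using that R by (simp add: ipT nc_inner_self_nonneg)
  have posS: "ip u (S u) \<ge> 0" if "nc_poly u" for u
  proof -
    have "Re (nc_inner (nc_mult \<theta> x u) (nc_mult \<theta> x u)) \<le> (R - 1) * Re (nc_inner u u)"
      using nc_mult_bounded[OF x that] by (simp add: R_def)
    also have "\<dots> \<le> R * Re (nc_inner u u)"
      by (intro mult_right_mono nc_inner_self_nonneg) simp
    finally have "Re (nc_inner (nc_mult \<theta> x u) (nc_mult \<theta> x u)) / R \<le> Re (nc_inner u u)"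
      using R by (simp add: field_simps)
    then show ?thesis
      unfolding ip_def S_def using that R by (simp add: nc_inner_diff_right ipT)
  qed
  have comm: "S (T u) = T (S u)" for u
    unfolding S_def T_def by (simp add: nc_mult_diff_right nc_mult_scale_right right_diff_distrib)
  define D where "D k l = ip nc_one ((S ^^ l) ((T ^^ k) nc_one))" for k l
  have D: "D k l = D (Suc k) l + D k (Suc l)" "D k l \<ge> 0" for k l
  proof -
    have "ip u v = ip u (T v) + ip u (S v)" for u v
      by (simp add: ip_def S_def nc_inner_diff_right)
    note * = commuting_contraction_positivity[of nc_poly T S nc_one ip, OF T S nc_poly_one _ _ comm _ posT posS this]
    show "D k l = D (Suc k) l + D k (Suc l)" unfolding D_def
      by (rule *) (auto simp: ip_def saT saS nc_inner_self_nonneg)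
    show "D k l \<ge> 0" unfolding D_def
      by (rule *) (auto simp: ip_def saT saS nc_inner_self_nonneg)
  qed
  have Tpow: "(T ^^ n) nc_one = (\<lambda>m. of_real (1 / R ^ n) * nc_pow \<theta> y n m)" for n
  proof (induction n)
    case (Suc n)
    have "(T ^^ Suc n) nc_one = T (\<lambda>m. of_real (1 / R ^ n) * nc_pow \<theta> y n m)"
      using Suc by simp
    also have "\<dots> = (\<lambda>m. of_real (1 / R ^ Suc n) * nc_pow \<theta> y (Suc n) m)"
      unfolding T_def nc_mult_scale_right by simp
    finally show ?case .
  qed simp
  have D0: "D n 0 = Re (nc_trace (nc_pow \<theta> y n)) / R ^ n" for n
    by (simp add: D_def ip_def nc_inner_one Tpow nc_trace_def)
  have "D 0 0 = 1" by (simp add: D0 nc_trace_def nc_one_def)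
  from Hausdorff_moment_problem[of D, OF D this] obtain M where M: "real_distribution M"
    "AE t in M. 0 \<le> t \<and> t \<le> 1" "\<And>j. (\<integral>t. t ^ j \<partial>M) = D j 0" by auto
  interpret M: real_distribution M by (rule M)
  have "spec_meas \<theta> x (distr M borel (\<lambda>t. R * t))"
    unfolding spec_meas_def y_def[symmetric]
  proof (intro conjI allI)
    have "prob_space (distr M borel (\<lambda>t. R * t))" by (rule M.prob_space_distr) simp
    then show "finite_measure (distr M borel (\<lambda>t. R * t))" by (simp add: prob_space_def)
    have "AE t in distr M borel (\<lambda>t. R * t). 0 \<le> t \<and> t \<le> R"
      using M(2) R by (subst AE_distr_iff) auto
    then show "\<exists>R'. AE t in distr M borel (\<lambda>t. R * t). 0 \<le> t \<and> t \<le> R'" by blast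
    fix n
    have "integrable M (\<lambda>t. (R * t) ^ n)"
      by (rule M.integrable_comp_continuous[of 1 "\<lambda>t. (R * t) ^ n" "\<lambda>t. t"])
         (use M(2) in \<open>auto intro!: continuous_intros\<close>)
    then show "integrable (distr M borel (\<lambda>t. R * t)) (\<lambda>t. t ^ n)"
      by (subst integrable_distr_eq) auto
    show "(\<integral>t. t ^ n \<partial>distr M borel (\<lambda>t. R * t)) = Re (nc_trace (nc_pow \<theta> y n))"
      using M(3)[of n] R by (subst integral_distr) (auto simp: power_mult_distrib D0)
  qed simp
  then show ?thesis by blast
qed

lemma spec_meas_prob_space:
  assumes "spec_meas \<theta> x \<mu>" shows "prob_space \<mu>"
proof -
  interpret finite_measure \<mu> using assms by (simp add: spec_meas_def)
  have "(\<integral>t. t ^ 0 \<partial>\<mu>) = Re (nc_trace nc_one)"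
    using assms unfolding spec_meas_def by (metis nc_pow.simps(1))
  then have "measure \<mu> (space \<mu>) = 1" by (simp add: nc_trace_def nc_one_def)
  then show ?thesis by (intro prob_spaceI) (simp add: emeasure_eq_measure)
qed

lemma spec_meas_unique:
  assumes "spec_meas \<theta> x \<mu>" "spec_meas \<theta> x \<nu>" shows "\<mu> = \<nu>"
proof -
  obtain R R' where "AE t in \<mu>. 0 \<le> t \<and> t \<le> R" "AE t in \<nu>. 0 \<le> t \<and> t \<le> R'"
    using assms unfolding spec_meas_def by blast
  then show ?thesis
    using assms by (intro moments_determine_measure spec_meas_prob_space) (auto simp: spec_meas_def)
qed

lemma nc_Lp_norm_eq:
  assumes "spec_meas \<theta> x \<mu>"
  shows "nc_Lp_norm \<theta> p x = (\<integral>t. t powr (p / 2) \<partial>\<mu>) powr (1 / p)"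
proof -
  have "(THE \<mu>. spec_meas \<theta> x \<mu>) = \<mu>"
    using assms spec_meas_unique by blast
  then show ?thesis by (simp add: nc_Lp_norm_def)
qed

section \<open>Trigonometric polynomials and lacunary spectra\<close>

definition unit_lebesgue :: "real measure" where
  "unit_lebesgue = restrict_space lborel {0..1}"

lemma space_unit_lebesgue [simp]: "space unit_lebesgue = {0..1}"
  by (simp add: unit_lebesgue_def)

interpretation unit_lebesgue: prob_space unit_lebesgue
  by (rule prob_spaceI) (simp add: unit_lebesgue_def emeasure_restrict_space space_restrict_space)

lemma measurable_unit_lebesgue:
  "f \<in> borel_measurable borel \<Longrightarrow> f \<in> borel_measurable unit_lebesgue"
  by (simp add: unit_lebesgue_def measurable_restrict_space1)

lemma integral_unit_lebesgue:
  fixes f :: "real \<Rightarrow> 'a :: euclidean_space"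
  shows "(\<integral>t. f t \<partial>unit_lebesgue) = (\<integral>t. indicator {0..1} t *\<^sub>R f t \<partial>lborel)"
  unfolding unit_lebesgue_def by (rule integral_restrict_space) simp

lemma integrable_unit_lebesgue_continuous:
  fixes f :: "real \<Rightarrow> 'a :: euclidean_space"
  assumes "continuous_on UNIV f"
  shows "integrable unit_lebesgue f"
proof -
  have "integrable lborel (\<lambda>x. indicator {0..1} x *\<^sub>R f x)"
    using assms by (intro borel_integrable_compact) (auto intro: continuous_on_subset)
  then show ?thesis unfolding unit_lebesgue_def by (subst integrable_restrict_space) auto
qed

definition ch :: "int \<Rightarrow> real \<Rightarrow> complex" where
  "ch n t = cis (2 * pi * of_int n * t)"

lemma ch_add: "ch (m + n) t = ch m t * ch n t"
  by (simp add: ch_def cis_mult algebra_simps)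

lemma ch_add_arg: "ch n (s + t) = ch n s * ch n t"
  by (simp add: ch_def cis_mult algebra_simps)

lemma cnj_ch: "cnj (ch n t) = ch (- n) t"
  by (simp add: ch_def cis_cnj)

lemma ch_0 [simp]: "ch 0 t = 1" by (simp add: ch_def)

lemma norm_ch [simp]: "norm (ch n t) = 1" by (simp add: ch_def)

lemma ch_sum: "finite A \<Longrightarrow> ch (sum f A) t = (\<Prod>x\<in>A. ch (f x) t)"
  by (induction A rule: finite_induct) (simp_all add: ch_add)

lemma continuous_ch [continuous_intros]: "continuous_on A f \<Longrightarrow> continuous_on A (\<lambda>x. ch n (f x))"
  unfolding ch_def cis_conv_exp by (intro continuous_intros)

lemma measurable_ch [measurable]: "ch n \<in> borel_measurable borel"
  by (intro borel_measurable_continuous_onI continuous_intros)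

lemma measurable_unit_ch [measurable]: "ch n \<in> borel_measurable unit_lebesgue"
  by (rule measurable_unit_lebesgue) simp

lemma integral_ch: "(\<integral>t. ch n t \<partial>unit_lebesgue) = (if n = 0 then 1 else 0)"
proof (cases "n = 0")
  case True
  then show ?thesis using unit_lebesgue.prob_space by simp
next
  case False
  define F where "F t = exp (\<i> * of_real (2 * pi * of_int n) * of_real t) / (\<i> * of_real (2 * pi * of_int n))" for t
  have ch: "ch n t = exp (\<i> * of_real (2 * pi * of_int n) * of_real t)" for t
    by (simp add: ch_def cis_conv_exp mult_ac)
  have "(F has_vector_derivative ch n t) (at t within {0..1})" for t
  proof -
    have "((\<lambda>z. exp (\<i> * of_real (2 * pi * of_int n) * z) / (\<i> * of_real (2 * pi * of_int n)))
        has_field_derivative ch n t) (at (of_real t))"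
      unfolding ch using False by (auto intro!: derivative_eq_intros)
    from has_vector_derivative_real_field[OF this] show ?thesis unfolding F_def .
  qed
  then have "(\<integral>x. indicator {0..1} x *\<^sub>R ch n x \<partial>lborel) = F 1 - F 0"
    by (intro integral_FTC_Icc continuous_intros) auto
  also have "F 1 = F 0"
    using ch[of 1] by (simp add: F_def ch_def cis_multiple_2pi mult.commute mult.left_commute)
  finally show ?thesis using False by (simp add: integral_unit_lebesgue)
qed

definition trig :: "int set \<Rightarrow> (int \<Rightarrow> complex) \<Rightarrow> real \<Rightarrow> complex" where
  "trig S b t = (\<Sum>n\<in>S. b n * ch n t)"

lemma continuous_trig [continuous_intros]: "continuous_on A f \<Longrightarrow> continuous_on A (\<lambda>x. trig S b (f x))"
  unfolding trig_def by (intro continuous_intros)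

lemma trig_inner:
  assumes "finite S" "finite S'"
  shows "(\<integral>t. cnj (trig S b t) * trig S' c t \<partial>unit_lebesgue) = (\<Sum>n\<in>S \<inter> S'. cnj (b n) * c n)"
proof -
  have "cnj (trig S b t) * trig S' c t = (\<Sum>n\<in>S. \<Sum>m\<in>S'. cnj (b n) * c m * ch (m - n) t)" for t
    unfolding trig_def cnj_sum sum_product
    by (intro sum.cong refl) (simp add: cnj_ch ch_add[of _ "- _", simplified])
  then have "(\<integral>t. cnj (trig S b t) * trig S' c t \<partial>unit_lebesgue)
     = (\<integral>t. (\<Sum>n\<in>S. \<Sum>m\<in>S'. cnj (b n) * c m * ch (m - n) t) \<partial>unit_lebesgue)" by simp
  also have "\<dots> = (\<Sum>n\<in>S. \<Sum>m\<in>S'. \<integral>t. cnj (b n) * c m * ch (m - n) t \<partial>unit_lebesgue)"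
    by (subst Bochner_Integration.integral_sum, intro integrable_unit_lebesgue_continuous continuous_intros,
        rule sum.cong[OF refl], rule Bochner_Integration.integral_sum, intro integrable_unit_lebesgue_continuous continuous_intros)
  also have "\<dots> = (\<Sum>n\<in>S. \<Sum>m\<in>S'. if m = n then cnj (b n) * c m else 0)"
    by (intro sum.cong refl) (simp add: integral_ch)
  also have "\<dots> = (\<Sum>n\<in>S. if n \<in> S' then cnj (b n) * c n else 0)"
    using assms by (intro sum.cong refl) (simp add: sum.delta)
  also have "\<dots> = (\<Sum>n\<in>S \<inter> S'. cnj (b n) * c n)"
    using assms by (simp add: sum.inter_restrict)
  finally show ?thesis .
qed

lemma trig_Parseval:
  assumes "finite S"
  shows "(\<integral>t. (cmod (trig S b t))\<^sup>2 \<partial>unit_lebesgue) = (\<Sum>n\<in>S. (cmod (b n))\<^sup>2)"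
proof -
  have "complex_of_real (\<integral>t. (cmod (trig S b t))\<^sup>2 \<partial>unit_lebesgue) = (\<integral>t. cnj (trig S b t) * trig S b t \<partial>unit_lebesgue)"
    by (subst integral_complex_of_real[symmetric]) (simp only: complex_norm_square mult.commute)
  also have "\<dots> = complex_of_real (\<Sum>n\<in>S. (cmod (b n))\<^sup>2)"
    unfolding trig_inner[OF assms assms] by (simp add: complex_norm_square mult.commute del: of_real_power)
  finally show ?thesis using of_real_eq_iff by blast
qed

lemma square_sum_le_card:
  fixes f :: "'a \<Rightarrow> complex"
  shows "(cmod (\<Sum>x\<in>A. f x))\<^sup>2 \<le> card A * (\<Sum>x\<in>A. (cmod (f x))\<^sup>2)"
proof -
  have "(cmod (\<Sum>x\<in>A. f x))\<^sup>2 \<le> (\<Sum>x\<in>A. 1 * cmod (f x))\<^sup>2"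
    by (intro power_mono) (auto intro: norm_sum)
  also have "\<dots> \<le> (\<Sum>x\<in>A. 1\<^sup>2) * (\<Sum>x\<in>A. (cmod (f x))\<^sup>2)"
    by (rule Cauchy_Schwarz_ineq_sum)
  finally show ?thesis by simp
qed

text \<open>The coefficients of the \<open>K\<close>-th power are sums over representations of a frequency as a sum
  of \<open>K\<close> elements of \<open>S\<close>; Cauchy-Schwarz in these sums and Parseval give the bound.\<close>

lemma trig_even_norm_le:
  fixes C :: real
  assumes S: "finite S" and "C \<ge> 0"
    and rep: "\<And>n. real (card {x \<in> PiE {..<K} (\<lambda>_. S). (\<Sum>r<K. x r) = n}) \<le> C"
  shows "(\<integral>t. (cmod (trig S b t)) ^ (2 * K) \<partial>unit_lebesgue) \<le> C * (\<Sum>n\<in>S. (cmod (b n))\<^sup>2) ^ K"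
proof -
  define P where "P = PiE {..<K} (\<lambda>_. S)"
  define \<sigma> where "\<sigma> x = (\<Sum>r<K. x r)" for x :: "nat \<Rightarrow> int"
  define w where "w x = (\<Prod>r<K. b (x r))" for x
  have P: "finite P" unfolding P_def using S by (intro finite_PiE) auto
  define c where "c n = (\<Sum>x | x \<in> P \<and> \<sigma> x = n. w x)" for n
  have pow: "(trig S b t) ^ K = trig (\<sigma> ` P) c t" for t
  proof -
    have "(trig S b t) ^ K = (\<Prod>r<K. \<Sum>n\<in>S. b n * ch n t)" by (simp add: trig_def)
    also have "\<dots> = (\<Sum>x\<in>P. \<Prod>r<K. b (x r) * ch (x r) t)"
      unfolding P_def using S by (subst prod_sum_PiE) auto
    also have "\<dots> = (\<Sum>x\<in>P. w x * ch (\<sigma> x) t)"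
      by (simp add: prod.distrib w_def \<sigma>_def ch_sum)
    also have "\<dots> = (\<Sum>n\<in>\<sigma> ` P. \<Sum>x | x \<in> P \<and> \<sigma> x = n. w x * ch (\<sigma> x) t)"
      using P by (rule sum.image_gen)
    also have "\<dots> = trig (\<sigma> ` P) c t"
      unfolding trig_def c_def sum_distrib_right by (intro sum.cong refl) auto
    finally show ?thesis .
  qed
  have "(\<integral>t. (cmod (trig S b t)) ^ (2 * K) \<partial>unit_lebesgue) = (\<integral>t. (cmod (trig (\<sigma> ` P) c t))\<^sup>2 \<partial>unit_lebesgue)"
    by (simp add: pow[symmetric] norm_power power_mult[symmetric] mult.commute)
  also have "\<dots> = (\<Sum>n\<in>\<sigma> ` P. (cmod (c n))\<^sup>2)"
    using P by (intro trig_Parseval) simp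
  also have "\<dots> \<le> (\<Sum>n\<in>\<sigma> ` P. C * (\<Sum>x | x \<in> P \<and> \<sigma> x = n. (cmod (w x))\<^sup>2))"
  proof (rule sum_mono)
    fix n
    have "(cmod (c n))\<^sup>2 \<le> real (card {x. x \<in> P \<and> \<sigma> x = n}) * (\<Sum>x | x \<in> P \<and> \<sigma> x = n. (cmod (w x))\<^sup>2)"
      unfolding c_def by (rule square_sum_le_card)
    also have "\<dots> \<le> C * (\<Sum>x | x \<in> P \<and> \<sigma> x = n. (cmod (w x))\<^sup>2)"
      using rep[of n] by (intro mult_right_mono sum_nonneg) (auto simp: P_def \<sigma>_def)
    finally show "(cmod (c n))\<^sup>2 \<le> C * (\<Sum>x | x \<in> P \<and> \<sigma> x = n. (cmod (w x))\<^sup>2)" .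
  qed
  also have "\<dots> = C * (\<Sum>x\<in>P. (cmod (w x))\<^sup>2)"
    unfolding sum_distrib_left[symmetric] using P by (simp add: sum.image_gen[symmetric])
  also have "(\<Sum>x\<in>P. (cmod (w x))\<^sup>2) = (\<Sum>x\<in>P. \<Prod>r<K. (cmod (b (x r)))\<^sup>2)"
    by (simp add: w_def prod_norm[symmetric] prod_power_distrib)
  also have "\<dots> = (\<Prod>r<K. \<Sum>n\<in>S. (cmod (b n))\<^sup>2)"
    unfolding P_def using S by (subst prod_sum_PiE) auto
  finally show ?thesis by simp
qed

section \<open>Base-B digits and the number of representations as a sum of frequencies\<close>

lemma digit_sum:
  fixes c :: "nat \<Rightarrow> nat"
  assumes "\<And>e. c e < B" "m < L"
  shows "(\<Sum>e<L. c e * B ^ e) div B ^ m mod B = c m"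
  using assms
proof (induction m arbitrary: c L)
  case 0
  then obtain L' where L: "L = Suc L'" by (cases L) auto
  have "(\<Sum>e<L. c e * B ^ e) = c 0 + B * (\<Sum>e<L'. c (Suc e) * B ^ e)"
    unfolding L by (subst sum.lessThan_Suc_shift) (simp add: sum_distrib_left mult_ac)
  then show ?case using 0 by simp
next
  case (Suc m)
  then obtain L' where L: "L = Suc L'" by (cases L) auto
  have B: "B > 0" using Suc.prems(1)[of 0] by simp
  have "(\<Sum>e<L. c e * B ^ e) = c 0 + B * (\<Sum>e<L'. c (Suc e) * B ^ e)"
    unfolding L by (subst sum.lessThan_Suc_shift) (simp add: sum_distrib_left mult_ac)
  then have "(\<Sum>e<L. c e * B ^ e) div B ^ Suc m = (\<Sum>e<L'. c (Suc e) * B ^ e) div B ^ m"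
    using Suc.prems(1)[of 0] B by (simp add: div_mult2_eq)
  then show ?case using Suc.IH[of "\<lambda>e. c (Suc e)" L'] Suc.prems L by simp
qed

lemma sum_powers_eq_digits:
  fixes \<alpha> :: "'a \<Rightarrow> nat"
  assumes "finite A" "\<And>r. r \<in> A \<Longrightarrow> \<alpha> r < L"
  shows "(\<Sum>r\<in>A. B ^ \<alpha> r) = (\<Sum>e<L. card {r \<in> A. \<alpha> r = e} * (B ^ e :: nat))"
proof -
  have "(\<Sum>r\<in>A. B ^ \<alpha> r) = (\<Sum>e<L. \<Sum>r | r \<in> A \<and> \<alpha> r = e. B ^ \<alpha> r)"
    using assms by (subst sum.group) auto
  also have "\<dots> = (\<Sum>e<L. card {r \<in> A. \<alpha> r = e} * B ^ e)"
    by (intro sum.cong refl) simp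
  finally show ?thesis .
qed

text \<open>Even places are fed only by the \<open>i r\<close> and odd places only by the
  \<open>j r\<close>, so no place receives more than \<open>card A < B\<close> units. There are no
  carries, and each digit counts indices.\<close>

lemma digit_of_two_power_sum:
  assumes "finite A" "card A < B"
  shows "(\<Sum>r\<in>A. B ^ (2 * i r) + B ^ (2 * j r + 1)) div B ^ (2 * k) mod B = card {r \<in> A. i r = k}"
    and "(\<Sum>r\<in>A. B ^ (2 * i r) + B ^ (2 * j r + 1)) div B ^ (2 * k + 1) mod B = card {r \<in> A. j r = k}"
proof -
  \<comment> \<open>Any bound above all occurring exponents and above the two places 2k and 2k + 1
    that are read off.\<close>
  define L where "L = Suc (2 * k + 1 + (\<Sum>r\<in>A. 2 * i r + (2 * j r + 1)))"
  have le: "2 * i r + (2 * j r + 1) < L" if "r \<in> A" for r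
    using member_le_sum[of r A "\<lambda>r. 2 * i r + (2 * j r + 1)"] assms that by (simp add: L_def)
  define c where "c e = card {r \<in> A. 2 * i r = e} + card {r \<in> A. 2 * j r + 1 = e}" for e
  have cB: "c e < B" for e
  proof -
    have "c e = card ({r \<in> A. 2 * i r = e} \<union> {r \<in> A. 2 * j r + 1 = e})"
    proof (cases "even e")
      case True
      then have "{r \<in> A. 2 * j r + 1 = e} = {}" by auto
      then show ?thesis unfolding c_def by (simp only: card.empty Un_empty_right)
    next
      case False
      then have "{r \<in> A. 2 * i r = e} = {}" by auto
      then show ?thesis unfolding c_def by (simp only: card.empty Un_empty_left)
    qed
    also have "\<dots> \<le> card A" using assms by (intro card_mono) auto
    finally show ?thesis using assms by simp
  qed
  have "(\<Sum>r\<in>A. B ^ (2 * i r) + B ^ (2 * j r + 1)) = (\<Sum>e<L. c e * B ^ e)"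
    using assms(1) sum_powers_eq_digits[of A "\<lambda>r. 2 * i r" L B] sum_powers_eq_digits[of A "\<lambda>r. 2 * j r + 1" L B] le
    by (force simp: sum.distrib c_def algebra_simps dest: le)
  then have *: "(\<Sum>r\<in>A. B ^ (2 * i r) + B ^ (2 * j r + 1)) div B ^ m mod B = c m" if "m < L" for m
    using digit_sum[of c B m L] cB that by simp
  have "2 * j r + 1 \<noteq> 2 * k" for r by presburger
  then have "{r \<in> A. 2 * j r + 1 = 2 * k} = {}" by blast
  then have "c (2 * k) = card {r \<in> A. i r = k}" unfolding c_def by (simp only: card.empty) simp
  then show "(\<Sum>r\<in>A. B ^ (2 * i r) + B ^ (2 * j r + 1)) div B ^ (2 * k) mod B = card {r \<in> A. i r = k}"
    using *[of "2 * k"] by (simp add: L_def)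
  have "2 * i r \<noteq> 2 * k + 1" for r by presburger
  then have "{r \<in> A. 2 * i r = 2 * k + 1} = {}" by blast
  then have "c (2 * k + 1) = card {r \<in> A. j r = k}" unfolding c_def by (simp only: card.empty) simp
  then show "(\<Sum>r\<in>A. B ^ (2 * i r) + B ^ (2 * j r + 1)) div B ^ (2 * k + 1) mod B = card {r \<in> A. j r = k}"
    using *[of "2 * k + 1"] by (simp add: L_def)
qed

definition freq :: "nat \<Rightarrow> nat \<Rightarrow> nat \<Rightarrow> int" where
  "freq B i j = int (B ^ (2 * i) + B ^ (2 * j + 1))"

lemma freq_inject:
  assumes "B > 1" "freq B i j = freq B i' j'" shows "i = i' \<and> j = j'"
proof -
  have *: "B ^ (2 * i) + B ^ (2 * j + 1) = B ^ (2 * i') + B ^ (2 * j' + 1)"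
    using assms unfolding freq_def by linarith
  then have e: "(\<Sum>r\<in>{()}. B ^ (2 * i) + B ^ (2 * j + 1)) = (\<Sum>r\<in>{()}. B ^ (2 * i') + B ^ (2 * j' + 1))"
    by simp
  have c: "card {()} < B" using assms by simp
  note d = digit_of_two_power_sum[OF finite.insertI[OF finite.emptyI] c]
  have "card {r \<in> {()}. i' = i} = card {r \<in> {()}. i = i}"
    using d(1)[of "\<lambda>_. i" "\<lambda>_. j" i] d(1)[of "\<lambda>_. i'" "\<lambda>_. j'" i] unfolding e by metis
  moreover have "card {r \<in> {()}. j' = j} = card {r \<in> {()}. j = j}"
    using d(2)[of "\<lambda>_. i" "\<lambda>_. j" j] d(2)[of "\<lambda>_. i'" "\<lambda>_. j'" j] unfolding e by metis
  ultimately show ?thesis by (auto split: if_splits)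
qed

text \<open>The nonzero even digits of \<open>n\<close> recover the set \<open>I\<close> of all
  first indices, the nonzero odd digits the set \<open>J\<close> of all second indices, each with at
  most K elements. Every representation takes its K terms from the at most K * K frequencies over
  \<open>I\<close> and \<open>J\<close>; how the indices are paired is not determined by
  \<open>n\<close>.\<close>

lemma card_freq_representations:
  assumes "K < B" and S: "S \<subseteq> range (case_prod (freq B))"
  shows "card {x \<in> PiE {..<K} (\<lambda>_. S). (\<Sum>r<K. x r) = n} \<le> (K * K) ^ K"
proof (cases "{x \<in> PiE {..<K} (\<lambda>_. S). (\<Sum>r<K. x r) = n} = {}")
  case True
  then show ?thesis by (simp only: card.empty)
next
  case False
  define I where "I = {k. nat n div B ^ (2 * k) mod B \<noteq> 0}"
  define J where "J = {k. nat n div B ^ (2 * k + 1) mod B \<noteq> 0}"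
  have *: "\<exists>i j. (\<forall>r<K. x r = freq B (i r) (j r)) \<and> i ` {..<K} = I \<and> j ` {..<K} = J"
    if x: "x \<in> PiE {..<K} (\<lambda>_. S)" "(\<Sum>r<K. x r) = n" for x
  proof -
    have "\<forall>r. \<exists>i j. r < K \<longrightarrow> x r = freq B i j"
      using x(1) S by (force simp: PiE_iff)
    then obtain i j where ij: "\<And>r. r < K \<Longrightarrow> x r = freq B (i r) (j r)" by metis
    have "n = (\<Sum>r<K. freq B (i r) (j r))" using x(2) ij by simp
    also have "\<dots> = int (\<Sum>r<K. B ^ (2 * i r) + B ^ (2 * j r + 1))" by (simp add: freq_def)
    finally have n: "nat n = (\<Sum>r<K. B ^ (2 * i r) + B ^ (2 * j r + 1))" by (simp only: nat_int)
    have c: "card {..<K} < B" using \<open>K < B\<close> by simp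
    have "I = i ` {..<K}"
      unfolding I_def n digit_of_two_power_sum(1)[OF finite_lessThan c] by (auto simp: card_eq_0_iff)
    moreover have "J = j ` {..<K}"
      unfolding J_def n digit_of_two_power_sum(2)[OF finite_lessThan c] by (auto simp: card_eq_0_iff)
    ultimately show ?thesis using ij by blast
  qed
  from False obtain x where "x \<in> PiE {..<K} (\<lambda>_. S)" "(\<Sum>r<K. x r) = n" by auto
  from *[OF this] obtain i j :: "nat \<Rightarrow> nat" where ij: "i ` {..<K} = I" "j ` {..<K} = J" by auto
  have fin: "finite I" "finite J" and card: "card I \<le> K" "card J \<le> K"
    using card_image_le[of "{..<K}" i] card_image_le[of "{..<K}" j]
    unfolding ij[symmetric] by auto
  define E where "E = case_prod (freq B) ` (I \<times> J)"
  have "card E \<le> card (I \<times> J)" unfolding E_def using fin by (intro card_image_le) auto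
  also have "\<dots> \<le> K * K" using card by (simp add: card_cartesian_product mult_mono)
  finally have "card E \<le> K * K" .
  have "{x \<in> PiE {..<K} (\<lambda>_. S). (\<Sum>r<K. x r) = n} \<subseteq> PiE {..<K} (\<lambda>_. E)"
  proof
    fix x assume x: "x \<in> {x \<in> PiE {..<K} (\<lambda>_. S). (\<Sum>r<K. x r) = n}"
    then obtain i j where "\<forall>r<K. x r = freq B (i r) (j r)" "i ` {..<K} = I" "j ` {..<K} = J"
      using * by blast
    then show "x \<in> PiE {..<K} (\<lambda>_. E)" using x unfolding E_def by (force simp: PiE_iff)
  qed
  then have "card {x \<in> PiE {..<K} (\<lambda>_. S). (\<Sum>r<K. x r) = n} \<le> card (PiE {..<K} (\<lambda>_. E))"
    using fin by (intro card_mono finite_PiE) (auto simp: E_def)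
  also have "\<dots> = card E ^ K" by (simp add: card_PiE)
  also have "\<dots> \<le> (K * K) ^ K" using \<open>card E \<le> K * K\<close> by (rule power_mono) simp
  finally show ?thesis .
qed

section \<open>From the Lambda property to bounded lacunary multipliers\<close>

lemma Holder_inequality:
  fixes u v :: "'a \<Rightarrow> real"
  assumes pq: "p > 1" "q > 1" "1 / p + 1 / q = 1"
    and nn: "\<And>x. u x \<ge> 0" "\<And>x. v x \<ge> 0"
    and int: "integrable M (\<lambda>x. u x powr p)" "integrable M (\<lambda>x. v x powr q)" "integrable M (\<lambda>x. u x * v x)"
  shows "(\<integral>x. u x * v x \<partial>M) \<le> (\<integral>x. u x powr p \<partial>M) powr (1 / p) * (\<integral>x. v x powr q \<partial>M) powr (1 / q)"
proof -
  let ?U = "\<integral>x. u x powr p \<partial>M" and ?V = "\<integral>x. v x powr q \<partial>M"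
  have UV: "?U \<ge> 0" "?V \<ge> 0" by (simp_all add: integral_nonneg_AE)
  show ?thesis
  proof (cases "?U = 0 \<or> ?V = 0")
    case True
    then have "AE x in M. u x * v x = 0"
    proof
      assume "?U = 0"
      then have "AE x in M. u x powr p = 0" using int by (subst (asm) integral_nonneg_eq_0_iff_AE) auto
      then show ?thesis by eventually_elim simp
    next
      assume "?V = 0"
      then have "AE x in M. v x powr q = 0" using int by (subst (asm) integral_nonneg_eq_0_iff_AE) auto
      then show ?thesis by eventually_elim simp
    qed
    then have "(\<integral>x. u x * v x \<partial>M) = 0" by (rule integral_eq_zero_AE)
    then show ?thesis by simp
  next
    case False
    define a b where "a = ?U powr (1 / p)" and "b = ?V powr (1 / q)"
    have ab: "a > 0" "b > 0" "a powr p = ?U" "b powr q = ?V"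
      using False UV pq by (auto simp: a_def b_def powr_powr)
    have "(\<integral>x. u x * v x \<partial>M) / (a * b) = (\<integral>x. (u x / a) * (v x / b) \<partial>M)" by simp
    also have "\<dots> \<le> (\<integral>x. u x powr p / ?U / p + v x powr q / ?V / q \<partial>M)"
    proof (rule integral_mono)
      show "integrable M (\<lambda>x. u x / a * (v x / b))" using int by simp
      show "integrable M (\<lambda>x. u x powr p / ?U / p + v x powr q / ?V / q)" using int by simp
      show "u x / a * (v x / b) \<le> u x powr p / ?U / p + v x powr q / ?V / q" for x
        using Youngs_inequality[OF pq, of "u x / a" "v x / b"] nn ab by (simp add: powr_divide)
    qed
    also have "\<dots> = 1" using int False pq by simp
    finally show ?thesis using ab(1,2) by (simp add: a_def b_def field_simps)
  qed
qed

lemma (in prob_space) Lyapunov_inequality: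
  fixes u :: "'a \<Rightarrow> real"
  assumes "0 < r" "r \<le> s" "\<And>x. u x \<ge> 0"
    and int: "integrable M (\<lambda>x. u x powr r)" "integrable M (\<lambda>x. u x powr s)"
  shows "(\<integral>x. u x powr r \<partial>M) powr (1 / r) \<le> (\<integral>x. u x powr s \<partial>M) powr (1 / s)"
proof (cases "r = s")
  case False
  define q where "q = s / (s - r)"
  have s: "s > r" "s > 0" using False assms by auto
  have q: "s / r > 1" "q > 1" "1 / (s / r) + 1 / q = 1"
    using assms s by (auto simp: q_def field_simps)
  have "(\<integral>x. u x powr r * 1 \<partial>M) \<le> (\<integral>x. (u x powr r) powr (s / r) \<partial>M) powr (1 / (s / r)) * (\<integral>x. 1 powr q \<partial>M) powr (1 / q)"
    using assms s by (intro Holder_inequality q) (auto simp: powr_powr)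
  then have "(\<integral>x. u x powr r \<partial>M) \<le> (\<integral>x. u x powr s \<partial>M) powr (r / s)"
    using assms s by (simp add: powr_powr prob_space)
  then have "(\<integral>x. u x powr r \<partial>M) powr (1 / r) \<le> ((\<integral>x. u x powr s \<partial>M) powr (r / s)) powr (1 / r)"
    using assms by (intro powr_mono2) (auto intro: integral_nonneg_AE)
  also have "\<dots> = (\<integral>x. u x powr s \<partial>M) powr (1 / s)" using assms s by (simp add: powr_powr)
  finally show ?thesis .
qed simp

lemma integrable_powr_trig: "p > 0 \<Longrightarrow> integrable unit_lebesgue (\<lambda>t. cmod (trig S b t) powr p)"
  by (intro integrable_unit_lebesgue_continuous continuous_on_powr' continuous_intros) auto

text \<open>The exponent 2K is accessible by counting representations; smaller exponents follow
  since L_q norms increase with q on a probability space. The factor (K * K)^K becomes K under the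
  2K-th root.\<close>

lemma trig_Lambda_set:
  assumes "finite S" "S \<subseteq> range (case_prod (freq B))" "K < B" "K \<ge> 1" "0 < q" "q \<le> 2 * real K"
  shows "(\<integral>t. cmod (trig S b t) powr q \<partial>unit_lebesgue) powr (1 / q)
     \<le> (real K * real K) * sqrt (\<Sum>n\<in>S. (cmod (b n))\<^sup>2)"
proof -
  let ?s = "\<Sum>n\<in>S. (cmod (b n))\<^sup>2"
  have s: "?s \<ge> 0" by (intro sum_nonneg) simp
  have K: "2 * real K > 0" using assms by simp
  have "(\<integral>t. cmod (trig S b t) powr q \<partial>unit_lebesgue) powr (1 / q)
    \<le> (\<integral>t. cmod (trig S b t) powr (2 * real K) \<partial>unit_lebesgue) powr (1 / (2 * real K))"
    using assms K by (intro unit_lebesgue.Lyapunov_inequality integrable_powr_trig) auto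
  also have "(\<integral>t. cmod (trig S b t) powr (2 * real K) \<partial>unit_lebesgue)
     = (\<integral>t. cmod (trig S b t) ^ (2 * K) \<partial>unit_lebesgue)"
  proof (intro Bochner_Integration.integral_cong refl)
    show "cmod (trig S b t) powr (2 * real K) = cmod (trig S b t) ^ (2 * K)" for t
      using K powr_realpow'[of "cmod (trig S b t)" "2 * K"] by simp
  qed
  also have "(\<integral>t. cmod (trig S b t) ^ (2 * K) \<partial>unit_lebesgue) powr (1 / (2 * real K))
     \<le> (real ((K * K) ^ K) * ?s ^ K) powr (1 / (2 * real K))"
  proof (intro powr_mono2 trig_even_norm_le integral_nonneg_AE)
    show "real (card {x \<in> {..<K} \<rightarrow>\<^sub>E S. sum x {..<K} = n}) \<le> real ((K * K) ^ K)" for n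
      using card_freq_representations[OF assms(3,2)] of_nat_le_iff by blast
  qed (use assms in auto)
  also have "real ((K * K) ^ K) * ?s ^ K = ((real K * real K) * ?s) ^ K"
    by (simp add: power_mult_distrib)
  also have "(((real K * real K) * ?s) ^ K) powr (1 / (2 * real K)) = ((real K * real K) * ?s) powr (1 / 2)"
  proof -
    have "(((real K * real K) * ?s) ^ K) = ((real K * real K) * ?s) powr real K"
      using s assms by (intro powr_realpow'[symmetric]) auto
    then show ?thesis using assms by (simp add: powr_powr)
  qed
  also have "\<dots> = real K * sqrt ?s"
    using s by (simp add: powr_half_sqrt real_sqrt_mult)
  also have "\<dots> \<le> (real K * real K) * sqrt ?s"
    using assms s by (intro mult_right_mono) auto
  finally show ?thesis .
qed

text \<open>The Lambda bound is used twice, with constant \<open>A = K * K\<close> each time, whence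
  \<open>K ^ 4\<close>. At \<open>p\<close> it bounds the output by the l_2 norm \<open>s\<close> of
  the coefficients on the lacunary part \<open>E\<close>. At the conjugate exponent \<open>q\<close>
  it bounds \<open>s\<close> by the input: s^2 is the pairing of the input with its projection onto
  \<open>E\<close>, at most ||input||_p times A s. Hence both \<open>p\<close> and
  \<open>p / (p - 1)\<close> must lie below 2K.\<close>

lemma lacunary_multiplier_bounded:
  assumes p: "1 < p" and K: "p \<le> 2 * real K" "p / (p - 1) \<le> 2 * real K" "K < B"
    and \<psi>: "\<And>n. n \<notin> range (case_prod (freq B)) \<Longrightarrow> \<psi> n = 0" "\<And>n. cmod (\<psi> n) \<le> 1" and S: "finite S"
  shows "(\<integral>t. cmod (trig S (\<lambda>n. \<psi> n * b n) t) powr p \<partial>unit_lebesgue)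
    \<le> (real K ^ 4) powr p * (\<integral>t. cmod (trig S b t) powr p \<partial>unit_lebesgue)"
proof -
  define q where "q = p / (p - 1)"
  have q: "q > 1" "1 / p + 1 / q = 1" "p > 0" "q > 0" using p by (auto simp: q_def field_simps)
  have "K \<noteq> 0" using K p by (intro notI) simp
  then have K1: "K \<ge> 1" by simp
  define A where "A = real K * real K"
  have A: "A > 0" using K1 by (simp add: A_def)
  define E where "E = S \<inter> range (case_prod (freq B))"
  have E: "finite E" "E \<subseteq> range (case_prod (freq B))" "S \<inter> E = E" "E \<inter> S = E" using S by (auto simp: E_def)
  define s where "s = sqrt (\<Sum>n\<in>E. (cmod (b n))\<^sup>2)"
  have s0: "s \<ge> 0" unfolding s_def by (intro real_sqrt_ge_zero sum_nonneg) simp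
  have s2: "s * s = (\<Sum>n\<in>E. (cmod (b n))\<^sup>2)" unfolding s_def by (simp add: sum_nonneg)
  let ?f = "\<lambda>t. cmod (trig S b t)" and ?h = "\<lambda>t. cmod (trig E b t)"
  let ?F = "(\<integral>t. ?f t powr p \<partial>unit_lebesgue) powr (1 / p)"
  have "trig S (\<lambda>n. \<psi> n * b n) t = trig E (\<lambda>n. \<psi> n * b n) t" for t
    unfolding trig_def using S \<psi> by (intro sum.mono_neutral_right) (auto simp: E_def)
  then have "(\<integral>t. cmod (trig S (\<lambda>n. \<psi> n * b n) t) powr p \<partial>unit_lebesgue) powr (1 / p)
     \<le> A * sqrt (\<Sum>n\<in>E. (cmod (\<psi> n * b n))\<^sup>2)"
    using trig_Lambda_set[OF E(1,2) K(3) K1 q(3) K(1)] by (simp add: A_def)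
  also have "\<dots> \<le> A * s"
  proof -
    have "cmod (\<psi> n * b n) \<le> cmod (b n)" for n
      using \<psi>(2) by (simp add: norm_mult mult_left_le_one_le)
    then show ?thesis
      unfolding s_def using A by (intro mult_left_mono real_sqrt_le_mono sum_mono power_mono) auto
  qed
  finally have 1: "(\<integral>t. cmod (trig S (\<lambda>n. \<psi> n * b n) t) powr p \<partial>unit_lebesgue) powr (1 / p) \<le> A * s" .
  have 2: "(\<integral>t. ?h t powr q \<partial>unit_lebesgue) powr (1 / q) \<le> A * s"
    using trig_Lambda_set[OF E(1,2) K(3) K1 q(4)] K(2) unfolding q_def[symmetric] by (simp add: A_def s_def)
  have "complex_of_real (s * s) = (\<integral>t. cnj (trig E b t) * trig S b t \<partial>unit_lebesgue)"
    unfolding trig_inner[OF E(1) S] E s2 by (simp add: complex_norm_square mult.commute del: of_real_power)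
  then have "s * s = cmod (\<integral>t. cnj (trig E b t) * trig S b t \<partial>unit_lebesgue)"
    using s0 by (metis norm_of_real abs_of_nonneg mult_nonneg_nonneg)
  also have "\<dots> \<le> (\<integral>t. cmod (cnj (trig E b t) * trig S b t) \<partial>unit_lebesgue)"
    by (rule integral_norm_bound)
  also have "\<dots> = (\<integral>t. ?f t * ?h t \<partial>unit_lebesgue)" by (simp add: norm_mult mult.commute)
  also have "\<dots> \<le> ?F * (\<integral>t. ?h t powr q \<partial>unit_lebesgue) powr (1 / q)"
    using p q by (intro Holder_inequality integrable_powr_trig
        integrable_unit_lebesgue_continuous[of "\<lambda>t. ?f t * ?h t"] continuous_intros) auto
  also have "\<dots> \<le> ?F * (A * s)" using 2 by (rule mult_left_mono) simp
  finally have "s * s \<le> (?F * A) * s" by (simp add: mult_ac)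
  then have "s \<le> ?F * A" using s0 A by (cases "s = 0") (auto simp: mult_nonneg_nonneg)
  then have "A * s \<le> A * (?F * A)" using A by (intro mult_left_mono) auto
  with 1 have "(\<integral>t. cmod (trig S (\<lambda>n. \<psi> n * b n) t) powr p \<partial>unit_lebesgue) powr (1 / p)
     \<le> (real K ^ 4) * ?F" by (simp add: A_def power4_eq_xxxx mult_ac)
  then have "((\<integral>t. cmod (trig S (\<lambda>n. \<psi> n * b n) t) powr p \<partial>unit_lebesgue) powr (1 / p)) powr p
     \<le> ((real K ^ 4) * ?F) powr p" using q by (intro powr_mono2) auto
  then show ?thesis using q by (simp add: powr_powr powr_mult integral_nonneg_AE)
qed

section \<open>The classical torus\<close>

definition ev :: "(int \<times> int \<Rightarrow> complex) \<Rightarrow> real \<times> real \<Rightarrow> complex" where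
  "ev a z = (\<Sum>m | a m \<noteq> 0. a m * (ch (fst m) (fst z) * ch (snd m) (snd z)))"

lemma ev_mult: assumes "nc_poly a" "nc_poly b" shows "ev (nc_mult 0 a b) z = ev a z * ev b z"
  unfolding ev_def sum_nc_mult[OF assms] sum_product
  by (simp add: nc_phase_def ch_add mult_ac)

lemma ev_adj: assumes "nc_poly a" shows "ev (nc_adj 0 a) z = cnj (ev a z)"
proof -
  have "ev (nc_adj 0 a) z = (\<Sum>m\<in>uminus ` {m. a m \<noteq> 0}. nc_adj 0 a m * (ch (fst m) (fst z) * ch (snd m) (snd z)))"
    unfolding ev_def using assms
    by (intro sum.mono_neutral_left) (force simp: nc_poly_def nc_adj_eq)+
  also have "\<dots> = cnj (ev a z)"
    by (subst sum.reindex) (auto simp: inj_on_def ev_def nc_adj_eq nc_phase_def cnj_ch)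
  finally show ?thesis .
qed

lemma ev_one: "ev nc_one z = 1"
proof -
  have "{m. nc_one m \<noteq> 0} = {(0, 0)}" by (auto simp: nc_one_def split: if_splits)
  then show ?thesis by (simp add: ev_def nc_one_def)
qed

lemma ev_pow: "nc_poly a \<Longrightarrow> ev (nc_pow 0 a n) z = ev a z ^ n"
  by (induction n) (simp_all add: ev_one ev_mult nc_poly_pow)

abbreviation unit_square :: "(real \<times> real) measure" where
  "unit_square \<equiv> unit_lebesgue \<Otimes>\<^sub>M unit_lebesgue"

interpretation unit_square: pair_prob_space unit_lebesgue unit_lebesgue ..

lemma measurable_ev [measurable]: "ev a \<in> borel_measurable unit_square"
  unfolding ev_def by measurable

lemma norm_ev_le: "cmod (ev a z) \<le> (\<Sum>m | a m \<noteq> 0. cmod (a m))"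
  unfolding ev_def by (rule order_trans[OF norm_sum]) (simp add: norm_mult)

lemma integrable_unit_square_bounded:
  fixes f :: "_ \<Rightarrow> 'a :: {banach, second_countable_topology}"
  assumes "f \<in> borel_measurable unit_square" "\<And>z. norm (f z) \<le> B"
  shows "integrable unit_square f"
  using assms by (intro unit_square.P.integrable_const_bound[where B = B]) auto

lemma integral_ev: assumes "nc_poly a" shows "(\<integral>z. ev a z \<partial>unit_square) = nc_trace a"
proof -
  have int: "integrable unit_square (\<lambda>z. ch k (fst z) * ch l (snd z))" for k l
  proof (rule integrable_unit_square_bounded[where B = 1])
    show "(\<lambda>z. ch k (fst z) * ch l (snd z)) \<in> borel_measurable unit_square" by measurable
    show "norm (ch k (fst z) * ch l (snd z)) \<le> 1" for z by (simp add: norm_mult)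
  qed
  have *: "(\<integral>z. ch k (fst z) * ch l (snd z) \<partial>unit_square) = (if k = 0 \<and> l = 0 then 1 else 0)" for k l
  proof -
    have "(\<integral>z. ch k (fst z) * ch l (snd z) \<partial>unit_square) = (\<integral>x. (\<integral>y. ch k x * ch l y \<partial>unit_lebesgue) \<partial>unit_lebesgue)"
      using unit_square.integral_fst'[OF int[of k l]] by simp
    then show ?thesis by (simp add: integral_ch)
  qed
  have "(\<integral>z. ev a z \<partial>unit_square) = (\<Sum>m | a m \<noteq> 0. a m * (if fst m = 0 \<and> snd m = 0 then 1 else 0))"
    unfolding ev_def by (subst Bochner_Integration.integral_sum) (use int in \<open>auto simp: *\<close>)
  also have "\<dots> = (\<Sum>m | a m \<noteq> 0. if m = (0, 0) then a m else 0)"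
    by (intro sum.cong refl) (auto simp: prod_eq_iff)
  also have "\<dots> = a (0, 0)"
    using assms by (simp add: sum.delta nc_poly_def)
  finally show ?thesis by (simp add: nc_trace_def)
qed

text \<open>At \<open>\<theta> = 0\<close> evaluation is multiplicative, turns adjoints into
  conjugates, and the trace is the mean over the torus. The moments of x^* x are therefore those of
  |ev a|^2.\<close>

lemma spec_meas_classical:
  assumes a: "nc_poly a"
  shows "spec_meas 0 a (distr unit_square borel (\<lambda>z. (cmod (ev a z))\<^sup>2))"
  unfolding spec_meas_def
proof (intro conjI allI)
  have [measurable]: "(\<lambda>z. (cmod (ev a z))\<^sup>2) \<in> borel_measurable unit_square" by measurable
  have "prob_space (distr unit_square borel (\<lambda>z. (cmod (ev a z))\<^sup>2))"
    by (rule unit_square.P.prob_space_distr) measurable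
  then show "finite_measure (distr unit_square borel (\<lambda>z. (cmod (ev a z))\<^sup>2))"
    by (simp add: prob_space_def)
  define R where "R = (\<Sum>m | a m \<noteq> 0. cmod (a m))"
  have R: "(cmod (ev a z))\<^sup>2 \<le> R\<^sup>2" for z
    unfolding R_def by (intro power_mono norm_ev_le) simp
  then have "AE t in distr unit_square borel (\<lambda>z. (cmod (ev a z))\<^sup>2). 0 \<le> t \<and> t \<le> R\<^sup>2"
    by (subst AE_distr_iff) auto
  then show "\<exists>R. AE t in distr unit_square borel (\<lambda>z. (cmod (ev a z))\<^sup>2). 0 \<le> t \<and> t \<le> R" by blast
  fix n
  show "integrable (distr unit_square borel (\<lambda>z. (cmod (ev a z))\<^sup>2)) (\<lambda>t. t ^ n)"
  proof (subst integrable_distr_eq)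
    show "integrable unit_square (\<lambda>z. ((cmod (ev a z))\<^sup>2) ^ n)"
      by (rule integrable_unit_square_bounded[where B = "(R\<^sup>2) ^ n"]) (auto intro!: power_mono R simp: norm_power)
  qed auto
  let ?y = "nc_mult 0 (nc_adj 0 a) a"
  have y: "nc_poly ?y" using a by (simp add: nc_poly_mult nc_poly_adj)
  have "complex_of_real (((cmod (ev a z))\<^sup>2) ^ n) = ev (nc_pow 0 ?y n) z" for z
  proof -
    have "complex_of_real (((cmod (ev a z))\<^sup>2) ^ n) = (complex_of_real ((cmod (ev a z))\<^sup>2)) ^ n"
      by (rule of_real_power)
    also have "\<dots> = (cnj (ev a z) * ev a z) ^ n"
      by (simp only: complex_norm_square mult.commute)
    also have "\<dots> = ev (nc_pow 0 ?y n) z"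
      by (simp only: ev_pow[OF y] ev_mult[OF nc_poly_adj[OF a] a] ev_adj[OF a])
    finally show ?thesis .
  qed
  then have "complex_of_real (\<integral>z. ((cmod (ev a z))\<^sup>2) ^ n \<partial>unit_square) = (\<integral>z. ev (nc_pow 0 ?y n) z \<partial>unit_square)"
    by (subst integral_complex_of_real[symmetric]) (simp only:)
  then have "(\<integral>z. ((cmod (ev a z))\<^sup>2) ^ n \<partial>unit_square) = Re (nc_trace (nc_pow 0 ?y n))"
    using y by (metis integral_ev nc_poly_pow Re_complex_of_real)
  then show "(\<integral>t. t ^ n \<partial>distr unit_square borel (\<lambda>z. (cmod (ev a z))\<^sup>2)) = Re (nc_trace (nc_pow 0 ?y n))"
    by (subst integral_distr) auto
qed simp

lemma nc_Lp_norm_classical: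
  assumes "nc_poly a"
  shows "nc_Lp_norm 0 p a = (\<integral>z. cmod (ev a z) powr p \<partial>unit_square) powr (1 / p)"
proof -
  have "((cmod (ev a z))\<^sup>2) powr (p / 2) = cmod (ev a z) powr p" for z
    by (cases "ev a z = 0") (simp_all add: powr_powr flip: powr_numeral)
  then show ?thesis
    unfolding nc_Lp_norm_eq[OF spec_meas_classical[OF assms]] by (subst integral_distr) auto
qed

lemma ev_eq_trig:
  assumes "nc_poly a" "finite S" "finite S'" "{m. a m \<noteq> 0} \<subseteq> S \<times> S'"
  shows "ev a (s, t) = trig S (\<lambda>k. trig S' (\<lambda>l. a (k, l)) t) s"
proof -
  have "ev a (s, t) = (\<Sum>m\<in>S \<times> S'. a m * (ch (fst m) s * ch (snd m) t))"
    unfolding ev_def using assms by (intro sum.mono_neutral_cong_left) auto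
  also have "\<dots> = (\<Sum>k\<in>S. \<Sum>l\<in>S'. a (k, l) * (ch k s * ch l t))"
    by (simp add: sum.cartesian_product case_prod_unfold)
  finally show ?thesis by (simp add: trig_def sum_distrib_left sum_distrib_right mult_ac)
qed

text \<open>For fixed second variable t the element is a trigonometric polynomial in s with
  coefficients depending on t. The one-variable bound is uniform in the coefficients, so it can be
  integrated over t.\<close>

lemma bounded_mult_classical:
  assumes p: "1 < p"
    and bd: "\<And>S b. finite S \<Longrightarrow> (\<integral>t. cmod (trig S (\<lambda>n. \<psi> n * b n) t) powr p \<partial>unit_lebesgue)
      \<le> A powr p * (\<integral>t. cmod (trig S b t) powr p \<partial>unit_lebesgue)" and A: "A \<ge> 0"
  shows "bounded_mult_Lp 0 p (\<lambda>m. \<psi> (fst m))"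
  unfolding bounded_mult_Lp_def
proof (intro exI allI impI)
  fix a assume a: "nc_poly a"
  let ?\<phi>a = "fourier_mult (\<lambda>m. \<psi> (fst m)) a"
  have \<phi>a: "nc_poly ?\<phi>a" using a by (rule nc_poly_fourier_mult)
  define S S' where "S = fst ` {m. a m \<noteq> 0}" and "S' = snd ` {m. a m \<noteq> 0}"
  have S: "finite S" "finite S'" using a by (auto simp: S_def S'_def nc_poly_def)
  have sub: "{m. a m \<noteq> 0} \<subseteq> S \<times> S'" by (force simp: S_def S'_def)
  have sub': "{m. ?\<phi>a m \<noteq> 0} \<subseteq> S \<times> S'" using sub by (auto simp: fourier_mult_def)
  have int: "integrable unit_square (\<lambda>z. cmod (ev c z) powr p)" for c
    by (rule integrable_unit_square_bounded[where B = "(\<Sum>m | c m \<noteq> 0. cmod (c m)) powr p"])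
       (use p in \<open>auto intro!: powr_mono2 norm_ev_le\<close>)
  have iter: "(\<integral>z. cmod (ev c z) powr p \<partial>unit_square) = (\<integral>t. (\<integral>s. cmod (ev c (s, t)) powr p \<partial>unit_lebesgue) \<partial>unit_lebesgue)"
    and iint: "integrable unit_lebesgue (\<lambda>t. (\<integral>s. cmod (ev c (s, t)) powr p \<partial>unit_lebesgue))" for c
    using unit_square.integral_snd[of "\<lambda>s t. cmod (ev c (s, t)) powr p"]
      unit_square.integrable_snd[of "\<lambda>s t. cmod (ev c (s, t)) powr p"] int[of c]
    by (simp_all add: case_prod_unfold)
  have "(\<integral>z. cmod (ev ?\<phi>a z) powr p \<partial>unit_square) \<le> (\<integral>t. A powr p * (\<integral>s. cmod (ev a (s, t)) powr p \<partial>unit_lebesgue) \<partial>unit_lebesgue)"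
    unfolding iter
  proof (rule integral_mono)
    fix t
    have "trig S (\<lambda>k. trig S' (\<lambda>l. ?\<phi>a (k, l)) t) s = trig S (\<lambda>k. \<psi> k * trig S' (\<lambda>l. a (k, l)) t) s" for s
      by (simp add: trig_def fourier_mult_def sum_distrib_left mult_ac)
    then show "(\<integral>s. cmod (ev ?\<phi>a (s, t)) powr p \<partial>unit_lebesgue) \<le> A powr p * (\<integral>s. cmod (ev a (s, t)) powr p \<partial>unit_lebesgue)"
      unfolding ev_eq_trig[OF \<phi>a S sub'] ev_eq_trig[OF a S sub] using bd[OF S(1)] by simp
  qed (use iint in auto)
  also have "\<dots> = A powr p * (\<integral>z. cmod (ev a z) powr p \<partial>unit_square)"
    unfolding iter by simp
  finally have "(\<integral>z. cmod (ev ?\<phi>a z) powr p \<partial>unit_square) powr (1 / p)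
     \<le> (A powr p * (\<integral>z. cmod (ev a z) powr p \<partial>unit_square)) powr (1 / p)"
    using p by (intro powr_mono2) (auto intro: integral_nonneg_AE)
  also have "\<dots> = A * (\<integral>z. cmod (ev a z) powr p \<partial>unit_square) powr (1 / p)"
    using p A by (simp add: powr_mult powr_powr integral_nonneg_AE)
  finally show "nc_Lp_norm 0 p ?\<phi>a \<le> A * nc_Lp_norm 0 p a"
    unfolding nc_Lp_norm_classical[OF a] nc_Lp_norm_classical[OF \<phi>a] .
qed

section \<open>Matrix-like elements of the rotation algebra\<close>

text \<open>The sign (-1)^c, where c is the number of binary places in which both i and j have a 1.
  No matrix size enters: every upper left block of size 2^r is a Hadamard matrix, so a single symbol
  serves all sizes.\<close>

function walsh :: "nat \<Rightarrow> nat \<Rightarrow> real" where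
  "walsh i j = (if i = 0 then 1 else (if odd i \<and> odd j then - 1 else 1) * walsh (i div 2) (j div 2))"
  by auto
termination by (relation "Wellfounded.measure fst") auto

declare walsh.simps [simp del]

lemma walsh_double: "walsh (2 * i) j = walsh i (j div 2)"
  "walsh (Suc (2 * i)) j = (if odd j then - 1 else 1) * walsh i (j div 2)"
  by (simp_all add: walsh.simps[of "2 * i"] walsh.simps[of "Suc (2 * i)"]) (simp add: walsh.simps)

lemma walsh_square: "walsh i j * walsh i j = 1"
  by (induction i j rule: walsh.induct) (subst (1 2) walsh.simps, auto simp: mult_ac)

lemma abs_walsh [simp]: "\<bar>walsh i j\<bar> = 1"
  using walsh_square[of i j] by (metis abs_mult_self_eq abs_square_eq_1 power2_eq_square)

text \<open>Rows 2i and 2i + 1 together contribute the factor 1 plus the product of two signs, which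
  vanishes when j and j' differ in the last bit; the other factor is the sum for the halved
  indices.\<close>

lemma walsh_orthogonal:
  assumes "j < 2 ^ r" "j' < 2 ^ r"
  shows "(\<Sum>i<2 ^ r. walsh i j * walsh i j') = (if j = j' then 2 ^ r else 0)"
  using assms
proof (induction r arbitrary: j j')
  case 0
  then show ?case by (simp add: walsh.simps)
next
  case (Suc r)
  let ?\<sigma> = "\<lambda>j::nat. if odd j then - 1 else 1 :: real"
  have "(\<Sum>i<2 * 2 ^ r. walsh i j * walsh i j')
    = (\<Sum>i<2 ^ r. walsh (2 * i) j * walsh (2 * i) j' + walsh (Suc (2 * i)) j * walsh (Suc (2 * i)) j')"
    using sum.nat_group[of "\<lambda>i. walsh i j * walsh i j'" 2 "2 ^ r"]
    by (simp add: mult.commute[of _ 2] numeral_2_eq_2)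
  also have "\<dots> = (1 + ?\<sigma> j * ?\<sigma> j') * (\<Sum>i<2 ^ r. walsh i (j div 2) * walsh i (j' div 2))"
    unfolding walsh_double sum_distrib_left by (intro sum.cong refl) (simp add: algebra_simps)
  also have "(\<Sum>i<2 ^ r. walsh i (j div 2) * walsh i (j' div 2)) = (if j div 2 = j' div 2 then 2 ^ r else 0)"
    using Suc.prems by (intro Suc.IH) auto
  also have "(1 + ?\<sigma> j * ?\<sigma> j') * (if j div 2 = j' div 2 then 2 ^ r else 0) = (if j = j' then 2 ^ Suc r else 0)"
  proof (cases "j = j'")
    case False
    then have "even j \<noteq> even j'" if "j div 2 = j' div 2" using that by (metis even_two_times_div_two odd_two_times_div_two_succ)
    then show ?thesis using False by auto
  qed auto
  finally show ?case by simp
qed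

text \<open>The representation on sequences along the orbit of t under rotation by \<theta>: U is
  the shift taking \<xi>(r) to \<xi>(r + 1), and V multiplies by e^(2 pi i (t + r \<theta>)). All
  sums are finite, so arbitrary sequences are allowed.\<close>

definition orbit_op :: "real \<Rightarrow> real \<Rightarrow> (int \<times> int \<Rightarrow> complex) \<Rightarrow> (int \<Rightarrow> complex) \<Rightarrow> int \<Rightarrow> complex" where
  "orbit_op \<theta> t a \<xi> r = (\<Sum>m | a m \<noteq> 0. a m * (ch (snd m) (t + of_int (r + fst m) * \<theta>) * \<xi> (r + fst m)))"

lemma orbit_op_mult:
  assumes "nc_poly a" "nc_poly b"
  shows "orbit_op \<theta> t (nc_mult \<theta> a b) \<xi> = orbit_op \<theta> t a (orbit_op \<theta> t b \<xi>)"
proof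
  fix r
  have "nc_phase \<theta> i j * (ch (snd i + snd j) (t + of_int (r + (fst i + fst j)) * \<theta>))
     = ch (snd i) (t + of_int (r + fst i) * \<theta>) * ch (snd j) (t + of_int (r + fst i + fst j) * \<theta>)" for i j
    by (simp add: nc_phase_def ch_def cis_mult algebra_simps)
  then have "nc_phase \<theta> i j * (ch (snd i + snd j) (t + of_int (r + (fst i + fst j)) * \<theta>) * c)
     = ch (snd i) (t + of_int (r + fst i) * \<theta>) * (ch (snd j) (t + of_int (r + fst i + fst j) * \<theta>) * c)" for i j c
    by (metis mult.assoc)
  then show "orbit_op \<theta> t (nc_mult \<theta> a b) \<xi> r = orbit_op \<theta> t a (orbit_op \<theta> t b \<xi>) r"
    unfolding orbit_op_def sum_nc_mult[OF assms] sum_distrib_left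
    by (intro sum.cong refl) (simp add: mult_ac add_ac)
qed

lemma orbit_op_one: "orbit_op \<theta> t nc_one \<xi> = \<xi>"
proof
  fix r
  have "{m. nc_one m \<noteq> 0} = {(0, 0)}" by (auto simp: nc_one_def split: if_splits)
  then show "orbit_op \<theta> t nc_one \<xi> r = \<xi> r" by (simp add: orbit_op_def nc_one_def)
qed

lemma orbit_op_pow: "nc_poly a \<Longrightarrow> orbit_op \<theta> t (nc_pow \<theta> a n) \<xi> = (orbit_op \<theta> t a ^^ n) \<xi>"
  by (induction n) (simp_all add: orbit_op_one orbit_op_mult nc_poly_pow)

definition \<delta>0 :: "int \<Rightarrow> complex" where "\<delta>0 r = (if r = 0 then 1 else 0)"

text \<open>Only terms without a power of U link the site 0 to itself, and averaging over the
  starting point t removes the nonzero powers of V.\<close>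

lemma nc_trace_eq_integral:
  assumes "nc_poly a"
  shows "nc_trace a = (\<integral>t. orbit_op \<theta> t a \<delta>0 0 \<partial>unit_lebesgue)"
proof -
  have "orbit_op \<theta> t a \<delta>0 0 = (\<Sum>m | a m \<noteq> 0. if fst m = 0 then a m * ch (snd m) t else 0)" for t
    unfolding orbit_op_def \<delta>0_def by (intro sum.cong refl) simp
  then have "(\<integral>t. orbit_op \<theta> t a \<delta>0 0 \<partial>unit_lebesgue)
     = (\<integral>t. (\<Sum>m | a m \<noteq> 0. (if fst m = 0 then a m else 0) * ch (snd m) t) \<partial>unit_lebesgue)"
    by (simp add: if_distrib[of "\<lambda>x. x * _"] cong: if_cong)
  also have "\<dots> = (\<Sum>m | a m \<noteq> 0. \<integral>t. (if fst m = 0 then a m else 0) * ch (snd m) t \<partial>unit_lebesgue)"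
    by (rule Bochner_Integration.integral_sum) (intro integrable_unit_lebesgue_continuous continuous_intros)
  also have "\<dots> = (\<Sum>m | a m \<noteq> 0. if m = (0, 0) then a m else 0)"
    by (intro sum.cong refl) (auto simp: integral_ch prod_eq_iff)
  also have "\<dots> = a (0, 0)" using assms by (simp add: sum.delta nc_poly_def)
  finally show ?thesis by (simp add: nc_trace_def)
qed

text \<open>The element \<open>\<Sum>i j. A i j U\<^bsup>n i\<^esup> h(V) U\<^bsup>m j\<^esup>\<close> for the trigonometric polynomial
  \<open>h = trig L c\<close>; if \<open>h\<close> were the indicator of a set with disjoint translates, this would be
  a matrix \<open>A\<close> with respect to a system of matrix units.\<close>

definition corner :: "real \<Rightarrow> nat \<Rightarrow> (nat \<Rightarrow> int) \<Rightarrow> (nat \<Rightarrow> int) \<Rightarrow> (nat \<Rightarrow> nat \<Rightarrow> real) \<Rightarrow> int set \<Rightarrow> (int \<Rightarrow> complex)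
    \<Rightarrow> int \<times> int \<Rightarrow> complex" where
  "corner \<theta> N n m A L c = (\<lambda>q. \<Sum>i<N. \<Sum>j<N. \<Sum>l\<in>L.
      if q = (n i + m j, l) then of_real (A i j) * (c l * ch l (- of_int (m j) * \<theta>)) else 0)"

lemma corner_support:
  "corner \<theta> N n m A L c q \<noteq> 0 \<Longrightarrow> q \<in> (\<lambda>(i, j). n i + m j) ` ({..<N} \<times> {..<N}) \<times> L"
proof (rule ccontr)
  assume "corner \<theta> N n m A L c q \<noteq> 0" and q: "q \<notin> (\<lambda>(i, j). n i + m j) ` ({..<N} \<times> {..<N}) \<times> L"
  have "corner \<theta> N n m A L c q = 0"
    unfolding corner_def using q by (intro sum.neutral ballI) auto
  then show False using \<open>corner \<theta> N n m A L c q \<noteq> 0\<close> by simp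
qed

lemma nc_poly_corner: "finite L \<Longrightarrow> nc_poly (corner \<theta> N n m A L c)"
  by (rule nc_polyI[OF _ corner_support]) auto

lemma sum_corner:
  assumes "finite L"
  shows "(\<Sum>q | corner \<theta> N n m A L c q \<noteq> 0. corner \<theta> N n m A L c q * G q)
    = (\<Sum>i<N. \<Sum>j<N. of_real (A i j) * (\<Sum>l\<in>L. c l * ch l (- of_int (m j) * \<theta>) * G (n i + m j, l)))"
proof -
  define W where "W = (\<lambda>(i, j). n i + m j) ` ({..<N} \<times> {..<N}) \<times> L"
  have W: "finite W" unfolding W_def using assms by auto
  have "(\<Sum>q | corner \<theta> N n m A L c q \<noteq> 0. corner \<theta> N n m A L c q * G q) = (\<Sum>q\<in>W. corner \<theta> N n m A L c q * G q)"
    using W corner_support[of \<theta> N n m A L c] by (intro sum.mono_neutral_left) (auto simp: W_def)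
  also have "\<dots> = (\<Sum>q\<in>W. \<Sum>i<N. \<Sum>j<N. \<Sum>l\<in>L.
      if q = (n i + m j, l) then of_real (A i j) * (c l * ch l (- of_int (m j) * \<theta>)) * G q else 0)"
    unfolding corner_def sum_distrib_right by (intro sum.cong refl) simp
  also have "\<dots> = (\<Sum>i<N. \<Sum>j<N. \<Sum>l\<in>L. \<Sum>q\<in>W.
      if q = (n i + m j, l) then of_real (A i j) * (c l * ch l (- of_int (m j) * \<theta>)) * G q else 0)"
    by (subst sum.swap, intro sum.cong refl, subst sum.swap, intro sum.cong refl, rule sum.swap)
  also have "\<dots> = (\<Sum>i<N. \<Sum>j<N. \<Sum>l\<in>L.
      of_real (A i j) * (c l * ch l (- of_int (m j) * \<theta>)) * G (n i + m j, l))"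
    using W by (intro sum.cong refl) (force simp: sum.delta W_def)
  finally show ?thesis by (simp add: sum_distrib_left mult_ac)
qed

text \<open>The orbit action of the sum of the A i j U^(n i) h(V) U^(m j), with
  \<open>corner_bwd\<close> for its adjoint. It is formulated for an arbitrary real function
  \<open>h\<close>, so that it also covers the limiting bump, for which no polynomial element is at
  hand.\<close>

definition corner_fwd :: "real \<Rightarrow> nat \<Rightarrow> (nat \<Rightarrow> int) \<Rightarrow> (nat \<Rightarrow> int) \<Rightarrow> (nat \<Rightarrow> nat \<Rightarrow> real) \<Rightarrow> (real \<Rightarrow> real) \<Rightarrow> real
    \<Rightarrow> (int \<Rightarrow> complex) \<Rightarrow> int \<Rightarrow> complex" where
  "corner_fwd \<theta> N n m A h t \<xi> r = (\<Sum>i<N. \<Sum>j<N.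
     of_real (A i j * h (t + of_int (r + n i) * \<theta>)) * \<xi> (r + n i + m j))"

definition corner_bwd :: "real \<Rightarrow> nat \<Rightarrow> (nat \<Rightarrow> int) \<Rightarrow> (nat \<Rightarrow> int) \<Rightarrow> (nat \<Rightarrow> nat \<Rightarrow> real) \<Rightarrow> (real \<Rightarrow> real) \<Rightarrow> real
    \<Rightarrow> (int \<Rightarrow> complex) \<Rightarrow> int \<Rightarrow> complex" where
  "corner_bwd \<theta> N n m A h t \<xi> r = (\<Sum>i<N. \<Sum>j<N.
     of_real (A i j * h (t + of_int (r - m j) * \<theta>)) * \<xi> (r - m j - n i))"

definition corner_sq :: "real \<Rightarrow> nat \<Rightarrow> (nat \<Rightarrow> int) \<Rightarrow> (nat \<Rightarrow> int) \<Rightarrow> (nat \<Rightarrow> nat \<Rightarrow> real) \<Rightarrow> (real \<Rightarrow> real) \<Rightarrow> real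
    \<Rightarrow> (int \<Rightarrow> complex) \<Rightarrow> int \<Rightarrow> complex" where
  "corner_sq \<theta> N n m A h t \<xi> = corner_bwd \<theta> N n m A h t (corner_fwd \<theta> N n m A h t \<xi>)"

text \<open>The factor \<open>ch l (- of_int (m j) * \<theta>)\<close> in \<open>corner\<close> is
  the phase from rewriting V^l U^(m j) as a multiple of U^(m j) V^l. Here it cancels the shift by
  \<open>m j\<close>, so \<open>h\<close> is sampled at the site \<open>r + n i\<close>.\<close>

lemma orbit_op_corner:
  assumes L: "finite L" and h: "\<And>s. trig L c s = of_real (h s)"
  shows "orbit_op \<theta> t (corner \<theta> N n m A L c) \<xi> = corner_fwd \<theta> N n m A h t \<xi>"
proof
  fix r
  have "ch l (- of_int (m j) * \<theta>) * ch l (t + of_int (r + (n i + m j)) * \<theta>) = ch l (t + of_int (r + n i) * \<theta>)" for i j l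
    unfolding ch_add_arg[symmetric] by (simp add: algebra_simps)
  then have "(\<Sum>l\<in>L. c l * ch l (- of_int (m j) * \<theta>) * (ch l (t + of_int (r + (n i + m j)) * \<theta>) * \<xi> (r + (n i + m j))))
     = trig L c (t + of_int (r + n i) * \<theta>) * \<xi> (r + n i + m j)" for i j
    unfolding trig_def sum_distrib_right by (intro sum.cong refl) (metis (no_types) mult.assoc add.assoc)
  then show "orbit_op \<theta> t (corner \<theta> N n m A L c) \<xi> r = corner_fwd \<theta> N n m A h t \<xi> r"
    unfolding orbit_op_def sum_corner[OF L] corner_fwd_def by (simp add: h mult.assoc)
qed

lemma orbit_op_adj:
  assumes "nc_poly a"
  shows "orbit_op \<theta> t (nc_adj \<theta> a) \<xi> r = cnj (\<Sum>m | a m \<noteq> 0. a m * (ch (snd m) (t + of_int r * \<theta>) * cnj (\<xi> (r - fst m))))"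
proof -
  have "orbit_op \<theta> t (nc_adj \<theta> a) \<xi> r = (\<Sum>m\<in>uminus ` {m. a m \<noteq> 0}.
      nc_adj \<theta> a m * (ch (snd m) (t + of_int (r + fst m) * \<theta>) * \<xi> (r + fst m)))"
    unfolding orbit_op_def using assms
    by (intro sum.mono_neutral_left) (force simp: nc_poly_def nc_adj_eq)+
  also have "\<dots> = (\<Sum>m | a m \<noteq> 0. cnj (a m) * nc_phase \<theta> (-m) (-m) * (ch (- snd m) (t + of_int (r - fst m) * \<theta>) * \<xi> (r - fst m)))"
    by (subst sum.reindex) (auto simp: inj_on_def nc_adj_eq)
  also have "\<dots> = (\<Sum>m | a m \<noteq> 0. cnj (a m) * cnj (ch (snd m) (t + of_int r * \<theta>)) * \<xi> (r - fst m))"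
  proof (intro sum.cong refl)
    fix m
    have "nc_phase \<theta> (-m) (-m) * ch (- snd m) (t + of_int (r - fst m) * \<theta>) = cnj (ch (snd m) (t + of_int r * \<theta>))"
      by (simp add: nc_phase_def ch_def cis_mult cis_cnj algebra_simps)
    then show "cnj (a m) * nc_phase \<theta> (-m) (-m) * (ch (- snd m) (t + of_int (r - fst m) * \<theta>) * \<xi> (r - fst m))
      = cnj (a m) * cnj (ch (snd m) (t + of_int r * \<theta>)) * \<xi> (r - fst m)"
      by (metis mult.assoc)
  qed
  finally show ?thesis by (simp add: mult.assoc)
qed

lemma orbit_op_adj_corner:
  assumes L: "finite L" and h: "\<And>s. trig L c s = of_real (h s)"
  shows "orbit_op \<theta> t (nc_adj \<theta> (corner \<theta> N n m A L c)) \<xi> = corner_bwd \<theta> N n m A h t \<xi>"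
proof
  fix r
  have "ch l (- of_int (m j) * \<theta>) * ch l (t + of_int r * \<theta>) = ch l (t + of_int (r - m j) * \<theta>)" for j l
    unfolding ch_add_arg[symmetric] by (simp add: algebra_simps)
  then have "(\<Sum>l\<in>L. c l * ch l (- of_int (m j) * \<theta>) * (ch l (t + of_int r * \<theta>) * cnj (\<xi> (r - (n i + m j)))))
     = trig L c (t + of_int (r - m j) * \<theta>) * cnj (\<xi> (r - m j - n i))" for i j
    unfolding trig_def sum_distrib_right by (intro sum.cong refl) (metis (no_types) mult.assoc diff_diff_eq add.commute)
  then show "orbit_op \<theta> t (nc_adj \<theta> (corner \<theta> N n m A L c)) \<xi> r = corner_bwd \<theta> N n m A h t \<xi> r"
    unfolding orbit_op_adj[OF nc_poly_corner[OF L]] sum_corner[OF L] corner_bwd_def by (simp add: h mult.assoc)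
qed

text \<open>The moments depend on the element only through the values of \<open>h\<close>, which
  allows a passage to the limit under the integral when \<open>h\<close> converges
  pointwise.\<close>

lemma corner_moment:
  fixes \<theta> :: real and N :: nat and n m :: "nat \<Rightarrow> int" and A :: "nat \<Rightarrow> nat \<Rightarrow> real"
  assumes L: "finite L" and h: "\<And>s. trig L c s = of_real (h s)"
  defines "x \<equiv> corner \<theta> N n m A L c"
  shows "nc_trace (nc_pow \<theta> (nc_mult \<theta> (nc_adj \<theta> x) x) k)
    = (\<integral>t. (corner_sq \<theta> N n m A h t ^^ k) \<delta>0 0 \<partial>unit_lebesgue)"
proof -
  have x: "nc_poly x" unfolding x_def by (rule nc_poly_corner[OF L])
  have "orbit_op \<theta> t (nc_mult \<theta> (nc_adj \<theta> x) x) = corner_sq \<theta> N n m A h t" for t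
    unfolding orbit_op_mult[OF nc_poly_adj[OF x] x, abs_def]
    by (rule ext) (simp only: x_def orbit_op_corner[OF L h] orbit_op_adj_corner[OF L h] corner_sq_def
        orbit_op_mult nc_poly_adj nc_poly_corner L)
  then show ?thesis
    using x by (simp add: nc_trace_eq_integral[of _ \<theta>] nc_poly_pow nc_poly_mult nc_poly_adj orbit_op_pow)
qed

lemma norm_corner_sq_le:
  assumes A: "\<And>i j. \<bar>A i j\<bar> \<le> 1" and h: "\<And>s. \<bar>h s\<bar> \<le> H" and \<xi>: "\<And>r. cmod (\<xi> r) \<le> M"
  shows "cmod (corner_sq \<theta> N n m A h t \<xi> r) \<le> (real N * real N * H)\<^sup>2 * M"
proof -
  have H: "H \<ge> 0" using h[of 0] by linarith
  have 1: "cmod (\<Sum>i<N. \<Sum>j<N. of_real (A i j * h (a i j)) * \<eta> (b i j)) \<le> real N * real N * H * M"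
    if "\<And>r. cmod (\<eta> r) \<le> M" for a :: "nat \<Rightarrow> nat \<Rightarrow> real" and b :: "nat \<Rightarrow> nat \<Rightarrow> int" and \<eta> M
  proof -
    have "cmod (of_real (A i j * h (a i j)) * \<eta> (b i j)) \<le> (1 * H) * M" for i j
      unfolding norm_mult norm_of_real abs_mult
      by (intro mult_mono A h that) (use H in auto)
    then have "cmod (\<Sum>i<N. \<Sum>j<N. of_real (A i j * h (a i j)) * \<eta> (b i j)) \<le> (\<Sum>i<N. \<Sum>j<N. (1 * H) * M)"
      by (intro order_trans[OF norm_sum] sum_mono)
    then show ?thesis by simp
  qed
  have "cmod (corner_sq \<theta> N n m A h t \<xi> r) \<le> real N * real N * H * (real N * real N * H * M)"
    unfolding corner_sq_def corner_bwd_def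
    by (rule 1) (unfold corner_fwd_def, rule 1, rule \<xi>)
  then show ?thesis by (simp add: power2_eq_square mult_ac)
qed

lemma norm_corner_sq_pow_le:
  assumes A: "\<And>i j. \<bar>A i j\<bar> \<le> 1" and h: "\<And>s. \<bar>h s\<bar> \<le> H"
  shows "cmod ((corner_sq \<theta> N n m A h t ^^ k) \<delta>0 r) \<le> ((real N * real N * H)\<^sup>2) ^ k"
proof (induction k arbitrary: r)
  case 0
  then show ?case by (simp add: \<delta>0_def)
next
  case (Suc k)
  have "cmod (corner_sq \<theta> N n m A h t ((corner_sq \<theta> N n m A h t ^^ k) \<delta>0) r) \<le> (real N * real N * H)\<^sup>2 * ((real N * real N * H)\<^sup>2) ^ k"
    by (rule norm_corner_sq_le) (rule A h Suc.IH)+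
  then show ?case by simp
qed

lemma measurable_corner_sq:
  assumes [measurable]: "h \<in> borel_measurable borel" "\<And>r. (\<lambda>t. \<xi> t r) \<in> borel_measurable borel"
  shows "(\<lambda>t. corner_sq \<theta> N n m A h t (\<xi> t) r) \<in> borel_measurable borel"
  unfolding corner_sq_def corner_bwd_def corner_fwd_def by measurable

lemma measurable_corner_sq_pow:
  assumes [measurable]: "h \<in> borel_measurable borel"
  shows "(\<lambda>t. (corner_sq \<theta> N n m A h t ^^ k) \<delta>0 r) \<in> borel_measurable borel"
proof (induction k arbitrary: r)
  case (Suc k)
  show ?case unfolding funpow.simps comp_def by (intro measurable_corner_sq assms Suc.IH)
qed simp

lemma corner_sq_pow_tendsto:
  assumes h: "\<And>s. (\<lambda>k. h k s) \<longlonglongrightarrow> g s"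
  shows "(\<lambda>s. (corner_sq \<theta> N n m A (h s) t ^^ k) \<delta>0 r) \<longlonglongrightarrow> (corner_sq \<theta> N n m A g t ^^ k) \<delta>0 r"
proof (induction k arbitrary: r)
  case (Suc k)
  show ?case unfolding funpow.simps comp_def corner_sq_def corner_bwd_def corner_fwd_def
    by (intro tendsto_intros h Suc.IH[unfolded corner_sq_def corner_bwd_def corner_fwd_def])
qed simp

lemma corner_moment_tendsto:
  assumes L: "\<And>s. finite (L s)" and h: "\<And>s u. trig (L s) (c s) u = of_real (h s u)"
    and lim: "\<And>u. (\<lambda>s. h s u) \<longlonglongrightarrow> g u" and bd: "\<And>s u. \<bar>h s u\<bar> \<le> H"
    and meas: "\<And>s. h s \<in> borel_measurable borel" "g \<in> borel_measurable borel"
    and A: "\<And>i j. \<bar>A i j\<bar> \<le> 1"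
  shows "(\<lambda>s. nc_trace (nc_pow \<theta> (nc_mult \<theta> (nc_adj \<theta> (corner \<theta> N n m A (L s) (c s))) (corner \<theta> N n m A (L s) (c s))) k))
     \<longlonglongrightarrow> (\<integral>t. (corner_sq \<theta> N n m A g t ^^ k) \<delta>0 0 \<partial>unit_lebesgue)"
  unfolding corner_moment[OF L h]
proof (rule integral_dominated_convergence[where w = "\<lambda>_. ((real N * real N * H)\<^sup>2) ^ k"])
  show "(\<lambda>t. (corner_sq \<theta> N n m A g t ^^ k) \<delta>0 0) \<in> borel_measurable unit_lebesgue"
    "(\<lambda>t. (corner_sq \<theta> N n m A (h s) t ^^ k) \<delta>0 0) \<in> borel_measurable unit_lebesgue" for s
    by (intro measurable_unit_lebesgue measurable_corner_sq_pow meas)+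
  show "AE t in unit_lebesgue. (\<lambda>s. (corner_sq \<theta> N n m A (h s) t ^^ k) \<delta>0 0) \<longlonglongrightarrow> (corner_sq \<theta> N n m A g t ^^ k) \<delta>0 0"
    by (intro AE_I2 corner_sq_pow_tendsto lim)
  show "AE t in unit_lebesgue. norm ((corner_sq \<theta> N n m A (h s) t ^^ k) \<delta>0 0) \<le> ((real N * real N * H)\<^sup>2) ^ k" for s
    by (intro AE_I2 norm_corner_sq_pow_le A bd)
qed simp

text \<open>Serves to confine the spectral measures of all approximants to one interval: the radius
  in \<open>spec_meas\<close> may vary with the element, whereas convergence of moments is applied
  with a common one.\<close>

lemma corner_moment_bound:
  fixes \<theta> :: real and N :: nat and n m :: "nat \<Rightarrow> int" and A :: "nat \<Rightarrow> nat \<Rightarrow> real"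
  assumes L: "finite L" and h: "\<And>s. trig L c s = of_real (h s)" and bd: "\<And>s. \<bar>h s\<bar> \<le> H"
    and meas: "h \<in> borel_measurable borel" and A: "\<And>i j. \<bar>A i j\<bar> \<le> 1"
  defines "x \<equiv> corner \<theta> N n m A L c"
  shows "cmod (nc_trace (nc_pow \<theta> (nc_mult \<theta> (nc_adj \<theta> x) x) k)) \<le> ((real N * real N * H)\<^sup>2) ^ k"
proof -
  have b: "cmod ((corner_sq \<theta> N n m A h t ^^ k) \<delta>0 0) \<le> ((real N * real N * H)\<^sup>2) ^ k" for t
    by (intro norm_corner_sq_pow_le A bd)
  have "cmod (\<integral>t. (corner_sq \<theta> N n m A h t ^^ k) \<delta>0 0 \<partial>unit_lebesgue) \<le> (\<integral>t. cmod ((corner_sq \<theta> N n m A h t ^^ k) \<delta>0 0) \<partial>unit_lebesgue)"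
    by (rule integral_norm_bound)
  also have "\<dots> \<le> (\<integral>t. ((real N * real N * H)\<^sup>2) ^ k \<partial>unit_lebesgue)"
  proof (rule integral_mono)
    show "integrable unit_lebesgue (\<lambda>t. cmod ((corner_sq \<theta> N n m A h t ^^ k) \<delta>0 0))"
      by (intro integrable_norm unit_lebesgue.integrable_const_bound[where B = "((real N * real N * H)\<^sup>2) ^ k"]
          AE_I2 b measurable_unit_lebesgue measurable_corner_sq_pow meas)
  qed (use b in auto)
  finally show ?thesis
    unfolding x_def corner_moment[OF L h] using unit_lebesgue.prob_space by simp
qed

text \<open>If the translates of \<open>g\<close> are disjointly supported then \<open>(x\<^sup>* x)\<^sup>k\<close> is governed by
  the matrix power \<open>(A\<^sup>T A)\<^sup>k\<close>; \<open>gram_pow\<close> is indexed so that \<open>gram_pow N A k = (A\<^sup>T A)\<^bsup>k + 1\<^esup>\<close>.\<close>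

fun gram_pow :: "nat \<Rightarrow> (nat \<Rightarrow> nat \<Rightarrow> real) \<Rightarrow> nat \<Rightarrow> nat \<Rightarrow> nat \<Rightarrow> real" where
  "gram_pow N A 0 j j' = (\<Sum>i<N. A i j * A i j')"
| "gram_pow N A (Suc k) j j' = (\<Sum>q<N. gram_pow N A 0 j q * gram_pow N A k q j')"

context
  fixes \<theta> :: real and N :: nat and n m :: "nat \<Rightarrow> int" and g :: "real \<Rightarrow> real"
  assumes disj_n: "\<And>i i' s. i < N \<Longrightarrow> i' < N \<Longrightarrow> i \<noteq> i' \<Longrightarrow> g s * g (s + of_int (n i - n i') * \<theta>) = 0"
    and disj_m: "\<And>i i' s. i < N \<Longrightarrow> i' < N \<Longrightarrow> i \<noteq> i' \<Longrightarrow> g s * g (s + of_int (m i - m i') * \<theta>) = 0"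
begin

text \<open>In x^* x the shifts U^(- n i) U^(n i') stand between two copies of \<open>g\<close>;
  disjointness of the translates forces i = i', as for matrix units.\<close>

lemma corner_sq_disjoint:
  "corner_sq \<theta> N n m A g t \<xi> r = (\<Sum>j<N. \<Sum>j'<N.
     of_real (gram_pow N A 0 j j' * g (t + of_int (r - m j) * \<theta>) ^ 2) * \<xi> (r - m j + m j'))"
proof -
  have "corner_sq \<theta> N n m A g t \<xi> r = (\<Sum>i<N. \<Sum>j<N. \<Sum>i'<N. \<Sum>j'<N.
     of_real (A i j * A i' j' * (g (t + of_int (r - m j) * \<theta>) * g (t + of_int (r - m j) * \<theta> + of_int (n i' - n i) * \<theta>)))
      * \<xi> (r - m j - n i + n i' + m j'))"
    unfolding corner_sq_def corner_bwd_def corner_fwd_def sum_distrib_left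
    by (intro sum.cong refl) (simp add: algebra_simps)
  also have "\<dots> = (\<Sum>i<N. \<Sum>j<N. \<Sum>i'<N. if i' = i then \<Sum>j'<N.
     of_real (A i j * A i j' * (g (t + of_int (r - m j) * \<theta>) ^ 2)) * \<xi> (r - m j + m j') else 0)"
  proof (intro sum.cong refl)
    fix i j i' assume "i \<in> {..<N}" "i' \<in> {..<N}"
    then have d: "g (t + of_int (r - m j) * \<theta>) * g (t + of_int (r - m j) * \<theta> + of_int (n i' - n i) * \<theta>) = 0" if "i' \<noteq> i"
      using disj_n[of i' i] that by blast
    show "(\<Sum>j'<N.
     of_real (A i j * A i' j' * (g (t + of_int (r - m j) * \<theta>) * g (t + of_int (r - m j) * \<theta> + of_int (n i' - n i) * \<theta>)))
      * \<xi> (r - m j - n i + n i' + m j')) = (if i' = i then \<Sum>j'<N.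
     of_real (A i j * A i j' * (g (t + of_int (r - m j) * \<theta>) ^ 2)) * \<xi> (r - m j + m j') else 0)"
    proof (cases "i' = i")
      case False
      show ?thesis unfolding d[OF False] using False by simp
    qed (simp add: power2_eq_square)
  qed
  also have "\<dots> = (\<Sum>i<N. \<Sum>j<N. \<Sum>j'<N.
     of_real (A i j * A i j' * (g (t + of_int (r - m j) * \<theta>) ^ 2)) * \<xi> (r - m j + m j'))"
    by (rule sum.cong[OF refl], rule sum.cong[OF refl]) (simp add: sum.delta)
  also have "\<dots> = (\<Sum>j<N. \<Sum>j'<N. \<Sum>i<N.
     of_real (A i j * A i j' * (g (t + of_int (r - m j) * \<theta>) ^ 2)) * \<xi> (r - m j + m j'))"
    by (rule trans[OF sum.swap], rule sum.cong[OF refl], rule sum.swap)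
  finally show ?thesis
    by (simp add: sum_distrib_right)
qed

text \<open>The same collapse between consecutive factors x^* x, now with the shifts U^(m q) U^(- m
  q') between two powers of \<open>g\<close>. The formula starts at the first power: the zeroth is
  the identity and is not cut down to the support of \<open>g\<close>.\<close>

lemma corner_sq_pow_disjoint:
  "(corner_sq \<theta> N n m A g t ^^ Suc k) \<xi> r = (\<Sum>j<N. \<Sum>j'<N.
     of_real (gram_pow N A k j j' * g (t + of_int (r - m j) * \<theta>) ^ (2 * Suc k)) * \<xi> (r - m j + m j'))"
proof (induction k arbitrary: r)
  case 0
  then show ?case by (simp add: corner_sq_disjoint del: gram_pow.simps)
next
  case (Suc k)
  let ?g = "\<lambda>j. g (t + of_int (r - m j) * \<theta>)"
  have "(corner_sq \<theta> N n m A g t ^^ Suc (Suc k)) \<xi> r =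
     (\<Sum>j<N. \<Sum>q<N. of_real (gram_pow N A 0 j q * ?g j ^ 2) * (corner_sq \<theta> N n m A g t ^^ Suc k) \<xi> (r - m j + m q))"
    unfolding funpow.simps(2)[of "Suc k"] comp_def corner_sq_disjoint[of _ _ "_ \<xi>"] ..
  also have "\<dots> = (\<Sum>j<N. \<Sum>q<N. \<Sum>q'<N. \<Sum>j'<N. of_real (gram_pow N A 0 j q * gram_pow N A k q' j' *
      (?g j * (?g j * (g (t + of_int (r - m j) * \<theta> + of_int (m q - m q') * \<theta>)) ^ (2 * Suc k)))) * \<xi> (r - m j + m q - m q' + m j'))"
    unfolding Suc.IH sum_distrib_left by (intro sum.cong refl) (simp add: algebra_simps power2_eq_square)
  also have "\<dots> = (\<Sum>j<N. \<Sum>q<N. \<Sum>q'<N. if q' = q then \<Sum>j'<N. of_real (gram_pow N A 0 j q * gram_pow N A k q j' *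
      ?g j ^ (2 * Suc (Suc k))) * \<xi> (r - m j + m j') else 0)"
  proof (intro sum.cong refl)
    fix j q q' assume *: "q \<in> {..<N}" "q' \<in> {..<N}"
    let ?d = "g (t + of_int (r - m j) * \<theta> + of_int (m q - m q') * \<theta>)"
    have d: "?g j * (?g j * ?d ^ (2 * Suc k)) = 0" if "q' \<noteq> q"
      using disj_m[of q q' "t + of_int (r - m j) * \<theta>"] * that by auto
    show "(\<Sum>j'<N. of_real (gram_pow N A 0 j q * gram_pow N A k q' j' *
      (?g j * (?g j * ?d ^ (2 * Suc k)))) * \<xi> (r - m j + m q - m q' + m j'))
      = (if q' = q then \<Sum>j'<N. of_real (gram_pow N A 0 j q * gram_pow N A k q j' *
      ?g j ^ (2 * Suc (Suc k))) * \<xi> (r - m j + m j') else 0)"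
    proof (cases "q' = q")
      case True
      have "?g j * (?g j * ?g j ^ (2 * Suc k)) = ?g j ^ (2 * Suc (Suc k))" by simp
      with True show ?thesis by (simp del: gram_pow.simps)
    next
      case False
      show ?thesis unfolding d[OF False] using False by simp
    qed
  qed
  also have "\<dots> = (\<Sum>j<N. \<Sum>q<N. \<Sum>j'<N. of_real (gram_pow N A 0 j q * gram_pow N A k q j' *
      ?g j ^ (2 * Suc (Suc k))) * \<xi> (r - m j + m j'))"
    by (rule sum.cong[OF refl], rule sum.cong[OF refl]) (simp add: sum.delta del: gram_pow.simps)
  also have "\<dots> = (\<Sum>j<N. \<Sum>j'<N. \<Sum>q<N. of_real (gram_pow N A 0 j q * gram_pow N A k q j' *
      ?g j ^ (2 * Suc (Suc k))) * \<xi> (r - m j + m j'))"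
    by (intro sum.cong refl sum.swap)
  finally show ?case
    unfolding gram_pow.simps(2) sum_distrib_right of_real_sum by simp
qed

lemma corner_sq_pow_disjoint_trace:
  assumes "inj m"
  shows "(corner_sq \<theta> N n m A g t ^^ Suc k) \<delta>0 0 = of_real (\<Sum>j<N. gram_pow N A k j j * g (t - of_int (m j) * \<theta>) ^ (2 * Suc k))"
proof -
  have "(corner_sq \<theta> N n m A g t ^^ Suc k) \<delta>0 0 = (\<Sum>j<N. \<Sum>j'<N.
     if j' = j then of_real (gram_pow N A k j j' * g (t - of_int (m j) * \<theta>) ^ (2 * Suc k)) else 0)"
    unfolding corner_sq_pow_disjoint using \<open>inj m\<close>
    by (intro sum.cong refl) (auto simp: \<delta>0_def inj_eq)
  then show ?thesis by (simp add: sum.delta)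
qed

end

lemma gram_pow_const: "j < N \<Longrightarrow> gram_pow N (\<lambda>_ _. 1) k j j' = real N ^ (2 * k + 1)"
  by (induction k arbitrary: j) (simp_all add: mult_ac)

lemma gram_pow_walsh:
  assumes "N = 2 ^ r" "j < N" "j' < N" shows "gram_pow N walsh k j j' = (if j = j' then real N ^ (k + 1) else 0)"
  using assms(2)
proof (induction k arbitrary: j)
  case 0
  then show ?case using assms walsh_orthogonal[of j r j'] by simp
next
  case (Suc k)
  have "gram_pow N walsh (Suc k) j j' = (\<Sum>q<N. if q = j then real N * gram_pow N walsh k q j' else 0)"
    unfolding gram_pow.simps(2) using assms walsh_orthogonal[of j r] Suc.prems
    by (intro sum.cong refl) auto
  also have "\<dots> = real N * gram_pow N walsh k j j'" using Suc.prems by (simp add: sum.delta)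
  finally show ?case using Suc by simp
qed

section \<open>The limit of the norms and the main theorem\<close>

text \<open>The n-th moment bounds the mass of [c, oo) by (R / c)^n, as in Chebyshev's inequality;
  for c > R this tends to 0.\<close>

lemma AE_le_from_moments:
  fixes \<mu> :: "real measure"
  assumes "prob_space \<mu>" "sets \<mu> = sets borel" "AE t in \<mu>. 0 \<le> t"
    and int: "\<And>n. integrable \<mu> (\<lambda>t. t ^ n)" and bd: "\<And>n. (\<integral>t. t ^ n \<partial>\<mu>) \<le> R ^ n" and R: "R > 0"
  shows "AE t in \<mu>. t \<le> R"
proof -
  interpret prob_space \<mu> by fact
  have lt: "AE t in \<mu>. t < c" if c: "c > R" for c
  proof -
    have m: "{c..} \<in> sets \<mu>" using assms(2) by simp
    have le: "measure \<mu> {c..} \<le> (R / c) ^ n" for n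
    proof -
      have "(\<integral>t. c ^ n * indicator {c..} t \<partial>\<mu>) \<le> (\<integral>t. t ^ n \<partial>\<mu>)"
      proof (rule integral_mono_AE)
        show "AE t in \<mu>. c ^ n * indicator {c..} t \<le> t ^ n"
          using assms(3) by eventually_elim (use c R in \<open>auto simp: indicator_def intro: power_mono\<close>)
        show "integrable \<mu> (\<lambda>t. c ^ n * indicator {c..} t)"
          by (intro integrable_mult_right integrable_real_indicator m) (simp add: emeasure_eq_measure)
      qed (rule int)
      also have "(\<integral>t. c ^ n * indicator {c..} t \<partial>\<mu>) = c ^ n * measure \<mu> {c..}" using m by simp
      finally have "c ^ n * measure \<mu> {c..} \<le> R ^ n" using bd[of n] by linarith
      then show ?thesis using c R by (simp add: power_divide field_simps)
    qed
    have "(\<lambda>n. (R / c) ^ n) \<longlonglongrightarrow> 0" using c R by (intro LIMSEQ_power_zero) auto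
    then have "measure \<mu> {c..} \<le> 0" using le by (intro LIMSEQ_le_const) auto
    then have "measure \<mu> {c..} = 0" using measure_nonneg[of \<mu> "{c..}"] by linarith
    then have "{c..} \<in> null_sets \<mu>" using m by (simp add: null_sets_def emeasure_eq_measure)
    from AE_not_in[OF this] show ?thesis by eventually_elim auto
  qed
  have "AE t in \<mu>. \<forall>k. t < R + 1 / real (Suc k)"
    unfolding AE_all_countable by (intro allI lt) simp
  then show ?thesis
  proof eventually_elim
    case (elim t)
    show ?case
    proof (rule ccontr)
      assume "\<not> t \<le> R"
      then obtain k where "1 / real (Suc k) < t - R" using nat_approx_posE[of "t - R"] by auto
      then show False using elim[rule_format, of k] by linarith
    qed
  qed
qed

section \<open>Trigonometric approximation and rotation invariance of the mean\<close>

lemma ch_power: "ch j t ^ k = ch (int k * j) t"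
  by (simp add: ch_def Complex.DeMoivre mult_ac)

lemma cos_polynomial_eq_trig:
  fixes a :: "nat \<Rightarrow> real"
  obtains L c where "finite L" "\<And>t. trig L c t = of_real (\<Sum>i\<le>d. a i * cos (2 * pi * t) ^ i)"
proof -
  define P where "P = Sigma {..d} (\<lambda>i. {..i})"
  define \<sigma> where "\<sigma> = (\<lambda>(i, k). int k - int (i - k))"
  define w :: "nat \<times> nat \<Rightarrow> complex" where "w = (\<lambda>(i, k). of_real (a i / 2 ^ i) * of_nat (i choose k))"
  have P: "finite P" by (simp add: P_def)
  have cos: "complex_of_real (cos (2 * pi * t)) = (ch 1 t + ch (- 1) t) / 2" for t
    by (rule complex_eqI) (simp_all add: ch_def)
  have pow: "complex_of_real (cos (2 * pi * t)) ^ i = (\<Sum>k\<le>i. of_real (1 / 2 ^ i) * of_nat (i choose k) * ch (int k - int (i - k)) t)" for t i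
  proof -
    have "ch 1 t ^ k * ch (- 1) t ^ (i - k) = ch (int k - int (i - k)) t" for k
      unfolding ch_power ch_add[symmetric] by simp
    then show ?thesis
      unfolding cos power_divide binomial_ring sum_divide_distrib
      by (intro sum.cong refl) (simp add: mult.assoc)
  qed
  have "of_real (\<Sum>i\<le>d. a i * cos (2 * pi * t) ^ i) = trig (\<sigma> ` P) (\<lambda>n. \<Sum>x | x \<in> P \<and> \<sigma> x = n. w x) t" for t
  proof -
    have "complex_of_real (\<Sum>i\<le>d. a i * cos (2 * pi * t) ^ i) = (\<Sum>i\<le>d. of_real (a i) * complex_of_real (cos (2 * pi * t)) ^ i)"
      by simp
    also have "\<dots> = (\<Sum>i\<le>d. \<Sum>k\<le>i. w (i, k) * ch (\<sigma> (i, k)) t)"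
      unfolding pow sum_distrib_left by (intro sum.cong refl) (simp add: w_def \<sigma>_def mult.assoc)
    also have "\<dots> = (\<Sum>x\<in>P. w x * ch (\<sigma> x) t)"
      unfolding P_def by (subst sum.Sigma) auto
    also have "\<dots> = (\<Sum>n\<in>\<sigma> ` P. \<Sum>x | x \<in> P \<and> \<sigma> x = n. w x * ch (\<sigma> x) t)"
      using P by (rule sum.image_gen)
    also have "\<dots> = trig (\<sigma> ` P) (\<lambda>n. \<Sum>x | x \<in> P \<and> \<sigma> x = n. w x) t"
      unfolding trig_def sum_distrib_right by (intro sum.cong refl) auto
    finally show ?thesis .
  qed
  from that[OF _ this[symmetric]] P show ?thesis by simp
qed

text \<open>The bump is a continuous function of cos(2 pi t). For such functions algebraic
  Weierstrass approximation on [-1, 1] already yields real-valued trigonometric polynomials.\<close>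

lemma trig_approximation:
  fixes u :: "real \<Rightarrow> real"
  assumes "continuous_on {- 1..1} u"
  obtains L c h where "\<And>s :: nat. finite (L s)" "\<And>s t. trig (L s) (c s) t = of_real (h s t)"
    "\<And>s t. \<bar>u (cos (2 * pi * t)) - h s t\<bar> < 1 / real (Suc s)" "\<And>s. continuous_on UNIV (h s)"
proof -
  have "\<exists>L c h. finite L \<and> (\<forall>t. trig L c t = of_real (h t)) \<and> (\<forall>t. \<bar>u (cos (2 * pi * t)) - h t\<bar> < 1 / real (Suc s))
    \<and> continuous_on UNIV h" for s
  proof -
    obtain q where q: "real_polynomial_function q" "\<And>x. x \<in> {- 1..1} \<Longrightarrow> \<bar>u x - q x\<bar> < 1 / real (Suc s)"
      using Stone_Weierstrass_real_polynomial_function[of "{- 1..1}" u "1 / real (Suc s)"] assms by auto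
    obtain a d where q_eq: "q = (\<lambda>x. \<Sum>i\<le>d. a i * x ^ i)"
      using q(1) real_polynomial_function_iff_sum by blast
    obtain L c where "finite L" "\<And>t. trig L c t = of_real (\<Sum>i\<le>d. a i * cos (2 * pi * t) ^ i)"
      using cos_polynomial_eq_trig by blast
    then show ?thesis
      using q(2) unfolding q_eq
      by (intro exI[of _ L] exI[of _ c] exI[of _ "\<lambda>t. \<Sum>i\<le>d. a i * cos (2 * pi * t) ^ i"])
         (auto intro!: continuous_intros)
  qed
  then show ?thesis using that by metis
qed

text \<open>A trigonometric polynomial and its translates have the same zeroth coefficient, hence
  the same mean; uniform approximation carries this over and replaces a substitution in a periodic
  integral.\<close>

lemma integral_cos_shift:
  fixes u :: "real \<Rightarrow> real"
  assumes u: "continuous_on {- 1..1} u"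
  shows "(\<integral>t. u (cos (2 * pi * (t + a))) \<partial>unit_lebesgue) = (\<integral>t. u (cos (2 * pi * t)) \<partial>unit_lebesgue)"
proof -
  obtain L c h where L: "\<And>s :: nat. finite (L s)" and h: "\<And>s t. trig (L s) (c s) t = of_real (h s t)"
    "\<And>s t. \<bar>u (cos (2 * pi * t)) - h s t\<bar> < 1 / real (Suc s)" "\<And>s. continuous_on UNIV (h s)"
    using trig_approximation[OF u] by metis
  have int_h: "(\<integral>t. h s (t + b) \<partial>unit_lebesgue) = Re (if 0 \<in> L s then c s 0 else 0)" for s b
  proof -
    have "complex_of_real (\<integral>t. h s (t + b) \<partial>unit_lebesgue) = (\<integral>t. (\<Sum>n\<in>L s. c s n * ch n b * ch n t) \<partial>unit_lebesgue)"
      by (subst integral_complex_of_real[symmetric]) (simp add: h(1)[symmetric] trig_def ch_add_arg mult_ac)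
    also have "\<dots> = (\<Sum>n\<in>L s. \<integral>t. c s n * ch n b * ch n t \<partial>unit_lebesgue)"
      by (rule Bochner_Integration.integral_sum) (intro integrable_unit_lebesgue_continuous continuous_intros)
    also have "\<dots> = (\<Sum>n\<in>L s. if n = 0 then c s n else 0)"
      by (intro sum.cong refl) (simp add: integral_ch)
    also have "\<dots> = (if 0 \<in> L s then c s 0 else 0)" using L[of s] by (simp add: sum.delta)
    finally show ?thesis by (metis Re_complex_of_real)
  qed
  have cont: "continuous_on UNIV (\<lambda>t. u (cos (2 * pi * (t + b))))" for b
    by (rule continuous_on_compose2[OF u]) (auto intro!: continuous_intros)
  have close: "\<bar>(\<integral>t. u (cos (2 * pi * (t + b))) \<partial>unit_lebesgue) - (\<integral>t. h s (t + b) \<partial>unit_lebesgue)\<bar> \<le> 1 / real (Suc s)" for s b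
  proof (rule unit_lebesgue.abs_integral_diff_le)
    show "integrable unit_lebesgue (\<lambda>t. u (cos (2 * pi * (t + b))))"
      by (rule integrable_unit_lebesgue_continuous[OF cont])
    show "integrable unit_lebesgue (\<lambda>t. h s (t + b))"
      by (rule integrable_unit_lebesgue_continuous, rule continuous_on_compose2[OF h(3)])
         (auto intro!: continuous_intros)
    show "AE t in unit_lebesgue. \<bar>u (cos (2 * pi * (t + b))) - h s (t + b)\<bar> \<le> 1 / real (Suc s)"
      by (intro AE_I2 less_imp_le h(2))
  qed
  have "\<bar>(\<integral>t. u (cos (2 * pi * (t + a))) \<partial>unit_lebesgue) - (\<integral>t. u (cos (2 * pi * t)) \<partial>unit_lebesgue)\<bar> \<le> 2 * inverse (real (Suc s))" for s
    using close[of a s] close[of 0 s] int_h[of s a] int_h[of s 0] by (simp add: divide_inverse)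
  moreover have "(\<lambda>s. 2 * inverse (real (Suc s))) \<longlonglongrightarrow> 0"
    using tendsto_mult[OF tendsto_const[of 2] LIMSEQ_inverse_real_of_nat] by simp
  ultimately have "\<bar>(\<integral>t. u (cos (2 * pi * (t + a))) \<partial>unit_lebesgue) - (\<integral>t. u (cos (2 * pi * t)) \<partial>unit_lebesgue)\<bar> \<le> 0"
    using LIMSEQ_le_const by blast
  then show ?thesis by simp
qed

section \<open>Bumps with disjoint translates\<close>

definition bump :: "real \<Rightarrow> real \<Rightarrow> real" where
  "bump c s = max 0 (cos (2 * pi * s) - c)"

lemma bump_nonneg: "bump c s \<ge> 0" by (simp add: bump_def)

lemma bump_le_1: "0 \<le> c \<Longrightarrow> bump c s \<le> 1"
  using cos_le_one[of "2 * pi * s"] unfolding bump_def by linarith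

lemma continuous_bump [continuous_intros]:
  fixes f :: "real \<Rightarrow> real"
  shows "continuous_on A f \<Longrightarrow> continuous_on A (\<lambda>x. bump c (f x))"
  unfolding bump_def by (intro continuous_intros)

text \<open>Irrationality gives cos(2 pi k \<theta>) < 1 for k in F, uniformly because F is finite.
  If cos x and cos y both exceed c > 0, then cos(y - x) > 2 c^2 - 1, so two points of the support
  cannot differ by such a rotation once c is close to 1.\<close>

lemma bump_disjoint_translates:
  assumes \<theta>: "\<theta> \<notin> \<rat>" and F: "finite F" "0 \<notin> F"
  obtains c where "0 < c" "c < 1" "\<And>k s. k \<in> F \<Longrightarrow> bump c s * bump c (s + of_int k * \<theta>) = 0"
proof -
  define M where "M = Max (insert 0 ((\<lambda>k. cos (2 * pi * (of_int k * \<theta>))) ` F))"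
  have Mk: "cos (2 * pi * (of_int k * \<theta>)) \<le> M" if "k \<in> F" for k
    unfolding M_def using F that by (auto intro!: Max_ge)
  have M0: "M \<ge> 0" unfolding M_def using F by (intro Max_ge) auto
  have "cos (2 * pi * (of_int k * \<theta>)) \<noteq> 1" if "k \<in> F" for k
  proof
    assume "cos (2 * pi * (of_int k * \<theta>)) = 1"
    then obtain j :: int where "2 * pi * (of_int k * \<theta>) = of_int j * 2 * pi"
      using cos_one_2pi_int by blast
    then have "of_int k * \<theta> = of_int j" by simp
    moreover have "k \<noteq> 0" using that F by metis
    ultimately have "\<theta> = of_int j / of_int k" by (simp add: field_simps)
    then show False using \<theta> by (metis Rats_divide Rats_of_int)
  qed
  then have "cos (2 * pi * (of_int k * \<theta>)) < 1" if "k \<in> F" for k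
    using that cos_le_one[of "2 * pi * (of_int k * \<theta>)"] by (metis less_eq_real_def)
  then have M1: "M < 1" unfolding M_def using F by (subst Max_less_iff) auto
  \<comment> \<open>Solves 2 c^2 - 1 = M. The 0 inserted into the maximum keeps c positive, and M <
    1 gives c < 1.\<close>
  define c where "c = sqrt ((1 + M) / 2)"
  have c2: "c\<^sup>2 = (1 + M) / 2" using M0 by (simp add: c_def)
  have c: "0 < c" "c < 1" using M0 M1 by (auto simp: c_def)
  have "bump c s * bump c (s + of_int k * \<theta>) = 0" if "k \<in> F" for k s
  proof (rule ccontr)
    assume "bump c s * bump c (s + of_int k * \<theta>) \<noteq> 0"
    define x y where "x = 2 * pi * s" and "y = 2 * pi * (s + of_int k * \<theta>)"
    have xy: "cos x > c" "cos y > c"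
      using \<open>bump c s * bump c (s + of_int k * \<theta>) \<noteq> 0\<close> by (auto simp: bump_def x_def y_def max_def split: if_splits)
    have sq: "(cos x)\<^sup>2 > c\<^sup>2" "(cos y)\<^sup>2 > c\<^sup>2" using xy c by (auto intro: power_strict_mono)
    have "cos x * cos y > c * c" using xy c by (intro mult_strict_mono) auto
    moreover have "- (sin x * sin y) \<le> ((sin x)\<^sup>2 + (sin y)\<^sup>2) / 2"
      using sum_squares_ge_zero[of "sin x + sin y" 0] by (simp add: power2_eq_square algebra_simps)
    moreover have "(sin x)\<^sup>2 = 1 - (cos x)\<^sup>2" "(sin y)\<^sup>2 = 1 - (cos y)\<^sup>2" by (simp_all add: sin_squared_eq)
    ultimately have "cos y * cos x + sin y * sin x > 2 * c\<^sup>2 - 1"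
      using sq by (simp add: power2_eq_square mult.commute)
    moreover have "2 * c\<^sup>2 - 1 = M" unfolding c2 by (simp add: field_simps)
    ultimately have "cos (y - x) > M" by (simp add: cos_diff)
    moreover have "y - x = 2 * pi * (of_int k * \<theta>)" by (simp add: x_def y_def algebra_simps)
    ultimately show False using Mk[OF that] by simp
  qed
  with c show ?thesis using that by blast
qed

lemma bump_integral_pos:
  assumes "0 < c" "c < 1" "p > 0"
  shows "(\<integral>t. bump c t powr p \<partial>unit_lebesgue) > 0"
proof (rule ccontr)
  assume neg: "\<not> ?thesis"
  have int: "integrable unit_lebesgue (\<lambda>t. bump c t powr p)"
    by (intro integrable_unit_lebesgue_continuous continuous_on_powr' continuous_intros)
       (use assms in \<open>auto simp: bump_nonneg\<close>)
  have "(\<integral>t. bump c t powr p \<partial>unit_lebesgue) \<ge> 0" by (simp add: integral_nonneg_AE)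
  with neg have "(\<integral>t. bump c t powr p \<partial>unit_lebesgue) = 0" by linarith
  then have ae: "AE t in unit_lebesgue. bump c t powr p = 0"
    using int by (subst (asm) integral_nonneg_eq_0_iff_AE) auto
  have "((\<lambda>s::real. cos (2 * pi * s)) \<longlongrightarrow> cos (2 * pi * 0)) (at 0)"
    by (intro tendsto_intros)
  then have "eventually (\<lambda>s::real. cos (2 * pi * s) > c) (at 0)"
    using assms by (intro order_tendstoD(1)) auto
  then obtain d where d: "d > 0" "\<And>s. s \<noteq> 0 \<Longrightarrow> \<bar>s\<bar> < d \<Longrightarrow> cos (2 * pi * s) > c"
    unfolding eventually_at by (auto simp: dist_real_def)
  define e where "e = min (d / 2) 1"
  have e: "0 < e" "e \<le> 1" "e < d" using d(1) by (auto simp: e_def min_def)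
  have nz: "bump c t \<noteq> 0" if "t \<in> {0..e}" for t
    using d(2)[of t] that e assms by (cases "t = 0") (auto simp: bump_def max_def)
  from ae have "AE t in unit_lebesgue. \<not> (t \<in> {0..e})" by eventually_elim (use nz in auto)
  then have "emeasure unit_lebesgue {t \<in> space unit_lebesgue. t \<in> {0..e}} = 0"
    by (rule emeasure_eq_0_AE)
  moreover have "{t \<in> space unit_lebesgue. t \<in> {0..e}} = {0..e}" using e by auto
  moreover have "emeasure unit_lebesgue {0..e} = ennreal e"
    using e unfolding unit_lebesgue_def by (subst emeasure_restrict_space) auto
  ultimately show False using e by simp
qed

text \<open>The hypothesis \<open>gram\<close> says in effect that A^T A has the only nonzero
  eigenvalue \<kappa>, with multiplicity \<open>C\<close>. The moments of order k >= 1 then tend to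
  C times those of \<kappa> g^2 for the bump g, and the limit norm is the Schatten norm of A,
  C^(1/p) \<kappa>^(1/2), times the L_p norm of g.\<close>

lemma corner_Lp_norm_tendsto:
  assumes c: "0 < c" "c < 1" and N: "N > 0" and m: "inj m" and p: "p > 0"
    and disj_n: "\<And>i i' s. i < N \<Longrightarrow> i' < N \<Longrightarrow> i \<noteq> i' \<Longrightarrow> bump c s * bump c (s + of_int (n i - n i') * \<theta>) = 0"
    and disj_m: "\<And>i i' s. i < N \<Longrightarrow> i' < N \<Longrightarrow> i \<noteq> i' \<Longrightarrow> bump c s * bump c (s + of_int (m i - m i') * \<theta>) = 0"
    and L: "\<And>s. finite (L s)" and h: "\<And>s t. trig (L s) (b s) t = of_real (h s t)"
    and approx: "\<And>s t. \<bar>bump c t - h s t\<bar> < 1 / real (Suc s)" and hcont: "\<And>s. continuous_on UNIV (h s)"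
    and A: "\<And>i j. \<bar>A i j\<bar> \<le> 1"
    and gram: "\<And>k. (\<Sum>j<N. gram_pow N A k j j) = C * \<kappa> ^ Suc k" and C: "C > 0" "\<kappa> > 0"
  shows "(\<lambda>s. nc_Lp_norm \<theta> p (corner \<theta> N n m A (L s) (b s)))
    \<longlonglongrightarrow> (C * \<kappa> powr (p / 2) * (\<integral>t. bump c t powr p \<partial>unit_lebesgue)) powr (1 / p)"
proof -
  let ?x = "\<lambda>s. corner \<theta> N n m A (L s) (b s)"
  have "\<exists>\<mu>. spec_meas \<theta> (?x s) \<mu>" for s by (intro spec_meas_exists nc_poly_corner L)
  then obtain \<mu> where \<mu>: "\<And>s. spec_meas \<theta> (?x s) (\<mu> s)" by metis
  define y where "y s = nc_mult \<theta> (nc_adj \<theta> (?x s)) (?x s)" for s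
  have mom: "integrable (\<mu> s) (\<lambda>t. t ^ k)" "(\<integral>t. t ^ k \<partial>\<mu> s) = Re (nc_trace (nc_pow \<theta> (y s) k))" for s k
    using \<mu>[of s] by (auto simp: spec_meas_def y_def)
  have sets: "sets (\<mu> s) = sets borel" and prob: "prob_space (\<mu> s)" for s
    using \<mu>[of s] by (simp add: spec_meas_def, intro spec_meas_prob_space)
  \<comment> \<open>The bump is at most 1 and the approximation error is below 1.\<close>
  have hbd: "\<bar>h s t\<bar> \<le> 2" for s t
  proof -
    have "1 / real (Suc s) \<le> 1" by simp
    then show ?thesis using approx[of t s] bump_nonneg[of c t] bump_le_1[of c t] c by linarith
  qed
  have meas: "h s \<in> borel_measurable borel" "bump c \<in> borel_measurable borel" for s
    using hcont by (auto intro!: borel_measurable_continuous_onI continuous_intros)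
  have lim: "(\<lambda>s. h s t) \<longlonglongrightarrow> bump c t" for t
  proof (rule LIM_zero_cancel, rule Lim_null_comparison)
    show "\<forall>\<^sub>F s in sequentially. norm (h s t - bump c t) \<le> inverse (real (Suc s))"
      using approx[of t] by (intro always_eventually allI) (simp add: abs_minus_commute divide_inverse less_imp_le)
  qed (rule LIMSEQ_inverse_real_of_nat)
  define R1 where "R1 = (real N * real N * 2)\<^sup>2"
  \<comment> \<open>Large enough for the supports of all \<open>\<mu> s\<close>, by
    \<open>R1\<close>, and for the range of the limit function \<kappa> g^2, by
    \<open>\<kappa>\<close>.\<close>
  define R where "R = max R1 \<kappa>"
  have R1: "R1 > 0" using N by (simp add: R1_def)
  have supp: "AE t in \<mu> s. 0 \<le> t \<and> t \<le> R" for s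
  proof -
    obtain R' where R': "AE t in \<mu> s. 0 \<le> t \<and> t \<le> R'" using \<mu>[of s] unfolding spec_meas_def by blast
    then have nn: "AE t in \<mu> s. 0 \<le> t" by eventually_elim simp
    have bd: "(\<integral>t. t ^ k \<partial>\<mu> s) \<le> R1 ^ k" for k
      unfolding mom R1_def y_def
      by (rule order_trans[OF complex_Re_le_cmod corner_moment_bound[OF L h hbd meas(1) A]])
    from AE_le_from_moments[OF prob sets nn mom(1) bd R1]
    have "AE t in \<mu> s. t \<le> R1" .
    with nn show ?thesis by eventually_elim (auto simp: R_def)
  qed
  let ?h = "\<lambda>t. \<kappa> * (bump c t)\<^sup>2"
  have b2: "(bump c t)\<^sup>2 \<le> 1" for t using bump_nonneg[of c t] bump_le_1[of c t] c by (simp add: power_le_one)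
  have main: "(\<lambda>s. \<integral>t. t powr (p / 2) \<partial>\<mu> s) \<longlonglongrightarrow> C * (\<integral>t. ?h t powr (p / 2) \<partial>unit_lebesgue)"
  proof (rule moments_convergence[where R = R])
    show "prob_space unit_lebesgue" by (rule unit_lebesgue.prob_space_axioms)
    show "?h \<in> borel_measurable unit_lebesgue"
      by (intro measurable_unit_lebesgue borel_measurable_continuous_onI continuous_intros)
    have "?h t \<le> \<kappa>" for t using mult_left_mono[OF b2[of t], of \<kappa>] C by simp
    moreover have "\<kappa> \<le> R" by (simp add: R_def)
    ultimately have "?h t \<le> R" for t using order_trans by blast
    then show "AE t in unit_lebesgue. 0 \<le> ?h t \<and> ?h t \<le> R" using C by auto
    show "continuous_on {0..R} (\<lambda>t. t powr (p / 2))" using p by (intro continuous_on_powr' continuous_intros) auto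
    show "R \<ge> 0" using R1 by (simp add: R_def)
    fix k :: nat assume "k \<ge> 1"
    then obtain k' where k: "k = Suc k'" by (cases k) auto
    have "(\<lambda>s. nc_trace (nc_pow \<theta> (y s) k)) \<longlonglongrightarrow> (\<integral>t. (corner_sq \<theta> N n m A (bump c) t ^^ k) \<delta>0 0 \<partial>unit_lebesgue)"
      unfolding y_def by (rule corner_moment_tendsto[OF L h lim hbd meas A])
    then have "(\<lambda>s. Re (nc_trace (nc_pow \<theta> (y s) k))) \<longlonglongrightarrow> Re (\<integral>t. (corner_sq \<theta> N n m A (bump c) t ^^ k) \<delta>0 0 \<partial>unit_lebesgue)"
      by (rule tendsto_Re)
    also have "(\<integral>t. (corner_sq \<theta> N n m A (bump c) t ^^ k) \<delta>0 0 \<partial>unit_lebesgue)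
      = of_real (\<integral>t. (\<Sum>j<N. gram_pow N A k' j j * bump c (t - of_int (m j) * \<theta>) ^ (2 * k)) \<partial>unit_lebesgue)"
      unfolding integral_complex_of_real[symmetric] k
      by (intro Bochner_Integration.integral_cong refl corner_sq_pow_disjoint_trace disj_n disj_m m)
    also have "(\<integral>t. (\<Sum>j<N. gram_pow N A k' j j * bump c (t - of_int (m j) * \<theta>) ^ (2 * k)) \<partial>unit_lebesgue)
      = (\<Sum>j<N. \<integral>t. gram_pow N A k' j j * bump c (t - of_int (m j) * \<theta>) ^ (2 * k) \<partial>unit_lebesgue)"
      by (rule Bochner_Integration.integral_sum) (intro integrable_unit_lebesgue_continuous continuous_intros)
    \<comment> \<open>Rotation invariance removes the translates by \<open>m j\<close>, and only the
      trace of the matrix power remains.\<close>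
    also have "\<dots> = (\<Sum>j<N. gram_pow N A k' j j * (\<integral>t. bump c t ^ (2 * k) \<partial>unit_lebesgue))"
    proof (intro sum.cong refl)
      fix j
      have "(\<integral>t. (max 0 (cos (2 * pi * (t + - of_int (m j) * \<theta>)) - c)) ^ (2 * k) \<partial>unit_lebesgue)
         = (\<integral>t. (max 0 (cos (2 * pi * t) - c)) ^ (2 * k) \<partial>unit_lebesgue)"
        by (rule integral_cos_shift[of "\<lambda>x. (max 0 (x - c)) ^ (2 * k)"]) (intro continuous_intros)
      then show "(\<integral>t. gram_pow N A k' j j * bump c (t - of_int (m j) * \<theta>) ^ (2 * k) \<partial>unit_lebesgue)
         = gram_pow N A k' j j * (\<integral>t. bump c t ^ (2 * k) \<partial>unit_lebesgue)"
        by (simp add: bump_def)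
    qed
    also have "\<dots> = C * (\<kappa> ^ k * (\<integral>t. bump c t ^ (2 * k) \<partial>unit_lebesgue))"
      unfolding sum_distrib_right[symmetric] gram k by (simp add: mult.assoc)
    also have "\<kappa> ^ k * (\<integral>t. bump c t ^ (2 * k) \<partial>unit_lebesgue) = (\<integral>t. ?h t ^ k \<partial>unit_lebesgue)"
      by (simp add: power_mult_distrib power_mult)
    finally show "(\<lambda>s. \<integral>t. t ^ k \<partial>\<mu> s) \<longlonglongrightarrow> C * (\<integral>t. ?h t ^ k \<partial>unit_lebesgue)"
      by (simp add: mom)
  qed (use prob sets supp p in auto)
  have "?h t powr (p / 2) = \<kappa> powr (p / 2) * bump c t powr p" for t
    using C bump_nonneg[of c t] by (cases "bump c t = 0") (simp_all add: powr_mult powr_powr flip: powr_numeral)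
  then have lim2: "(\<lambda>s. \<integral>t. t powr (p / 2) \<partial>\<mu> s) \<longlonglongrightarrow> C * \<kappa> powr (p / 2) * (\<integral>t. bump c t powr p \<partial>unit_lebesgue)"
    using main by (simp add: mult.assoc)
  have "C * \<kappa> powr (p / 2) * (\<integral>t. bump c t powr p \<partial>unit_lebesgue) \<noteq> 0"
    using C bump_integral_pos[OF c p] by simp
  from tendsto_powr[OF lim2 tendsto_const this, of "1 / p"]
  show ?thesis unfolding nc_Lp_norm_eq[OF \<mu>] .
qed

lemma fourier_mult_corner:
  assumes "\<And>i j. \<psi> (n i + m j) = of_real (w i j)"
  shows "fourier_mult (\<lambda>q. \<psi> (fst q)) (corner \<theta> N n m A L c) = corner \<theta> N n m (\<lambda>i j. w i j * A i j) L c"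
  unfolding fourier_mult_def corner_def sum_distrib_left
  by (rule ext, intro sum.cong refl) (simp add: assms mult.assoc)

text \<open>Since the signs square to 1, the multiplier exchanges the elements built from the
  all-ones and the Hadamard matrix. So \<open>C\<close> bounds the ratio of their limit norms,
  N^(1/p - 1/2), as well as its inverse, which treats p < 2 and p > 2 together.\<close>

lemma bounded_mult_imp_walsh_bound:
  assumes \<theta>: "\<theta> \<notin> \<rat>" and p: "p > 0" and nm: "inj n" "inj m" and \<psi>: "\<And>i j. \<psi> (n i + m j) = of_real (walsh i j)"
    and C: "\<And>a. nc_poly a \<Longrightarrow> nc_Lp_norm \<theta> p (fourier_mult (\<lambda>q. \<psi> (fst q)) a) \<le> C * nc_Lp_norm \<theta> p a"
  shows "(2 ^ r) powr \<bar>1 / 2 - 1 / p\<bar> \<le> C"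
proof -
  define N :: nat where "N = 2 ^ r"
  have N: "N > 0" by (simp add: N_def)
  \<comment> \<open>All differences of distinct shifts on either side, nonzero by injectivity; these
    are the rotations under which the bump must be moved off itself.\<close>
  define F where "F = (\<lambda>(i, i'). n i - n i') ` {(i, i'). i < N \<and> i' < N \<and> i \<noteq> i'} \<union> (\<lambda>(i, i'). m i - m i') ` {(i, i'). i < N \<and> i' < N \<and> i \<noteq> i'}"
  have "finite {(i, i'). i < N \<and> i' < N \<and> i \<noteq> i'}"
    by (rule finite_subset[of _ "{..<N} \<times> {..<N}"]) auto
  then have F: "finite F" unfolding F_def by blast
  have F0: "0 \<notin> F" using nm by (auto simp: F_def inj_eq)
  obtain c where c: "0 < c" "c < 1" and disj: "\<And>k s. k \<in> F \<Longrightarrow> bump c s * bump c (s + of_int k * \<theta>) = 0"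
    using bump_disjoint_translates[OF \<theta> F F0] by metis
  have disj_n: "bump c s * bump c (s + of_int (n i - n i') * \<theta>) = 0"
    and disj_m: "bump c s * bump c (s + of_int (m i - m i') * \<theta>) = 0" if "i < N" "i' < N" "i \<noteq> i'" for i i' s
  proof -
    have "n i - n i' \<in> F" "m i - m i' \<in> F" using that by (force simp: F_def)+
    then show "bump c s * bump c (s + of_int (n i - n i') * \<theta>) = 0"
      "bump c s * bump c (s + of_int (m i - m i') * \<theta>) = 0" by (simp_all only: disj)
  qed
  have "continuous_on {- 1..1} (\<lambda>x. max 0 (x - c))" by (intro continuous_intros)
  from trig_approximation[OF this] obtain L b h where L: "\<And>s :: nat. finite (L s)"
    and h: "\<And>s t. trig (L s) (b s) t = of_real (h s t)"
    and approx: "\<And>s t. \<bar>bump c t - h s t\<bar> < 1 / real (Suc s)" and hcont: "\<And>s. continuous_on UNIV (h s)"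
    unfolding bump_def by metis
  note lim = corner_Lp_norm_tendsto[OF c N nm(2) p disj_n disj_m L h approx hcont]
  define I where "I = (\<integral>t. bump c t powr p \<partial>unit_lebesgue)"
  have I: "I > 0" unfolding I_def by (rule bump_integral_pos[OF c p])
  define x where "x s = corner \<theta> N n m (\<lambda>_ _. 1) (L s) (b s)" for s
  define z where "z s = corner \<theta> N n m walsh (L s) (b s)" for s
  \<comment> \<open>For the all-ones matrix A^T A has rank one with eigenvalue N^2: multiplicity 1,
    \<kappa> = N^2.\<close>
  have limx: "(\<lambda>s. nc_Lp_norm \<theta> p (x s)) \<longlonglongrightarrow> (1 * (real N ^ 2) powr (p / 2) * I) powr (1 / p)"
    unfolding x_def I_def
  proof (rule lim)
    fix k
    have "(\<Sum>j<N. gram_pow N (\<lambda>_ _. 1) k j j) = real N * real N ^ (2 * k + 1)"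
      by (simp add: gram_pow_const)
    also have "\<dots> = real N ^ (2 * Suc k)" by simp
    also have "\<dots> = (real N ^ 2) ^ Suc k" by (rule power_mult)
    finally show "(\<Sum>j<N. gram_pow N (\<lambda>_ _. 1) k j j) = 1 * (real N ^ 2) ^ Suc k" by simp
  qed (use N in auto)
  \<comment> \<open>For the Hadamard matrix A^T A is N times the identity: multiplicity N, \<kappa>
    = N.\<close>
  have limz: "(\<lambda>s. nc_Lp_norm \<theta> p (z s)) \<longlonglongrightarrow> (real N * real N powr (p / 2) * I) powr (1 / p)"
    unfolding z_def I_def
  proof (rule lim)
    show "(\<Sum>j<N. gram_pow N walsh k j j) = real N * real N ^ Suc k" for k
      by (simp add: gram_pow_walsh[OF N_def])
  qed (use N in auto)
  have "nc_Lp_norm \<theta> p (z s) \<le> C * nc_Lp_norm \<theta> p (x s)" "nc_Lp_norm \<theta> p (x s) \<le> C * nc_Lp_norm \<theta> p (z s)" for s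
    using C[of "x s"] C[of "z s"] L[of s]
    by (simp_all add: x_def z_def nc_poly_corner fourier_mult_corner[where w = walsh, OF \<psi>] walsh_square)
  note xz = this
  have le: "(real N * real N powr (p / 2) * I) powr (1 / p) \<le> C * (1 * (real N ^ 2) powr (p / 2) * I) powr (1 / p)"
    "(1 * (real N ^ 2) powr (p / 2) * I) powr (1 / p) \<le> C * (real N * real N powr (p / 2) * I) powr (1 / p)"
    using LIMSEQ_le[OF limz tendsto_mult[OF tendsto_const limx]]
      LIMSEQ_le[OF limx tendsto_mult[OF tendsto_const limz]] xz by blast+
  have ex: "(1 * (real N ^ 2) powr (p / 2) * I) powr (1 / p) = real N * I powr (1 / p)"
    using N I p by (simp add: powr_mult powr_powr flip: powr_numeral)
  have ez: "(real N * real N powr (p / 2) * I) powr (1 / p) = real N powr (1 / p + 1 / 2) * I powr (1 / p)"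
    using N I p by (simp add: powr_mult powr_powr powr_add)
  have I': "I powr (1 / p) > 0" using I by simp
  \<comment> \<open>\<open>I\<close> depends on N through the choice of \<open>c\<close>, but both
    norms carry the same positive factor I^(1/p), which cancels.\<close>
  from le have le': "real N powr (1 / p + 1 / 2) \<le> C * real N" "real N \<le> C * real N powr (1 / p + 1 / 2)"
    unfolding ex ez mult.assoc[symmetric] using I' by auto
  have "real N powr (1 / p - 1 / 2) = real N powr (1 / p + 1 / 2) / real N"
    using N by (simp add: powr_diff powr_add) (simp add: powr_half_sqrt field_simps)
  also have "\<dots> \<le> C" using le'(1) N by (simp add: field_simps)
  finally have 1: "real N powr (1 / p - 1 / 2) \<le> C" .
  have "real N powr (1 / 2 - 1 / p) = real N / real N powr (1 / p + 1 / 2)"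
    using N by (simp add: powr_diff powr_add) (simp add: powr_half_sqrt field_simps)
  also have "\<dots> \<le> C" using le'(2) N by (simp add: field_simps)
  finally have 2: "real N powr (1 / 2 - 1 / p) \<le> C" .
  have "real N powr \<bar>1 / 2 - 1 / p\<bar> \<le> C"
    using 1 2 by (cases "1 / 2 - 1 / p \<ge> 0") (simp_all add: abs_if)
  then show ?thesis by (simp add: N_def)
qed

theorem theorem3p7:
  fixes \<theta> p :: real
  assumes "\<theta> \<notin> \<rat>" and "1 < p" and "p \<noteq> 2"
  shows "\<exists>\<phi> :: int \<times> int \<Rightarrow> complex. bounded_mult_Lp 0 p \<phi> \<and> \<not> bounded_mult_Lp \<theta> p \<phi>"
proof -
  \<comment> \<open>Both \<open>p\<close> and its conjugate exponent have to lie below 2K for the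
    Lambda bound and its dual use.\<close>
  define K where "K = nat \<lceil>max p (p / (p - 1))\<rceil>"
  have "max p (p / (p - 1)) \<le> real K" unfolding K_def by (rule real_nat_ceiling_ge)
  then have K: "p \<le> 2 * real K" "p / (p - 1) \<le> 2 * real K" using assms(2) by auto
  have "p \<le> real K" using \<open>max p (p / (p - 1)) \<le> real K\<close> by simp
  then have "K \<ge> 1" using assms(2) by linarith
  \<comment> \<open>The smallest base in which sums of K frequencies have no carries by the digit
    argument, which asks for K < B.\<close>
  define B where "B = Suc K"
  have B: "B > 1" "K < B" using \<open>K \<ge> 1\<close> by (auto simp: B_def)
  define n m where "n i = int (B ^ (2 * i))" and "m j = int (B ^ (2 * j + 1))" for i j :: nat
  have freq: "n i + m j = freq B i j" for i j by (simp add: n_def m_def freq_def)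
  have nm: "inj n" "inj m" using B by (auto simp: inj_def n_def m_def power_inject_exp)
  have inj: "inj (case_prod (freq B))" using freq_inject[OF B(1)] by (auto simp: inj_def)
  define \<psi> where "\<psi> k = (if k \<in> range (case_prod (freq B))
    then complex_of_real (case_prod walsh (inv (case_prod (freq B)) k)) else 0)" for k
  have \<psi>: "\<psi> (n i + m j) = of_real (walsh i j)" for i j
    using inv_f_f[OF inj, of "(i, j)"] by (force simp: \<psi>_def freq)
  have \<psi>0: "\<psi> k = 0" if "k \<notin> range (case_prod (freq B))" for k using that by (simp add: \<psi>_def)
  have \<psi>1: "cmod (\<psi> k) \<le> 1" for k
    by (simp add: \<psi>_def split: prod.split)
  have "bounded_mult_Lp 0 p (\<lambda>q. \<psi> (fst q))"
    by (rule bounded_mult_classical[OF assms(2), where A = "real K ^ 4"])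
       (auto intro: lacunary_multiplier_bounded[OF assms(2) K B(2) \<psi>0 \<psi>1])
  moreover have "\<not> bounded_mult_Lp \<theta> p (\<lambda>q. \<psi> (fst q))"
  proof
    assume "bounded_mult_Lp \<theta> p (\<lambda>q. \<psi> (fst q))"
    then obtain C where C: "\<And>a. nc_poly a \<Longrightarrow> nc_Lp_norm \<theta> p (fourier_mult (\<lambda>q. \<psi> (fst q)) a) \<le> C * nc_Lp_norm \<theta> p a"
      unfolding bounded_mult_Lp_def by blast
    define e where "e = \<bar>1 / 2 - 1 / p\<bar>"
    have "e > 0" using assms by (simp add: e_def field_simps)
    then have "2 powr e > 1" by simp
    then obtain r where "C < (2 powr e) ^ r" using real_arch_pow by blast
    also have "(2 powr e) ^ r = (2 ^ r) powr e"
      by (simp add: powr_powr mult.commute flip: powr_realpow)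
    also have "\<dots> \<le> C"
      unfolding e_def using assms(2) by (intro bounded_mult_imp_walsh_bound[OF assms(1) _ nm \<psi> C]) auto
    finally show False by simp
  qed
  ultimately show ?thesis by blast
qed

end
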